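(* If $(n;H_1,\dots,H_m)\in\mathcal{C}_{X_m,1,2}$, then there exist non-negative integers $\alpha_0,\alpha_1$ with $\alpha_0\ge\max_{1\le i\le m}d_{0,i}$ and $2\alpha_0+\alpha_1\ge\max_{1\le i\le m}(2d_{0,i}+d_{1,i})$ such that $$\sum_{i=1}^m d_{0,i}-(m-1)\alpha_0\ge0\quad\text{and}\quad\Big(\sum_{i=1}^m d_{0,i}-(m-1)\alpha_0\Big)+\Big(\sum_{i=1}^m\min(d_{1,i},\alpha_1)-(m-2)\alpha_1\Big)\ge0.$$
   Context: Fix a prime $p$; $\mathbb{Z}_p$ is the $p$-adic integers; $\overline{\mathbb{Z}}_{\ge1}=\mathbb{Z}_{\ge1}\cup\{\infty\}$, $p^\infty=0$. $X_m=\{x_1,\dots,x_m\}$ is an ordered subset of $\mathbb{Z}_p$ of size $m$ with pairwise distinct reductions mod $p$. $\mathcal{M}_{\mathbb{Z}_p}$: isomorphism classes of finitely generated $\mathbb{Z}_p$-modules; $s(H)=\dim_{\mathbb{F}_p}(H/pH)$. $\mathcal{B}_m:=\{(n;H_1,\dots,H_m)\in\mathbb{Z}_{\ge0}\times\mathcal{M}_{\mathbb{Z}_p}^m: n\ge s(H_i)\ \forall i\}$; write $H_i\cong\prod_{r\in\overline{\mathbb{Z}}_{\ge1}}(\mathbb{Z}_p/p^r\mathbb{Z}_p)^{d_{r,i}}$ and $d_{0,i}:=n-\sum_{r\in\overline{\mathbb{Z}}_{\ge1}}d_{r,i}$. A first integral is a polynomial in $\operatorname{M}_n(\mathbb{Z}_p)[t]$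 of the form $A_0+tA_1+pt^2A_2+\dots+p^rt^{r+1}A_{r+1}$. $\mathcal{C}_{X_m,1,2}$ is the set of $(n;H_1,\dots,H_m)\in\mathcal{B}_m$ such that some first integral $P(t)\in\operatorname{M}_n(\mathbb{Z}_p)[t]$ satisfies $\operatorname{cok}_{\mathbb{Z}_p/p^2\mathbb{Z}_p}(P(x_i))\cong H_i/p^2H_i$ for all $i$, where $\operatorname{cok}_{\mathbb{Z}_p/p^2\mathbb{Z}_p}$ is the cokernel of the reduction mod $p^2$ as a $\mathbb{Z}_p/p^2\mathbb{Z}_p$-module. *)

theory Defs
  imports
    "HOL-Computational_Algebra.Primes"
    "HOL-Library.Extended_Nat"
    "HOL-Algebra.QuotRing"
    "HOL-Algebra.UnivPoly"
    "Jordan_Normal_Form.Missing_VectorSpace"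
begin

section \<open>The ring of p-adic integers\<close>

text \<open>A p-adic integer is a compatible sequence of residues: entry \<open>k\<close> is the canonical
  representative of the class modulo \<open>p ^ k\<close>, so that the ring is the inverse limit of the
  rings of integers modulo \<open>p ^ k\<close>.\<close>

type_synonym padic = "nat \<Rightarrow> int"

definition padic_int :: "int \<Rightarrow> padic ring" where
  "padic_int p =
    \<lparr>carrier = {x. \<forall>k. x k \<in> {0..<p ^ k} \<and> x (Suc k) mod p ^ k = x k},
     mult = (\<lambda>x y k. (x k * y k) mod p ^ k),
     one = (\<lambda>k. 1 mod p ^ k),
     zero = (\<lambda>k. 0),
     add = (\<lambda>x y k. (x k + y k) mod p ^ k)\<rparr>"

lemma padic_int_cring:
  assumes "p > 1"
  shows "cring (padic_int p)"
proof (intro cringI abelian_groupI comm_monoidI)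
  have pk: "p ^ k dvd p ^ Suc k" for k by simp
  have cl: "(a mod p ^ Suc k) mod p ^ k = a mod p ^ k" for a k
    using pk by (rule mod_mod_cancel)
  have pos: "p ^ k > 0" for k using assms by simp
  { fix x y assume xy: "x \<in> carrier (padic_int p)" "y \<in> carrier (padic_int p)"
    have "x (Suc k) mod p ^ k = x k" "y (Suc k) mod p ^ k = y k" for k using xy by (auto simp: padic_int_def)
    then have "(x (Suc k) + y (Suc k)) mod p ^ k = (x k + y k) mod p ^ k"
     "(x (Suc k) * y (Suc k)) mod p ^ k = (x k * y k) mod p ^ k" for k
      by (metis mod_add_eq, metis mod_mult_eq)
    then show "x \<oplus>\<^bsub>padic_int p\<^esub> y \<in> carrier (padic_int p)" "x \<otimes>\<^bsub>padic_int p\<^esub> y \<in> carrier (padic_int p)"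
      using pos cl by (auto simp: padic_int_def simp del: power_Suc) }
  { fix x assume x: "x \<in> carrier (padic_int p)"
    have c: "x (Suc k) mod p ^ k = x k" for k using x by (auto simp: padic_int_def)
    have "(- x (Suc k)) mod p ^ k = (- x k) mod p ^ k" for k using c[of k] by (metis mod_minus_eq)
    then have "(\<lambda>k. (- x k) mod p ^ k) \<in> carrier (padic_int p)"
      using pos cl by (auto simp: padic_int_def simp del: power_Suc)
    then show "\<exists>y\<in>carrier (padic_int p). y \<oplus>\<^bsub>padic_int p\<^esub> x = \<zero>\<^bsub>padic_int p\<^esub>"
      by (rule bexI[rotated]) (auto simp: padic_int_def mod_simps) }
  show "\<one>\<^bsub>padic_int p\<^esub> \<in> carrier (padic_int p)" "\<zero>\<^bsub>padic_int p\<^esub> \<in> carrier (padic_int p)"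
    using pos cl by (auto simp: padic_int_def simp del: power_Suc)
qed (use assms in \<open>auto simp: padic_int_def mod_simps algebra_simps fun_eq_iff\<close>)

definition padic_of_int :: "int \<Rightarrow> int \<Rightarrow> padic" where
  "padic_of_int p a = (\<lambda>k. a mod p ^ k)"

text \<open>The power \<open>p\<^sup>r\<close> as a p-adic integer, with the convention that it is \<open>0\<close> for \<open>r = \<infinity>\<close>.\<close>

definition p_power :: "int \<Rightarrow> enat \<Rightarrow> padic" where
  "p_power p r = (case r of enat k \<Rightarrow> padic_of_int p (p ^ k) | \<infinity> \<Rightarrow> \<zero>\<^bsub>padic_int p\<^esub>)"

definition p_ideal :: "int \<Rightarrow> enat \<Rightarrow> padic set" where
  "p_ideal p r = PIdl\<^bsub>padic_int p\<^esub> (p_power p r)"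

definition padic_mod :: "int \<Rightarrow> enat \<Rightarrow> padic set ring" where
  "padic_mod p r = padic_int p Quot p_ideal p r"

definition padic_reduce :: "int \<Rightarrow> enat \<Rightarrow> padic \<Rightarrow> padic set" where
  "padic_reduce p r x = p_ideal p r +>\<^bsub>padic_int p\<^esub> x"


section \<open>Modules\<close>

text \<open>A module record also carries the fields \<open>mult\<close> and \<open>one\<close> of a ring, which the module axioms
  ignore; below they are filled in arbitrarily.\<close>

definition regular_module :: "('a, 'e) ring_scheme \<Rightarrow> ('a, 'a) module" where
  "regular_module R =
    \<lparr>carrier = carrier R, mult = mult R, one = one R, zero = zero R, add = add R, smult = mult R\<rparr>"

definition quot_module :: "('a, 'b, 'e) module_scheme \<Rightarrow> 'b set \<Rightarrow> ('a, 'b set) module" where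
  "quot_module M N =
    \<lparr>carrier = a_rcosets\<^bsub>M\<^esub> N, mult = (\<lambda>_ _. N), one = N, zero = N, add = set_add M,
     smult = (\<lambda>a X. \<Union>x\<in>X. N +>\<^bsub>M\<^esub> (a \<odot>\<^bsub>M\<^esub> x))\<rparr>"

definition prod_module :: "'i set \<Rightarrow> ('i \<Rightarrow> ('a, 'b, 'e) module_scheme) \<Rightarrow> ('a, 'i \<Rightarrow> 'b) module" where
  "prod_module I M =
    \<lparr>carrier = (\<Pi>\<^sub>E i\<in>I. carrier (M i)),
     mult = (\<lambda>_ _. \<lambda>i\<in>I. \<zero>\<^bsub>M i\<^esub>),
     one = (\<lambda>i\<in>I. \<zero>\<^bsub>M i\<^esub>),
     zero = (\<lambda>i\<in>I. \<zero>\<^bsub>M i\<^esub>),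
     add = (\<lambda>f g. \<lambda>i\<in>I. f i \<oplus>\<^bsub>M i\<^esub> g i),
     smult = (\<lambda>a f. \<lambda>i\<in>I. a \<odot>\<^bsub>M i\<^esub> f i)\<rparr>"

definition module_isomorphic ::
  "('a, 'e) ring_scheme \<Rightarrow> ('a, 'b, 'f) module_scheme \<Rightarrow> ('a, 'c, 'g) module_scheme \<Rightarrow> bool" where
  "module_isomorphic R M N \<longleftrightarrow> (\<exists>f\<in>module_hom R M N. bij_betw f (carrier M) (carrier N))"

definition fg_module :: "('a, 'e) ring_scheme \<Rightarrow> ('a, 'b, 'f) module_scheme \<Rightarrow> bool" where
  "fg_module R M \<longleftrightarrow> module R M \<and>
    (\<exists>S. finite S \<and> S \<subseteq> carrier M \<and> module.span R M S = carrier M)"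

text \<open>The quotient of \<open>H\<close> by \<open>p\<^sup>k H\<close>, as a module over the ring of p-adic integers modulo \<open>p\<^sup>k\<close>:
  scalars and vectors are both cosets, and they are multiplied through representatives.\<close>

definition module_mod :: "int \<Rightarrow> nat \<Rightarrow> (padic, 'b, 'e) module_scheme \<Rightarrow> (padic set, 'b set) module" where
  "module_mod p k H =
    (let N = (\<lambda>x. p_power p k \<odot>\<^bsub>H\<^esub> x) ` carrier H in
     \<lparr>carrier = a_rcosets\<^bsub>H\<^esub> N, mult = (\<lambda>_ _. N), one = N, zero = N, add = set_add H,
      smult = (\<lambda>A X. \<Union>a\<in>A. \<Union>x\<in>X. N +>\<^bsub>H\<^esub> (a \<odot>\<^bsub>H\<^esub> x))\<rparr>)"

definition s_rank :: "int \<Rightarrow> (padic, 'b, 'e) module_scheme \<Rightarrow> nat" where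
  "s_rank p H = vectorspace.dim (padic_mod p 1) (module_mod p 1 H)"

text \<open>\<open>has_type p H d\<close>: \<open>H\<close> is isomorphic to the product over \<open>r \<in> {1, 2, \<dots>, \<infinity>}\<close> of \<open>d r\<close> copies of
  the cyclic module of p-adic integers modulo \<open>p\<^sup>r\<close>, only finitely many of the \<open>d r\<close> being nonzero
  (automatic for finitely generated \<open>H\<close>). The value \<open>d 0\<close> is irrelevant.\<close>

definition has_type :: "int \<Rightarrow> (padic, 'b, 'e) module_scheme \<Rightarrow> (enat \<Rightarrow> nat) \<Rightarrow> bool" where
  "has_type p H d \<longleftrightarrow> finite {r. 1 \<le> r \<and> d r \<noteq> 0} \<and>
    module_isomorphic (padic_int p) H
      (prod_module {(r, j). 1 \<le> r \<and> j < d r}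
        (\<lambda>(r, j). quot_module (regular_module (padic_int p)) (p_ideal p r)))"

definition type_defect :: "nat \<Rightarrow> (enat \<Rightarrow> nat) \<Rightarrow> int" where
  "type_defect n d = int n - int (\<Sum>r | 1 \<le> r \<and> d r \<noteq> 0. d r)"


section \<open>Matrices and matrix polynomials\<close>

type_synonym 'a matrix = "nat \<times> nat \<Rightarrow> 'a"

definition mat_ring :: "('a, 'e) ring_scheme \<Rightarrow> nat \<Rightarrow> 'a matrix ring" where
  "mat_ring R n =
    \<lparr>carrier = {..<n} \<times> {..<n} \<rightarrow>\<^sub>E carrier R,
     mult = (\<lambda>A B. \<lambda>(i, j)\<in>{..<n} \<times> {..<n}. \<Oplus>\<^bsub>R\<^esub>k\<in>{..<n}. A (i, k) \<otimes>\<^bsub>R\<^esub> B (k, j)),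
     one = (\<lambda>(i, j)\<in>{..<n} \<times> {..<n}. if i = j then \<one>\<^bsub>R\<^esub> else \<zero>\<^bsub>R\<^esub>),
     zero = (\<lambda>(i, j)\<in>{..<n} \<times> {..<n}. \<zero>\<^bsub>R\<^esub>),
     add = (\<lambda>A B. \<lambda>(i, j)\<in>{..<n} \<times> {..<n}. A (i, j) \<oplus>\<^bsub>R\<^esub> B (i, j))\<rparr>"

definition mat_smult :: "('a, 'e) ring_scheme \<Rightarrow> nat \<Rightarrow> 'a \<Rightarrow> 'a matrix \<Rightarrow> 'a matrix" where
  "mat_smult R n a A = (\<lambda>(i, j)\<in>{..<n} \<times> {..<n}. a \<otimes>\<^bsub>R\<^esub> A (i, j))"

text \<open>Evaluation of a matrix polynomial at a scalar \<open>x\<close>, that is, at the scalar matrix with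
  diagonal entries \<open>x\<close>.\<close>

definition mat_poly_eval :: "('a, 'e) ring_scheme \<Rightarrow> nat \<Rightarrow> (nat \<Rightarrow> 'a matrix) \<Rightarrow> 'a \<Rightarrow> 'a matrix" where
  "mat_poly_eval R n P x =
    UnivPoly.eval (mat_ring R n) (mat_ring R n) (\<lambda>A. A) (mat_smult R n x \<one>\<^bsub>mat_ring R n\<^esub>) P"

definition first_integral :: "int \<Rightarrow> nat \<Rightarrow> (nat \<Rightarrow> padic matrix) \<Rightarrow> bool" where
  "first_integral p n P \<longleftrightarrow> P \<in> carrier (UP (mat_ring (padic_int p) n)) \<and>
    (\<exists>r A. (\<forall>k. A k \<in> carrier (mat_ring (padic_int p) n)) \<and>
      P = (\<lambda>k. if k = 0 then A 0
               else if k \<le> r + 1 then mat_smult (padic_int p) n (p_power p (enat (k - 1))) (A k)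
               else \<zero>\<^bsub>mat_ring (padic_int p) n\<^esub>))"

definition mat_apply :: "('a, 'e) ring_scheme \<Rightarrow> nat \<Rightarrow> 'a matrix \<Rightarrow> (nat \<Rightarrow> 'a) \<Rightarrow> nat \<Rightarrow> 'a" where
  "mat_apply R n A v = (\<lambda>i\<in>{..<n}. \<Oplus>\<^bsub>R\<^esub>j\<in>{..<n}. A (i, j) \<otimes>\<^bsub>R\<^esub> v j)"

definition cokernel :: "('a, 'e) ring_scheme \<Rightarrow> nat \<Rightarrow> 'a matrix \<Rightarrow> ('a, (nat \<Rightarrow> 'a) set) module" where
  "cokernel R n A =
    quot_module (ring.func_space R {..<n}) (mat_apply R n A ` carrier (ring.func_space R {..<n}))"

definition cokernel_mod :: "int \<Rightarrow> nat \<Rightarrow> nat \<Rightarrow> padic matrix \<Rightarrow> (padic set, (nat \<Rightarrow> padic set) set) module" where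
  "cokernel_mod p k n A =
    cokernel (padic_mod p k) n (\<lambda>(i, j)\<in>{..<n} \<times> {..<n}. padic_reduce p k (A (i, j)))"


section \<open>The sets of tuples\<close>

text \<open>Isomorphism classes of modules are given by representatives \<open>H 1, \<dots>, H m\<close>; all conditions
  below are invariant under isomorphism.\<close>

definition B_set :: "int \<Rightarrow> nat \<Rightarrow> (nat \<times> (nat \<Rightarrow> (padic, 'h) module)) set" where
  "B_set p m = {(n, H). \<forall>i\<in>{1..m}. fg_module (padic_int p) (H i) \<and> s_rank p (H i) \<le> n}"

definition C_set :: "int \<Rightarrow> nat \<Rightarrow> (nat \<Rightarrow> padic) \<Rightarrow> (nat \<times> (nat \<Rightarrow> (padic, 'h) module)) set" where
  "C_set p m x = {(n, H). (n, H) \<in> B_set p m \<and>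
    (\<exists>P. first_integral p n P \<and>
      (\<forall>i\<in>{1..m}. module_isomorphic (padic_mod p 2)
        (cokernel_mod p 2 n (mat_poly_eval (padic_int p) n P (x i)))
        (module_mod p 2 (H i))))}"

end

theory Submission
  imports Defs "Jordan_Normal_Form.Determinant"
begin

text \<open>Modulo \<open>p\<^sup>2\<close> a first integral is \<open>A0 + t A1 + p t\<^sup>2 A2\<close>, which lifts to a matrix \<open>P\<close> over the
  polynomial ring \<open>\<int>[t]\<close>. Multiplying \<open>P\<close> from the left by a matrix whose determinant is not divisible
  by the prime element \<open>p\<close> of \<open>\<int>[t]\<close>, one can make \<open>\<alpha>0\<close> rows, and then \<open>p\<close> times \<open>\<alpha>1\<close> further rows,
  out of rows that are independent modulo \<open>p\<close>, the remaining rows being divisible by \<open>p\<^sup>2\<close>. So all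
  minors of size \<open>\<alpha>0 + j\<close> are divisible by \<open>p ^ j\<close>, and for \<open>\<beta> = 0\<close> and for \<open>\<beta> = \<alpha>1\<close> some minor of size
  \<open>\<alpha>0 + \<beta>\<close> is \<open>p ^ \<beta> g\<close> with \<open>g\<close> nonzero modulo \<open>p\<close>. Each factor \<open>p\<close> raises the degree in \<open>t\<close> by at most
  one, so \<open>g\<close> modulo \<open>p\<close> has degree at most \<open>\<alpha>0 + 2 \<beta>\<close>. On the other hand, the type of \<open>H i\<close> is that of
  \<open>P (x i)\<close>, which forces \<open>g\<close> modulo \<open>p\<close> to vanish at \<open>x i\<close> to order at least
  \<open>\<alpha>0 - d0 i + (\<beta> - min (d1 i) \<beta>)\<close>. Counting roots gives both inequalities.\<close>

section \<open>Determinants as multilinear functions\<close>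

text \<open>Behind the row operations stands the localization of \<int>[t] at the prime
  \<open>p\<close>, a discrete valuation ring: \<alpha>0 and \<alpha>1 count the elementary divisors
  1 and \<open>p\<close> of \<open>P\<close> there. Elements prime to \<open>p\<close> are never
  inverted; they are multiplied in as denominators and cancelled at the end, so determinants such as
  \<open>fdet n T\<close> occur as factors throughout. The lower bounds on \<alpha>0 and 2 \<alpha>0
  + \<alpha>1 hold because substituting an integer for \<open>t\<close> cannot make a minor less
  divisible by \<open>p\<close>. The order of vanishing is the hard point. The reduction over
  \<int>[t] and the reduction at a point \<open>x i\<close> are unrelated: the first forces
  p^\<beta> into every minor of size \<alpha>0 + \<beta>, the second forces powers of t - x_i, and
  both are needed at once. The argument therefore works in the ideal generated by p^(\<beta>+1) and
  p^\<beta> (t - x_i)^N, where a term may lose factors t - x_i only if it gains a further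
  \<open>p\<close>. Comparing the total order of vanishing with the degree bound \<alpha>0 + 2
  \<beta> gives the first inequality for \<beta> = 0 and the second for \<beta> = \<alpha>1.\<close>

definition fdet :: "nat \<Rightarrow> (nat \<Rightarrow> nat \<Rightarrow> 'a :: comm_ring_1) \<Rightarrow> 'a" where
  "fdet k M = det (mat k k (\<lambda>(i, j). M i j))"

lemma fdet_leibniz:
  "fdet k M = (\<Sum>\<pi> | \<pi> permutes {0..<k}. signof \<pi> * (\<Prod>i = 0..<k. M i (\<pi> i)))"
  unfolding fdet_def det_def by (auto intro!: sum.cong arg_cong2[of _ _ _ _ "(*)"] prod.cong)

lemma fdet_cong:
  assumes "\<And>i j. i < k \<Longrightarrow> j < k \<Longrightarrow> M i j = N i j"
  shows "fdet k M = fdet k N"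
  unfolding fdet_def using assms by (intro arg_cong[of _ _ det] cong_mat) auto

lemma fdet_expand_rows:
  assumes "\<And>i. i < k \<Longrightarrow> finite (L i)"
  shows "fdet k (\<lambda>i j. \<Sum>l\<in>L i. X i l j) = (\<Sum>h\<in>PiE {0..<k} L. fdet k (\<lambda>i j. X i (h i) j))"
proof -
  have "(\<Prod>i = 0..<k. \<Sum>l\<in>L i. X i l (\<pi> i)) = (\<Sum>h\<in>PiE {0..<k} L. \<Prod>i = 0..<k. X i (h i) (\<pi> i))" for \<pi>
    using assms by (intro prod_sum_PiE) auto
  then show ?thesis unfolding fdet_leibniz
    by (simp add: sum_distrib_left) (rule sum.swap)
qed

lemma fdet_scale_rows: "fdet k (\<lambda>i j. q i * M i j) = (\<Prod>i<k. q i) * fdet k M"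
  unfolding fdet_leibniz sum_distrib_left
  by (intro sum.cong) (auto simp: prod.distrib lessThan_atLeast0 algebra_simps)

lemma fdet_dvd_rows:
  assumes "\<And>i j. i < k \<Longrightarrow> j < k \<Longrightarrow> q i dvd M i j"
  shows "(\<Prod>i<k. q i) dvd fdet k M"
proof -
  obtain N where N: "\<And>i j. i < k \<Longrightarrow> j < k \<Longrightarrow> M i j = q i * N i j"
    using assms unfolding dvd_def by metis
  have "fdet k M = fdet k (\<lambda>i j. q i * N i j)" by (rule fdet_cong) (use N in auto)
  then show ?thesis by (simp add: fdet_scale_rows)
qed

lemma fdet_equal_rows:
  assumes "i < k" "j < k" "i \<noteq> j" "\<And>l. l < k \<Longrightarrow> M i l = M j l"
  shows "fdet k M = 0"
  unfolding fdet_def using assms by (intro det_identical_rows[of _ k i j]) (auto intro!: eq_vecI)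

text \<open>Laplace expansion along row \<open>r\<close>: the cofactors do not involve that row, so
  one \<open>C\<close> serves every \<open>v\<close>.\<close>

lemma fdet_linear_row:
  assumes "r < k"
  shows "\<exists>C. \<forall>v. fdet k (\<lambda>i j. if i = r then v j else M i j) = (\<Sum>j<k. v j * C j)"
proof -
  define A where "A v = mat k k (\<lambda>(i, j). if i = r then v j else M i j)" for v
  have "det (A v) = (\<Sum>j<k. v j * cofactor (A (\<lambda>_. 0)) r j)" for v
  proof -
    have "mat_delete (A v) r j = mat_delete (A (\<lambda>_. 0)) r j" if "j < k" for j
      by (rule eq_matI) (auto simp: A_def mat_delete_def)
    moreover have "det (A v) = (\<Sum>j<k. A v $$ (r, j) * cofactor (A v) r j)"
      by (rule laplace_expansion_row[OF _ assms]) (simp add: A_def)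
    ultimately show ?thesis using assms by (auto simp: cofactor_def A_def)
  qed
  then show ?thesis unfolding fdet_def A_def by (intro exI allI) auto
qed

text \<open>Laplace expansion along the last column. The value \<open>C r\<close> is singled out
  because it is the old minor in the bordering argument of
  \<open>independent_rows_minor\<close>.\<close>

lemma fdet_linear_last_col:
  "\<exists>C. C r = fdet r M \<and>
     (\<forall>v. fdet (Suc r) (\<lambda>i j. if j = r then v i else M i j) = (\<Sum>i<Suc r. v i * C i))"
proof -
  define A where "A v = mat (Suc r) (Suc r) (\<lambda>(i, j). if j = r then v i else M i j)" for v
  have "det (A v) = (\<Sum>i<Suc r. v i * cofactor (A (\<lambda>_. 0)) i r)" for v
  proof -
    have "mat_delete (A v) i r = mat_delete (A (\<lambda>_. 0)) i r" for i
      by (rule eq_matI) (auto simp: A_def mat_delete_def)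
    moreover have "det (A v) = (\<Sum>i<Suc r. A v $$ (i, r) * cofactor (A v) i r)"
      by (rule laplace_expansion_column) (simp_all add: A_def)
    ultimately show ?thesis by (auto simp: cofactor_def A_def)
  qed
  moreover have "mat_delete (A (\<lambda>_. 0)) r r = mat r r (\<lambda>(i, j). M i j)"
    by (rule eq_matI) (auto simp: A_def mat_delete_def)
  then have "cofactor (A (\<lambda>_. 0)) r r = fdet r M" by (simp add: cofactor_def fdet_def)
  ultimately show ?thesis unfolding fdet_def[of "Suc r"] A_def
    by (intro exI[of _ "\<lambda>i. cofactor (mat (Suc r) (Suc r) (\<lambda>(i, j). if j = r then 0 else M i j)) i r"] conjI allI) auto
qed

text \<open>By linearity in row \<open>r\<close>, since every term with \<open>l \<noteq> r\<close>
  has a repeated row. In row reduction this keeps the determinant prime to \<open>p\<close> as long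
  as the pivot coefficient \<open>c r\<close> is.\<close>

lemma fdet_replace_row:
  assumes "r < k"
  shows "fdet k (\<lambda>i j. if i = r then \<Sum>l<k. c l * M l j else M i j) = c r * fdet k M"
proof -
  obtain C where C: "\<And>v. fdet k (\<lambda>i j. if i = r then v j else M i j) = (\<Sum>j<k. v j * C j)"
    using fdet_linear_row[OF assms] by blast
  have eq: "(\<Sum>j<k. M l j * C j) = (if l = r then fdet k M else 0)" if "l < k" for l
  proof (cases "l = r")
    case True then show ?thesis unfolding C[symmetric] by (auto intro: fdet_cong)
  next
    case False then show ?thesis unfolding C[symmetric] using that assms
      by (auto intro!: fdet_equal_rows[of r k l])
  qed
  have "fdet k (\<lambda>i j. if i = r then \<Sum>l<k. c l * M l j else M i j) = (\<Sum>l<k. c l * (\<Sum>j<k. M l j * C j))"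
    unfolding C by (simp add: sum_distrib_left sum_distrib_right mult.assoc) (rule sum.swap)
  also have "\<dots> = (\<Sum>l<k. if l = r then c r * fdet k M else 0)" by (intro sum.cong) (auto simp: eq)
  finally show ?thesis using assms by simp
qed

lemma fdet_adjugate:
  "\<exists>A. \<forall>i<k. \<forall>j<k. (\<Sum>l<k. A i l * M l j) = (if i = j then fdet k M else 0) \<and>
                    (\<Sum>l<k. M i l * A l j) = (if i = j then fdet k M else 0)"
proof -
  let ?M = "mat k k (\<lambda>(i, j). M i j)"
  have c: "adj_mat ?M \<in> carrier_mat k k" by (rule adj_mat) simp
  have "(\<Sum>l<k. adj_mat ?M $$ (i, l) * M l j) = (adj_mat ?M * ?M) $$ (i, j)"
       "(\<Sum>l<k. M i l * adj_mat ?M $$ (l, j)) = (?M * adj_mat ?M) $$ (i, j)" if "i < k" "j < k" for i j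
    using c that by (auto simp: scalar_prod_def lessThan_atLeast0 intro!: sum.cong)
  then show ?thesis
    using adj_mat(2,3)[of ?M k]
    by (intro exI[of _ "\<lambda>i j. adj_mat ?M $$ (i, j)"]) (auto simp: fdet_def)
qed

lemma fdet_rows_inj:
  assumes "fdet k (\<lambda>i j. M (f i) j) \<noteq> 0"
  shows "inj_on f {..<k}"
  using assms fdet_equal_rows[of _ k _ "\<lambda>i j. M (f i) j"] by (metis inj_onI lessThan_iff)

section \<open>Row reduction and minors modulo a prime element\<close>

text \<open>One notion covers both uses of the expansion into minors: divisibility by a power of
  \<open>p\<close>, and membership in the ideal with generators p^(\<beta>+1) and p^\<beta>
  s^N.\<close>

definition ring_ideal :: "'a :: comm_ring_1 set \<Rightarrow> bool" where
  "ring_ideal I \<longleftrightarrow> 0 \<in> I \<and> (\<forall>x\<in>I. \<forall>y\<in>I. x + y \<in> I) \<and> (\<forall>c. \<forall>x\<in>I. c * x \<in> I)"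

lemma ring_ideal_sum:
  assumes "ring_ideal I" "\<And>i. i \<in> A \<Longrightarrow> f i \<in> I"
  shows "sum f A \<in> I"
  using assms by (induction A rule: infinite_finite_induct) (auto simp: ring_ideal_def)

lemma ring_ideal_multiples: "ring_ideal {x. q dvd x}"
  by (auto simp: ring_ideal_def)

lemma ring_ideal_two_generators: "ring_ideal {x. \<exists>u v. x = a * u + b * v}"
  unfolding ring_ideal_def
proof (intro conjI ballI allI CollectI)
  show "\<exists>u v. 0 = a * u + b * v"
    by (intro exI[of _ 0]) simp
next
  fix x y assume "x \<in> {x. \<exists>u v. x = a * u + b * v}" "y \<in> {x. \<exists>u v. x = a * u + b * v}"
  then obtain u v u' v' where "x = a * u + b * v" "y = a * u' + b * v'" by blast
  then have "x + y = a * (u + u') + b * (v + v')" by (simp add: algebra_simps)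
  then show "\<exists>u v. x + y = a * u + b * v" by blast
next
  fix c x assume "x \<in> {x. \<exists>u v. x = a * u + b * v}"
  then obtain u v where "x = a * u + b * v" by blast
  then have "c * x = a * (c * u) + b * (c * v)" by (simp add: algebra_simps)
  then show "\<exists>u v. c * x = a * u + b * v" by blast
qed

text \<open>The qualitative half of the Cauchy-Binet formula, with \<open>t\<close> as a common
  denominator of the row combinations. The selections \<open>h\<close> need not be injective,
  because the row expansion is not grouped; a repeated row makes the minor 0.\<close>

lemma fdet_rows_in_ideal:
  fixes n :: nat
  assumes I: "ring_ideal I"
    and rows: "\<And>i j. i < k \<Longrightarrow> j < k \<Longrightarrow> t * M i j = (\<Sum>l<n. c i l * Z l j)"
    and Z: "\<And>h. h ` {..<k} \<subseteq> {..<n} \<Longrightarrow> fdet k (\<lambda>i j. Z (h i) j) \<in> I"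
  shows "t ^ k * fdet k M \<in> I"
proof -
  have "t ^ k * fdet k M = fdet k (\<lambda>i j. t * M i j)"
    using fdet_scale_rows[of k "\<lambda>_. t" M] by simp
  also have "\<dots> = fdet k (\<lambda>i j. \<Sum>l<n. c i l * Z l j)"
    by (rule fdet_cong) (rule rows)
  also have "\<dots> = (\<Sum>h\<in>{0..<k} \<rightarrow>\<^sub>E {..<n}. fdet k (\<lambda>i j. c i (h i) * Z (h i) j))"
    by (rule fdet_expand_rows) simp
  also have "\<dots> \<in> I"
  proof (rule ring_ideal_sum[OF I])
    fix h assume "h \<in> {0..<k} \<rightarrow>\<^sub>E {..<n}"
    then have "fdet k (\<lambda>i j. Z (h i) j) \<in> I" by (intro Z) auto
    then show "fdet k (\<lambda>i j. c i (h i) * Z (h i) j) \<in> I"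
      using I by (simp add: fdet_scale_rows ring_ideal_def)
  qed
  finally show ?thesis .
qed

text \<open>The adjugate of \<open>T\<close> recovers \<open>x\<close> from T x up to
  \<open>fdet n T\<close>, which then serves as the denominator \<open>t\<close> of
  \<open>fdet_rows_in_ideal\<close>.\<close>

lemma fdet_invert_rows:
  "\<exists>A. \<forall>x. \<forall>i<n. (\<Sum>l<n. A i l * (\<Sum>a<n. T l a * x a)) = fdet n T * x i"
proof -
  obtain A where A: "\<And>i j. i < n \<Longrightarrow> j < n \<Longrightarrow> (\<Sum>l<n. A i l * T l j) = (if i = j then fdet n T else 0)"
    using fdet_adjugate[of n T] by blast
  have "(\<Sum>l<n. A i l * (\<Sum>a<n. T l a * x a)) = fdet n T * x i" if "i < n" for x i
  proof -
    have "(\<Sum>l<n. A i l * (\<Sum>a<n. T l a * x a)) = (\<Sum>a<n. (\<Sum>l<n. A i l * T l a) * x a)"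
      by (simp add: sum_distrib_left sum_distrib_right mult.assoc) (rule sum.swap)
    also have "\<dots> = (\<Sum>a<n. if a = i then fdet n T * x i else 0)"
      by (intro sum.cong) (auto simp: A that)
    finally show ?thesis using that by simp
  qed
  then show ?thesis by blast
qed

lemma prime_elem_power_dvd_cancel:
  fixes p :: "'a :: idom"
  assumes p: "prime_elem p" and a: "\<not> p dvd a" and "p ^ w dvd a * x"
  shows "p ^ w dvd x"
  using assms(3)
proof (induction w arbitrary: x)
  case 0
  show ?case by simp
next
  case (Suc w)
  have "p dvd p ^ Suc w" unfolding power_Suc by (rule dvd_triv_left)
  then have "p dvd a * x" using Suc.prems by (rule dvd_trans)
  then have "p dvd x" using p a prime_elem_dvd_multD by blast
  then obtain y where y: "x = p * y" by (rule dvdE)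
  have "p * p ^ w dvd p * (a * y)"
    using Suc.prems unfolding y by (simp only: power_Suc mult.left_commute)
  moreover have "p \<noteq> 0" using p unfolding prime_elem_def by blast
  ultimately have "p ^ w dvd a * y" by (simp only: dvd_mult_cancel_left) blast
  then have "p ^ w dvd y" by (rule Suc.IH)
  then show ?case unfolding y power_Suc by (rule mult_dvd_mono[OF dvd_refl])
qed

lemma prime_elem_not_dvd_power:
  assumes "prime_elem p" "\<not> p dvd a"
  shows "\<not> p dvd a ^ k"
  using assms prime_elem_dvd_power by blast

text \<open>Over the localization at \<open>p\<close>, \<open>T\<close> is invertible and the
  exponents \<open>e i < K\<close> are those of the elementary divisors of \<open>P\<close> below
  p^K. Rows with \<open>e i = K\<close> are left out of the independence condition: they stand for
  everything divisible by p^K. Independence modulo \<open>p\<close> is stated through coefficients,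
  which avoids forming the quotient ring.\<close>

definition row_reduced ::
  "'a :: comm_ring_1 \<Rightarrow> nat \<Rightarrow> nat \<Rightarrow> nat \<Rightarrow> (nat \<Rightarrow> nat \<Rightarrow> 'a) \<Rightarrow> (nat \<Rightarrow> nat \<Rightarrow> 'a) \<Rightarrow> (nat \<Rightarrow> nat) \<Rightarrow> (nat \<Rightarrow> nat \<Rightarrow> 'a) \<Rightarrow> bool"
  where "row_reduced p K n m P T e N \<longleftrightarrow>
    \<not> p dvd fdet n T \<and> (\<forall>i<n. e i \<le> K) \<and>
    (\<forall>i<n. \<forall>j<m. (\<Sum>l<n. T i l * P l j) = p ^ e i * N i j) \<and>
    (\<forall>c. (\<forall>j<m. p dvd (\<Sum>i | i < n \<and> e i < K. c i * N i j)) \<longrightarrow> (\<forall>i<n. e i < K \<longrightarrow> p dvd c i))"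

lemma row_reducedD:
  assumes "row_reduced p K n m P T e N"
  shows "\<not> p dvd fdet n T"
    and "\<And>i. i < n \<Longrightarrow> e i \<le> K"
    and "\<And>i j. i < n \<Longrightarrow> j < m \<Longrightarrow> (\<Sum>l<n. T i l * P l j) = p ^ e i * N i j"
    and "\<And>c i. (\<And>j. j < m \<Longrightarrow> p dvd (\<Sum>i | i < n \<and> e i < K. c i * N i j)) \<Longrightarrow> i < n \<Longrightarrow> e i < K \<Longrightarrow> p dvd c i"
  using assms unfolding row_reduced_def by blast+

lemma fdet_identity: "fdet n (\<lambda>i j. if i = j then 1 else 0) = 1"
proof -
  have "mat n n (\<lambda>(i, j). if i = j then 1 else 0) = (1\<^sub>m n :: 'a mat)" by (rule eq_matI) auto
  then show ?thesis by (simp add: fdet_def)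
qed

text \<open>Among all ways to extract powers of \<open>p\<close> (at most \<open>p ^ K\<close>) from the rows, one that extracts
  the largest total power leaves rows that are independent modulo \<open>p\<close>.\<close>

lemma row_reduced_exists:
  fixes p :: "'a :: idom"
  assumes p: "prime_elem p"
  shows "\<exists>T e N. row_reduced p K n m P T e N"
proof -
  define Q where "Q s \<longleftrightarrow> (\<exists>T e N. \<not> p dvd fdet n T \<and> (\<forall>i<n. e i \<le> K) \<and>
    (\<forall>i<n. \<forall>j<m. (\<Sum>l<n. T i l * P l j) = p ^ e i * N i j) \<and> s = (\<Sum>i<n. e i))" for s
  have pu: "\<not> p dvd 1" using p unfolding prime_elem_def by blast
  have id: "(\<Sum>l<n. (if i = l then 1 else 0) * P l j) = P i j" if "i < n" for i j
  proof -
    have "(\<Sum>l<n. (if i = l then 1 else 0) * P l j) = (\<Sum>l<n. if i = l then P l j else 0)"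
      by (rule sum.cong) auto
    then show ?thesis using that by simp
  qed
  have Q0: "Q 0" unfolding Q_def
  proof (intro exI conjI allI impI)
    show "\<not> p dvd fdet n (\<lambda>i j. if i = j then 1 else 0)" using pu by (simp only: fdet_identity) simp
    show "(\<Sum>l<n. (if i = l then 1 else 0) * P l j) = p ^ 0 * P i j" if "i < n" for i j
      using id[OF that] by simp
    show "0 = (\<Sum>i<n. 0)" by simp
  qed simp
  have bound: "s \<le> n * K" if Qs: "Q s" for s
  proof -
    obtain e where "\<forall>i<n. e i \<le> K" "s = (\<Sum>i<n. e i)" using Qs unfolding Q_def by blast
    then show ?thesis using sum_bounded_above[of "{..<n}" e K] by simp
  qed
  have "Q (GREATEST s. Q s)" using Q0 bound by (rule GreatestI_nat)
  have max: "s \<le> (GREATEST s. Q s)" if "Q s" for s using that bound by (rule Greatest_le_nat)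
  obtain T e N where T: "\<not> p dvd fdet n T" and e: "\<forall>i<n. e i \<le> K"
    and N: "\<And>i j. i < n \<Longrightarrow> j < m \<Longrightarrow> (\<Sum>l<n. T i l * P l j) = p ^ e i * N i j"
    and s: "(GREATEST s. Q s) = (\<Sum>i<n. e i)"
    using \<open>Q (GREATEST s. Q s)\<close> unfolding Q_def[of "GREATEST s. Q s"] by blast
  have "p dvd c i0" if c: "\<forall>j<m. p dvd (\<Sum>i | i < n \<and> e i < K. c i * N i j)" and i0: "i0 < n" "e i0 < K" for c i0
  proof (rule ccontr)
    assume nd: "\<not> p dvd c i0"
    define B where "B = {i. i < n \<and> e i < K \<and> \<not> p dvd c i}"
    have B: "finite B" "i0 \<in> B" using i0 nd by (auto simp: B_def)
    \<comment> \<open>A row of largest exponent among those that really occur in the relation modulo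
      \<open>p\<close>: replacing it by the combination requires no division by
      \<open>p\<close>.\<close>
    obtain r where r: "r \<in> B" and rmax: "\<And>i. i \<in> B \<Longrightarrow> e i \<le> e r"
    proof -
      have "Max (e ` B) \<in> e ` B" using B by (intro Max_in) auto
      then obtain r where "r \<in> B" "Max (e ` B) = e r" by blast
      then show ?thesis using B(1) Max_ge[of "e ` B"] by (intro that[of r]) auto
    qed
    have rn: "r < n" "e r < K" "\<not> p dvd c r" using r by (auto simp: B_def)
    have "p dvd (\<Sum>i\<in>B. c i * N i j)" if "j < m" for j
    proof -
      have "(\<Sum>i | i < n \<and> e i < K. c i * N i j) =
          (\<Sum>i\<in>{i. i < n \<and> e i < K} - B. c i * N i j) + (\<Sum>i\<in>B. c i * N i j)"
        by (rule sum.subset_diff) (auto simp: B_def)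
      moreover have "p dvd (\<Sum>i\<in>{i. i < n \<and> e i < K} - B. c i * N i j)"
        by (rule dvd_sum) (auto simp: B_def)
      moreover have "p dvd (\<Sum>i | i < n \<and> e i < K. c i * N i j)" using c that by blast
      ultimately show ?thesis by (simp only: dvd_add_right_iff)
    qed
    then obtain w where w: "\<And>j. j < m \<Longrightarrow> (\<Sum>i\<in>B. c i * N i j) = p * w j"
      unfolding dvd_def by metis
    \<comment> \<open>The factor p^(e r - e a) brings every row of the relation to the exponent
      \<open>e r\<close>. The combination is then p^(e r) times a multiple of \<open>p\<close>, so
      row \<open>r\<close> gains a power of \<open>p\<close>, while its own coefficient remains
      \<open>c r\<close>, prime to \<open>p\<close>.\<close>
    define c' where "c' a = (if a \<in> B then c a * p ^ (e r - e a) else 0)" for a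
    define T' where "T' i l = (if i = r then \<Sum>a<n. c' a * T a l else T i l)" for i l
    define N' where "N' i j = (if i = r then w j else N i j)" for i j
    have "fdet n T' = c r * fdet n T"
      unfolding T'_def fdet_replace_row[OF rn(1)] using r by (simp only: c'_def if_True diff_self_eq_0 power_0 mult_1_right)
    then have "\<not> p dvd fdet n T'" using prime_elem_dvd_multD[OF p] T rn(3) by metis
    moreover have "(\<Sum>l<n. T' i l * P l j) = p ^ (e(r := Suc (e r))) i * N' i j" if ij: "i < n" "j < m" for i j
    proof (cases "i = r")
      case True
      have "(\<Sum>l<n. T' r l * P l j) = (\<Sum>a<n. c' a * (\<Sum>l<n. T a l * P l j))"
        by (simp add: T'_def sum_distrib_left sum_distrib_right mult.assoc) (rule sum.swap)
      also have "\<dots> = (\<Sum>a<n. c' a * (p ^ e a * N a j))" by (intro sum.cong) (auto simp: N ij)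
      also have "\<dots> = (\<Sum>a\<in>B. c' a * (p ^ e a * N a j))"
        by (intro sum.mono_neutral_right) (auto simp: B_def c'_def)
      also have "\<dots> = (\<Sum>a\<in>B. p ^ e r * (c a * N a j))"
      proof (intro sum.cong refl)
        fix a assume a: "a \<in> B"
        have "c' a = c a * p ^ (e r - e a)" using a by (simp only: c'_def if_True)
        then have "c' a * (p ^ e a * N a j) = p ^ (e r - e a + e a) * (c a * N a j)"
          by (simp only: power_add mult_ac)
        then show "c' a * (p ^ e a * N a j) = p ^ e r * (c a * N a j)"
          by (simp only: le_add_diff_inverse2[OF rmax[OF a]])
      qed
      also have "\<dots> = p ^ Suc (e r) * w j"
        unfolding sum_distrib_left[symmetric] w[OF ij(2)] by (simp only: power_Suc mult_ac)
      finally show ?thesis using True by (simp add: N'_def)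
    next
      case False
      then show ?thesis using N[OF ij] by (simp add: T'_def N'_def)
    qed
    moreover have "(e(r := Suc (e r))) i \<le> K" if "i < n" for i using e that rn by auto
    ultimately have "Q (\<Sum>i<n. (e(r := Suc (e r))) i)" unfolding Q_def by blast
    then have "(\<Sum>i<n. (e(r := Suc (e r))) i) \<le> (\<Sum>i<n. e i)" unfolding s[symmetric] by (rule max)
    moreover have "(\<Sum>i<n. e i) < (\<Sum>i<n. (e(r := Suc (e r))) i)"
      using rn by (intro sum_strict_mono_ex1) auto
    ultimately show False by simp
  qed
  then have "row_reduced p K n m P T e N" using T e N unfolding row_reduced_def by blast
  then show ?thesis by blast
qed

text \<open>Bordering: a minor prime to \<open>p\<close> is enlarged by one further row
  \<open>i0\<close> and one column. If all enlarged minors were divisible by \<open>p\<close>, the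
  cofactors of the new column would be the coefficients of a relation modulo \<open>p\<close>, and
  the coefficient at \<open>i0\<close> is the old minor.\<close>

lemma independent_rows_minor:
  fixes p :: "'a :: idom"
  assumes p: "prime_elem p" and R: "finite R"
    and ind: "\<And>c. (\<And>j. j < m \<Longrightarrow> p dvd (\<Sum>i\<in>R. c i * N i j)) \<Longrightarrow> \<forall>i\<in>R. p dvd c i"
    and k: "k \<le> card R"
  shows "\<exists>f g. inj_on f {..<k} \<and> f ` {..<k} \<subseteq> R \<and> g ` {..<k} \<subseteq> {..<m} \<and>
    \<not> p dvd fdet k (\<lambda>i j. N (f i) (g j))"
  using k
proof (induction k)
  case 0
  have "\<not> p dvd 1" using p unfolding prime_elem_def by blast
  then show ?case by (auto simp: fdet_leibniz)
next
  case (Suc r)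
  then obtain f g where f: "inj_on f {..<r}" "f ` {..<r} \<subseteq> R" and g: "g ` {..<r} \<subseteq> {..<m}"
    and nd: "\<not> p dvd fdet r (\<lambda>i j. N (f i) (g j))" by auto
  have "card (f ` {..<r}) < card R" using f Suc.prems by (simp add: card_image)
  then obtain i0 where i0: "i0 \<in> R" "i0 \<notin> f ` {..<r}"
    using f(2) by (metis less_irrefl subsetI subset_antisym)
  define F where "F = f(r := i0)"
  have F: "inj_on F {..<Suc r}" "F ` {..<Suc r} \<subseteq> R" "F r = i0"
    using f i0 by (auto simp: F_def inj_on_def lessThan_Suc)
  obtain C where C: "C r = fdet r (\<lambda>i j. N (F i) (g j))"
    "\<And>v. fdet (Suc r) (\<lambda>i j. if j = r then v i else N (F i) (g j)) = (\<Sum>i<Suc r. v i * C i)"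
    using fdet_linear_last_col[of r "\<lambda>i j. N (F i) (g j)"] by blast
  have Cr: "\<not> p dvd C r"
  proof -
    have "C r = fdet r (\<lambda>i j. N (f i) (g j))" unfolding C by (rule fdet_cong) (auto simp: F_def)
    then show ?thesis using nd by simp
  qed
  have "\<exists>j<m. \<not> p dvd (\<Sum>i<Suc r. N (F i) j * C i)"
  proof (rule ccontr)
    assume "\<not> ?thesis"
    then have all: "p dvd (\<Sum>i<Suc r. N (F i) j * C i)" if "j < m" for j using that by blast
    \<comment> \<open>The cofactors, moved to the row indices chosen by \<open>F\<close>, and 0 on
      the rows of \<open>R\<close> that were not chosen.\<close>
    define c where "c i = (if i \<in> F ` {..<Suc r} then C (inv_into {..<Suc r} F i) else 0)" for i
    have cF: "c (F a) = C a" if "a < Suc r" for a using that F(1) by (simp add: c_def)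
    have "(\<Sum>i\<in>R. c i * N i j) = (\<Sum>i<Suc r. N (F i) j * C i)" for j
    proof -
      have "(\<Sum>i\<in>R. c i * N i j) = (\<Sum>i\<in>F ` {..<Suc r}. c i * N i j)"
        by (rule sum.mono_neutral_right) (use R F in \<open>auto simp: c_def\<close>)
      also have "\<dots> = (\<Sum>a<Suc r. c (F a) * N (F a) j)" by (subst sum.reindex[OF F(1)]) simp
      also have "\<dots> = (\<Sum>i<Suc r. N (F i) j * C i)" by (intro sum.cong) (auto simp: cF mult.commute)
      finally show ?thesis .
    qed
    then have "\<forall>i\<in>R. p dvd c i" using all by (intro ind) simp
    then show False using i0 F(3) cF[of r] Cr by auto
  qed
  then obtain j where j: "j < m" "\<not> p dvd (\<Sum>i<Suc r. N (F i) j * C i)" by blast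
  have "fdet (Suc r) (\<lambda>a b. N (F a) ((g(r := j)) b)) = (\<Sum>i<Suc r. N (F i) j * C i)"
    unfolding C(2)[symmetric] by (rule fdet_cong) auto
  then have "\<not> p dvd fdet (Suc r) (\<lambda>a b. N (F a) ((g(r := j)) b))" using j(2) by simp
  moreover have "(g(r := j)) ` {..<Suc r} \<subseteq> {..<m}" using g j by (auto simp: lessThan_Suc)
  ultimately show ?case using F(1,2) by blast
qed

section \<open>Divisibility of minors read off from a row reduction\<close>

lemma sum_inj_image_le:
  fixes w :: "nat \<Rightarrow> nat"
  assumes "inj_on h {..<k}" "h ` {..<k} \<subseteq> {..<n}"
  shows "(\<Sum>i<k. w (h i)) \<le> (\<Sum>l<n. w l)"
proof -
  have "(\<Sum>i<k. w (h i)) = (\<Sum>l\<in>h ` {..<k}. w l)" by (simp add: sum.reindex[OF assms(1)])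
  also have "\<dots> \<le> (\<Sum>l<n. w l)" by (rule sum_mono2) (use assms in auto)
  finally show ?thesis .
qed

text \<open>A minor of T P on distinct rows carries the sum of their exponents. Row \<open>i\<close>
  falls short of \<open>K\<close> by \<open>K - e i\<close>, and \<open>k\<close> distinct rows
  together fall short by at most the total over all rows. Passing from T P back to \<open>P\<close>
  costs only powers of \<open>fdet n T\<close>.\<close>

lemma minors_dvd:
  fixes p :: "'a :: idom"
  assumes p: "prime_elem p" and T: "\<not> p dvd fdet n T" and e: "\<And>i. i < n \<Longrightarrow> e i \<le> K"
    and N: "\<And>i j. i < n \<Longrightarrow> j < m \<Longrightarrow> (\<Sum>l<n. T i l * P l j) = p ^ e i * N i j"
    and f: "f ` {..<k} \<subseteq> {..<n}" and g: "g ` {..<k} \<subseteq> {..<m}"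
  shows "p ^ (k * K - (\<Sum>i<n. K - e i)) dvd fdet k (\<lambda>i j. P (f i) (g j))"
proof -
  let ?w = "k * K - (\<Sum>i<n. K - e i)"
  obtain A where A: "\<And>x i. i < n \<Longrightarrow> (\<Sum>l<n. A i l * (\<Sum>a<n. T l a * x a)) = fdet n T * x i"
    using fdet_invert_rows by blast
  have "fdet n T ^ k * fdet k (\<lambda>i j. P (f i) (g j)) \<in> {x. p ^ ?w dvd x}"
  proof (rule fdet_rows_in_ideal[where n = n and c = "\<lambda>i. A (f i)" and Z = "\<lambda>l j. p ^ e l * N l (g j)"])
    fix i j assume ij: "i < k" "j < k"
    have "fdet n T * P (f i) (g j) = (\<Sum>l<n. A (f i) l * (\<Sum>a<n. T l a * P a (g j)))"
      by (rule A[symmetric]) (use ij f in auto)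
    also have "\<dots> = (\<Sum>l<n. A (f i) l * (p ^ e l * N l (g j)))"
      by (intro sum.cong refl arg_cong2[of _ _ _ _ "(*)"] N) (use ij g in auto)
    finally show "fdet n T * P (f i) (g j) = \<dots>" .
  next
    fix h assume h: "h ` {..<k} \<subseteq> {..<n}"
    have split: "fdet k (\<lambda>i j. p ^ e (h i) * N (h i) (g j)) = p ^ (\<Sum>i<k. e (h i)) * fdet k (\<lambda>i j. N (h i) (g j))"
      by (simp add: fdet_scale_rows power_sum)
    show "fdet k (\<lambda>i j. p ^ e (h i) * N (h i) (g j)) \<in> {x. p ^ ?w dvd x}"
    proof (cases "inj_on h {..<k}")
      case True
      have "(\<Sum>i<k. K - e (h i)) \<le> (\<Sum>i<n. K - e i)"
        using sum_inj_image_le[OF True h, of "\<lambda>l. K - e l"] .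
      moreover have "(\<Sum>i<k. e (h i)) + (\<Sum>i<k. K - e (h i)) = k * K"
      proof -
        have "(\<Sum>i<k. e (h i)) + (\<Sum>i<k. K - e (h i)) = (\<Sum>i<k. K)"
          unfolding sum.distrib[symmetric] by (rule sum.cong) (use e h in auto)
        then show ?thesis by simp
      qed
      ultimately have "?w \<le> (\<Sum>i<k. e (h i))" by linarith
      then show ?thesis unfolding split by (simp add: le_imp_power_dvd)
    next
      case False
      then have "fdet k (\<lambda>i j. N (h i) (g j)) = 0"
        using fdet_rows_inj[of k "\<lambda>a j. N a (g j)" h] by blast
      then show ?thesis unfolding split by simp
    qed
  qed (rule ring_ideal_multiples)
  then show ?thesis
    using prime_elem_power_dvd_cancel[OF p prime_elem_not_dvd_power[OF p T]] by blast
qed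

text \<open>On all rows of T P with exponent below \<open>K'\<close>, the powers of \<open>p\<close>
  multiply to exactly the stated one and leave a minor of \<open>N\<close> prime to
  \<open>p\<close>. This minor of T P is a combination of minors of \<open>P\<close>, so these
  cannot all be more divisible.\<close>

lemma row_reduced_minor:
  fixes p :: "'a :: idom"
  assumes p: "prime_elem p" and red: "row_reduced p K n m P T e N" and K': "K' \<le> K"
    and k: "k = card {i. i < n \<and> e i < K'}"
  shows "\<exists>f g. f ` {..<k} \<subseteq> {..<n} \<and> g ` {..<k} \<subseteq> {..<m} \<and>
    \<not> p ^ Suc (\<Sum>i | i < n \<and> e i < K'. e i) dvd fdet k (\<lambda>i j. P (f i) (g j))"
proof -
  let ?R = "{i. i < n \<and> e i < K'}"
  let ?w = "\<Sum>i\<in>?R. e i"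
  have N: "\<And>i j. i < n \<Longrightarrow> j < m \<Longrightarrow> (\<Sum>l<n. T i l * P l j) = p ^ e i * N i j"
    and ind: "\<And>c i. (\<And>j. j < m \<Longrightarrow> p dvd (\<Sum>i | i < n \<and> e i < K. c i * N i j)) \<Longrightarrow> i < n \<Longrightarrow> e i < K \<Longrightarrow> p dvd c i"
    using red unfolding row_reduced_def by blast+
  have "\<exists>f g. inj_on f {..<k} \<and> f ` {..<k} \<subseteq> ?R \<and> g ` {..<k} \<subseteq> {..<m} \<and> \<not> p dvd fdet k (\<lambda>i j. N (f i) (g j))"
  proof (rule independent_rows_minor[OF p])
    fix c assume c: "\<And>j. j < m \<Longrightarrow> p dvd (\<Sum>i\<in>?R. c i * N i j)"
    \<comment> \<open>Extended by 0, a relation among the rows below \<open>K'\<close> becomes one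
      among the rows below \<open>K\<close>, where independence is known.\<close>
    have "(\<Sum>i | i < n \<and> e i < K. (if e i < K' then c i else 0) * N i j) = (\<Sum>i\<in>?R. c i * N i j)" for j
      using K' by (intro sum.mono_neutral_cong_right) auto
    then have "p dvd (if e i < K' then c i else 0)" if "i < n" "e i < K" for i
      using ind[of "\<lambda>i. if e i < K' then c i else 0"] c that by simp
    then show "\<forall>i\<in>?R. p dvd c i" using K' by fastforce
  qed (use k in auto)
  then obtain f g where f: "inj_on f {..<k}" "f ` {..<k} \<subseteq> ?R" and g: "g ` {..<k} \<subseteq> {..<m}"
    and nd: "\<not> p dvd fdet k (\<lambda>i j. N (f i) (g j))" by blast
  \<comment> \<open>As \<open>k\<close> is the full number of these rows, \<open>f\<close>
    enumerates all of them, which makes the exponent exact.\<close>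
  have fR: "f ` {..<k} = ?R" using f k by (intro card_subset_eq) (auto simp: card_image)
  have TP: "fdet k (\<lambda>i j. \<Sum>l<n. T (f i) l * P l (g j)) = p ^ ?w * fdet k (\<lambda>i j. N (f i) (g j))"
  proof -
    have "fdet k (\<lambda>i j. \<Sum>l<n. T (f i) l * P l (g j)) = fdet k (\<lambda>i j. p ^ e (f i) * N (f i) (g j))"
      by (rule fdet_cong, rule N) (use f g in auto)
    also have "\<dots> = p ^ (\<Sum>i<k. e (f i)) * fdet k (\<lambda>i j. N (f i) (g j))"
      by (simp add: fdet_scale_rows power_sum)
    also have "(\<Sum>i<k. e (f i)) = ?w" unfolding fR[symmetric] by (simp add: sum.reindex[OF f(1)])
    finally show ?thesis .
  qed
  have "\<exists>h. h ` {..<k} \<subseteq> {..<n} \<and> \<not> p ^ Suc ?w dvd fdet k (\<lambda>i j. P (h i) (g j))"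
  proof (rule ccontr)
    assume "\<not> ?thesis"
    then have "fdet k (\<lambda>i j. P (h i) (g j)) \<in> {x. p ^ Suc ?w dvd x}" if "h ` {..<k} \<subseteq> {..<n}" for h
      using that by blast
    then have "1 ^ k * fdet k (\<lambda>i j. \<Sum>l<n. T (f i) l * P l (g j)) \<in> {x. p ^ Suc ?w dvd x}"
      by (intro fdet_rows_in_ideal[OF ring_ideal_multiples, where c = "\<lambda>i. T (f i)" and Z = "\<lambda>l j. P l (g j)"]) auto
    then have "p ^ ?w * p dvd p ^ ?w * fdet k (\<lambda>i j. N (f i) (g j))" by (simp only: TP power_one mult_1_left mem_Collect_eq power_Suc2)
    moreover have "p ^ ?w \<noteq> 0" using p unfolding prime_elem_def by (intro power_not_zero) blast
    ultimately have "p dvd fdet k (\<lambda>i j. N (f i) (g j))" by (simp only: dvd_mult_cancel_left) blast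
    then show False using nd by simp
  qed
  then show ?thesis using g by blast
qed

lemma row_reduced_minorE:
  fixes p :: "'a :: idom"
  assumes "prime_elem p" and red: "row_reduced p K n m P T e N" and "K' \<le> K"
    and "card {i. i < n \<and> e i < K'} = k" and "(\<Sum>i | i < n \<and> e i < K'. e i) = w"
  obtains f g where "f ` {..<k} \<subseteq> {..<n}" and "g ` {..<k} \<subseteq> {..<m}"
    and "\<not> p ^ Suc w dvd fdet k (\<lambda>i j. P (f i) (g j))"
  using row_reduced_minor[OF assms(1,2,3) assms(4)[symmetric]] unfolding assms(5) by blast

section \<open>Combining divisibility by p with divisibility by a second element\<close>

lemma fdet_zero_row:
  assumes "i < k" "\<And>j. j < k \<Longrightarrow> M i j = 0"
  shows "fdet k M = 0"
proof -
  have "(\<Prod>a<k. if a = i then 0 else 1) dvd fdet k M"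
    by (rule fdet_dvd_rows) (use assms in auto)
  moreover have "(\<Prod>a<k. if a = i then 0 else (1 :: 'a)) = 0"
    using assms(1) by (intro prod_zero) auto
  ultimately show ?thesis by simp
qed

lemma prod_if_power:
  fixes k :: nat
  shows
  "(\<Prod>i<k. if Q i then q else (1 :: 'a :: comm_monoid_mult)) = q ^ card {i. i < k \<and> Q i}"
proof -
  have "(\<Prod>i<k. if Q i then q else 1) = (\<Prod>i\<in>{i. i < k \<and> Q i}. q)"
    by (intro prod.mono_neutral_cong_right) auto
  then show ?thesis by simp
qed

text \<open>Modulo \<open>p\<close> the rows in \<open>S\<close> lie, up to the factor
  \<open>t\<close>, in the span of \<open>card L\<close> vectors. A term of the row expansion
  survives only if its selected vectors \<open>Z l\<close> are distinct, so at least
  \<open>card S - card L\<close> rows contribute their part divisible by \<open>p\<close>.\<close>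

lemma low_rank_rows_dvd:
  fixes p :: "'a :: idom"
  assumes p: "prime_elem p" and t: "\<not> p dvd t" and S: "S \<subseteq> {..<k}" and L: "finite L"
    and rows: "\<And>i j. i \<in> S \<Longrightarrow> j < k \<Longrightarrow> t * M i j = (\<Sum>l\<in>L. c i l * Z l j) + p * Y i j"
  shows "p ^ (card S - card L) dvd fdet k M"
proof -
  let ?w = "card S - card L"
  \<comment> \<open>\<open>None\<close> selects the part divisible by \<open>p\<close> of a row in
    \<open>S\<close>, and the untouched row outside \<open>S\<close>; \<open>Some l\<close> selects
    the multiple of \<open>Z l\<close>.\<close>
  define X where "X i l j = (if i \<in> S then case l of None \<Rightarrow> p * Y i j | Some l \<Rightarrow> c i l * Z l j else M i j)" for i l j
  define LL where "LL i = (if i \<in> S then insert None (Some ` L) else {None})" for i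
  have "(\<Prod>i<k. if i \<in> S then t else 1) * fdet k M = fdet k (\<lambda>i j. (if i \<in> S then t else 1) * M i j)"
    by (simp only: fdet_scale_rows)
  also have "\<dots> = fdet k (\<lambda>i j. \<Sum>l\<in>LL i. X i l j)"
    by (rule fdet_cong) (use L rows in \<open>auto simp: LL_def X_def sum.reindex\<close>)
  also have "\<dots> = (\<Sum>h\<in>PiE {0..<k} LL. fdet k (\<lambda>i j. X i (h i) j))"
    by (rule fdet_expand_rows) (use L in \<open>auto simp: LL_def\<close>)
  also have "p ^ ?w dvd \<dots>"
  proof (rule dvd_sum)
    fix h assume h: "h \<in> PiE {0..<k} LL"
    let ?U = "{i \<in> S. h i \<noteq> None}"
    have hU: "h ` ?U \<subseteq> Some ` L" using h S by (fastforce simp: LL_def PiE_def Pi_def)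
    show "p ^ ?w dvd fdet k (\<lambda>i j. X i (h i) j)"
    proof (cases "inj_on h ?U")
      case True
      have fin: "finite S" using finite_subset[OF S] by simp
      have "card ?U \<le> card L"
        using card_inj_on_le[OF True hU] L by (simp add: card_image)
      moreover have "card S = card ?U + card {i. i < k \<and> (i \<in> S \<and> h i = None)}"
        using S fin by (subst card_Un_disjoint[symmetric]) (auto intro!: arg_cong[of _ _ card])
      ultimately have "?w \<le> card {i. i < k \<and> (i \<in> S \<and> h i = None)}" by linarith
      moreover have "p ^ card {i. i < k \<and> (i \<in> S \<and> h i = None)} dvd fdet k (\<lambda>i j. X i (h i) j)"
        unfolding prod_if_power[symmetric] by (rule fdet_dvd_rows) (auto simp: X_def)
      ultimately show ?thesis by (meson dvd_trans le_imp_power_dvd)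
    next
      case False
      then obtain a b where ab: "a \<in> ?U" "b \<in> ?U" "a \<noteq> b" "h a = h b" by (auto simp: inj_on_def)
      \<comment> \<open>Two rows of this term are multiples of the same \<open>Z l\<close>; pulling
        out the scalars \<open>q\<close> leaves equal rows in \<open>W\<close>.\<close>
      define q where "q i = (if i \<in> ?U then c i (the (h i)) else 1)" for i
      define W where "W i j = (if i \<in> ?U then Z (the (h i)) j else X i (h i) j)" for i j
      have "fdet k (\<lambda>i j. X i (h i) j) = fdet k (\<lambda>i j. q i * W i j)"
        by (rule fdet_cong) (auto simp: q_def W_def X_def)
      also have "\<dots> = 0" unfolding fdet_scale_rows
        using ab S by (subst fdet_equal_rows[of a k b]) (auto simp: W_def)
      finally show ?thesis by simp
    qed
  qed
  finally have "p ^ ?w dvd t ^ card {i. i < k \<and> i \<in> S} * fdet k M" by (simp only: prod_if_power)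
  then show ?thesis using prime_elem_power_dvd_cancel[OF p prime_elem_not_dvd_power[OF p t]] by blast
qed


text \<open>Splitting the rows of \<open>U P\<close> into a part divisible by \<open>p\<close> and a part \<open>P0\<close> in which all but
  \<open>d0\<close> rows are divisible by \<open>s\<close>, every product in the row expansion that uses \<open>c\<close> rows of the
  first part is divisible by \<open>p ^ (k - c - \<alpha>0)\<close>, because \<open>P0\<close> agrees with \<open>U P\<close> modulo \<open>p\<close> and hence
  has rank at most \<open>\<alpha>0\<close> there.\<close>

lemma minor_order:
  fixes p s :: "'a :: idom"
  assumes p: "prime_elem p" and s: "\<not> p dvd s"
    and T: "\<not> p dvd fdet n T"
    and N: "\<And>i j. i < n \<Longrightarrow> j < m \<Longrightarrow> (\<Sum>l<n. T i l * P l j) = p ^ e i * N i j"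
    and \<alpha>0: "\<alpha>0 = card {i. i < n \<and> e i = 0}"
    and e': "\<And>i. i < n \<Longrightarrow> e' i \<le> 2"
    and R: "\<And>i j. i < n \<Longrightarrow> j < m \<Longrightarrow> (\<Sum>l<n. U i l * P l j) = p ^ e' i * R i j + s * Q i j"
    and d0: "d0 = card {i. i < n \<and> e' i = 0}" and d1: "d1 = card {i. i < n \<and> e' i = 1}"
    and f: "f ` {..<\<alpha>0 + \<beta>} \<subseteq> {..<n}" and g: "g ` {..<\<alpha>0 + \<beta>} \<subseteq> {..<m}"
  shows "\<exists>u v. fdet n U ^ (\<alpha>0 + \<beta>) * fdet (\<alpha>0 + \<beta>) (\<lambda>i j. P (f i) (g j)) =
    p ^ Suc \<beta> * u + p ^ \<beta> * s ^ (\<alpha>0 + \<beta> - d0 - min d1 \<beta>) * v"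
proof -
  define k where "k = \<alpha>0 + \<beta>"
  \<comment> \<open>After cancelling p^\<beta>, membership in \<open>I\<close> means divisibility by
    the power of \<open>s\<close> modulo \<open>p\<close>. As \<open>I\<close> is an ideal, the
    terms of an expansion can be treated one by one, each falling under one of the two
    generators.\<close>
  define I where "I = {x. \<exists>u v. x = p ^ Suc \<beta> * u + (p ^ \<beta> * s ^ (k - d0 - min d1 \<beta>)) * v}"
  have I: "ring_ideal I" unfolding I_def by (rule ring_ideal_two_generators)
  have I1: "p ^ Suc \<beta> * x \<in> I" for x unfolding I_def by (rule CollectI, rule exI[of _ x], rule exI[of _ 0]) simp
  have I2: "p ^ \<beta> * s ^ (k - d0 - min d1 \<beta>) * x \<in> I" for x
    unfolding I_def by (rule CollectI, rule exI[of _ 0], rule exI[of _ x]) simp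
  define Z where "Z l j = (\<Sum>a<n. U l a * P a (g j))" for l j
  obtain A where A: "\<And>x i. i < n \<Longrightarrow> (\<Sum>l<n. A i l * (\<Sum>a<n. T l a * x a)) = fdet n T * x i"
    using fdet_invert_rows by blast
  obtain A' where A': "\<And>x i. i < n \<Longrightarrow> (\<Sum>l<n. A' i l * (\<Sum>a<n. U l a * x a)) = fdet n U * x i"
    using fdet_invert_rows by blast
  have gj: "g j < m" if "j < k" for j using g that by (auto simp: k_def)
  define B where "B i l = (\<Sum>a<n. U i a * A a l)" for i l
  have TZ: "fdet n T * Z i j = (\<Sum>l<n. B i l * (p ^ e l * N l (g j)))" if ij: "i < n" "j < k" for i j
  proof -
    have "fdet n T * Z i j = (\<Sum>a<n. U i a * (fdet n T * P a (g j)))"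
      by (simp add: Z_def sum_distrib_left algebra_simps)
    also have "\<dots> = (\<Sum>a<n. U i a * (\<Sum>l<n. A a l * (\<Sum>b<n. T l b * P b (g j))))"
      by (intro sum.cong refl arg_cong2[of _ _ _ _ "(*)"]) (simp add: A)
    also have "\<dots> = (\<Sum>a<n. U i a * (\<Sum>l<n. A a l * (p ^ e l * N l (g j))))"
      using ij gj by (intro sum.cong refl arg_cong2[of _ _ _ _ "(*)"] N) auto
    also have "\<dots> = (\<Sum>l<n. B i l * (p ^ e l * N l (g j)))"
      by (simp add: B_def sum_distrib_left sum_distrib_right mult.assoc) (rule sum.swap)
    finally show ?thesis .
  qed
  \<comment> \<open>Modulo \<open>p\<close> only the rows of T P with exponent 0 remain, so up to
    the factor \<open>fdet n T\<close> the rows of \<open>Z\<close> lie modulo \<open>p\<close> in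
    the span of \<alpha>0 vectors.\<close>
  define L where "L = {l. l < n \<and> e l = 0}"
  have TZ2: "fdet n T * Z i j = (\<Sum>l\<in>L. B i l * N l (g j)) +
      p * (\<Sum>l\<in>{..<n} - L. B i l * (p ^ (e l - 1) * N l (g j)))" if ij: "i < n" "j < k" for i j
  proof -
    have "fdet n T * Z i j = (\<Sum>l\<in>{..<n} - L. B i l * (p ^ e l * N l (g j))) + (\<Sum>l\<in>L. B i l * (p ^ e l * N l (g j)))"
      unfolding TZ[OF ij] by (rule sum.subset_diff) (auto simp: L_def)
    also have "(\<Sum>l\<in>L. B i l * (p ^ e l * N l (g j))) = (\<Sum>l\<in>L. B i l * N l (g j))"
      by (rule sum.cong) (auto simp: L_def)
    also have "(\<Sum>l\<in>{..<n} - L. B i l * (p ^ e l * N l (g j))) =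
        p * (\<Sum>l\<in>{..<n} - L. B i l * (p ^ (e l - 1) * N l (g j)))"
      unfolding sum_distrib_left
    proof (rule sum.cong[OF refl])
      fix l assume "l \<in> {..<n} - L"
      then have "p ^ e l = p * p ^ (e l - 1)" by (cases "e l") (auto simp: L_def)
      then show "B i l * (p ^ e l * N l (g j)) = p * (B i l * (p ^ (e l - 1) * N l (g j)))"
        by (simp add: algebra_simps)
    qed
    finally show ?thesis by (simp add: add.commute)
  qed
  have minors: "fdet k (\<lambda>i j. Z (h i) j) \<in> I" if h: "h ` {..<k} \<subseteq> {..<n}" for h
  proof (cases "inj_on h {..<k}")
    case False
    then have "fdet k (\<lambda>i j. Z (h i) j) = 0" using fdet_rows_inj[of k Z h] by blast
    then show ?thesis using I by (simp add: ring_ideal_def)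
  next
    case inj: True
    have hn: "h i < n" if "i < k" for i using h that by auto
    define E where "E i = e' (h i)" for i
    \<comment> \<open>A row with \<open>E i = 0\<close> offers neither a factor \<open>p\<close> nor
      a factor \<open>s\<close>; it is kept whole in \<open>P0\<close>, and its other part is set to
      0.\<close>
    define P0 where "P0 i j = (if E i = 0 then Z (h i) j else s * Q (h i) (g j))" for i j
    define R' where "R' i j = R (h i) (g j)" for i j
    define X where "X i b j = (if b then (if E i = 0 then 0 else p ^ E i) * R' i j else P0 i j)" for i b j
    have ZX: "Z (h i) j = (\<Sum>b\<in>UNIV. X i b j)" if "i < k" "j < k" for i j
      using R[OF hn[OF that(1)] gj[OF that(2)]] by (simp add: UNIV_bool X_def P0_def R'_def Z_def E_def)
    have cardE: "card {i. i < k \<and> E i = a} \<le> card {i. i < n \<and> e' i = a}" for a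
      by (rule card_inj_on_le[of h]) (use inj hn in \<open>auto simp: E_def intro: inj_on_subset\<close>)
    have "fdet k (\<lambda>i j. Z (h i) j) = fdet k (\<lambda>i j. \<Sum>b\<in>UNIV. X i b j)"
      by (rule fdet_cong) (rule ZX)
    also have "\<dots> = (\<Sum>b\<in>{0..<k} \<rightarrow>\<^sub>E UNIV. fdet k (\<lambda>i j. X i (b i) j))"
      by (rule fdet_expand_rows) simp
    also have "\<dots> \<in> I"
    proof (rule ring_ideal_sum[OF I])
      fix b :: "nat \<Rightarrow> bool"
      show "fdet k (\<lambda>i j. X i (b i) j) \<in> I"
      proof (cases "\<exists>i<k. b i \<and> E i = 0")
        case True
        then have "fdet k (\<lambda>i j. X i (b i) j) = 0"
          using fdet_zero_row[of _ k "\<lambda>i j. X i (b i) j"] by (auto simp: X_def)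
        then show ?thesis using I by (simp add: ring_ideal_def)
      next
        case False
        define D where "D = fdet k (\<lambda>i j. if b i then R' i j else P0 i j)"
        \<comment> \<open>Rows with \<open>b i\<close> contribute \<open>p\<close> or p^2 each, so
          p^(c 1 + 2 c 2) comes out of the term and \<open>D\<close> is what is left.\<close>
        define c where "c a = card {i. i < k \<and> b i \<and> E i = a}" for a
        have E2: "E i = 1 \<or> E i = 2" if "i < k" "b i" for i
          using e'[OF hn[OF that(1)]] False that by (auto simp: E_def le_Suc_eq numeral_2_eq_2)
        have "fdet k (\<lambda>i j. X i (b i) j) = fdet k (\<lambda>i j. (if b i then p ^ E i else 1) * (if b i then R' i j else P0 i j))"
          by (rule fdet_cong) (use False in \<open>auto simp: X_def\<close>)
        also have "\<dots> = (\<Prod>i<k. if b i then p ^ E i else 1) * D" by (simp only: fdet_scale_rows D_def)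
        also have "(\<Prod>i<k. if b i then p ^ E i else 1) = p ^ (c 1 + 2 * c 2)"
        proof -
          have "(\<Prod>i<k. if b i then p ^ E i else 1) =
              (\<Prod>i<k. (if b i \<and> E i = 1 then p else 1) * (if b i \<and> E i = 2 then p ^ 2 else 1))"
            by (intro prod.cong) (use E2 in fastforce)+
          then show ?thesis by (simp only: prod.distrib prod_if_power c_def power_add power_mult)
        qed
        finally have fX: "fdet k (\<lambda>i j. X i (b i) j) = p ^ (c 1 + 2 * c 2) * D" .
        have notb: "card {i. i < k \<and> \<not> b i} = k - (c 1 + c 2)"
        proof -
          have "{i. i < k \<and> b i} = {i. i < k \<and> b i \<and> E i = 1} \<union> {i. i < k \<and> b i \<and> E i = 2}"
            using E2 by auto
          then have "card {i. i < k \<and> b i} = c 1 + c 2"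
            unfolding c_def by (simp add: card_Un_disjoint disjoint_iff)
          moreover have "card {i. i < k \<and> b i} + card {i. i < k \<and> \<not> b i} = card ({i. i < k \<and> b i} \<union> {i. i < k \<and> \<not> b i})"
            by (rule card_Un_disjoint[symmetric]) auto
          moreover have "{i. i < k \<and> b i} \<union> {i. i < k \<and> \<not> b i} = {..<k}" by auto
          ultimately show ?thesis by simp
        qed
        \<comment> \<open>Of the \<open>k - (c 1 + c 2)\<close> rows taken from \<open>P0\<close>,
          all but at most \<open>d0\<close> are divisible by \<open>s\<close>.\<close>
        have sD: "s ^ (k - (c 1 + c 2) - d0) dvd D"
        proof -
          have "card {i. i < k \<and> \<not> b i} \<le> card ({i. i < k \<and> (\<not> b i \<and> E i \<noteq> 0)} \<union> {i. i < k \<and> E i = 0})"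
            by (rule card_mono) auto
          also have "\<dots> \<le> card {i. i < k \<and> (\<not> b i \<and> E i \<noteq> 0)} + card {i. i < k \<and> E i = 0}"
            by (rule card_Un_le)
          also have "\<dots> \<le> card {i. i < k \<and> (\<not> b i \<and> E i \<noteq> 0)} + d0"
            using cardE[of 0] by (simp add: d0)
          finally have "k - (c 1 + c 2) - d0 \<le> card {i. i < k \<and> (\<not> b i \<and> E i \<noteq> 0)}"
            unfolding notb by linarith
          moreover have "s ^ card {i. i < k \<and> (\<not> b i \<and> E i \<noteq> 0)} dvd D"
            unfolding prod_if_power[symmetric] D_def by (rule fdet_dvd_rows) (auto simp: P0_def)
          ultimately show ?thesis by (meson dvd_trans le_imp_power_dvd)
        qed
        have pD: "p ^ (\<beta> - (c 1 + c 2)) dvd D"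
        proof -
          have "p ^ (card {i. i < k \<and> \<not> b i} - card L) dvd D"
            unfolding D_def
          proof (rule low_rank_rows_dvd[OF p T, where c = "\<lambda>i. B (h i)" and Z = "\<lambda>l j. N l (g j)"
              and Y = "\<lambda>i j. (\<Sum>l\<in>{..<n} - L. B (h i) l * (p ^ (e l - 1) * N l (g j))) -
                 (if E i = 0 then 0 else fdet n T * (p ^ (E i - 1) * R' i j))"])
            fix i j assume i: "i \<in> {i. i < k \<and> \<not> b i}" and j: "j < k"
            have "P0 i j = Z (h i) j - p * (if E i = 0 then 0 else p ^ (E i - 1) * R' i j)"
            proof (cases "E i = 0")
              case True then show ?thesis by (simp add: P0_def)
            next
              case False
              then have "p ^ E i = p * p ^ (E i - 1)" by (cases "E i") auto
              then show ?thesis using ZX[of i j] i j False by (simp add: P0_def X_def UNIV_bool mult.assoc)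
            qed
            then show "fdet n T * (if b i then R' i j else P0 i j) = (\<Sum>l\<in>L. B (h i) l * N l (g j)) +
               p * ((\<Sum>l\<in>{..<n} - L. B (h i) l * (p ^ (e l - 1) * N l (g j))) -
                 (if E i = 0 then 0 else fdet n T * (p ^ (E i - 1) * R' i j)))"
              using TZ2[OF hn[of i] j] i by (simp add: right_diff_distrib mult.left_commute)
          qed (auto simp: L_def)
          then show ?thesis unfolding notb by (simp add: k_def \<alpha>0 L_def)
        qed
        obtain z where z: "D = s ^ (k - (c 1 + c 2) - d0) * z" using sD by (rule dvdE)
        \<comment> \<open>Since \<open>p\<close> does not divide \<open>s\<close>, the two
          divisibilities of \<open>D\<close> combine into divisibility by the product.\<close>
        have "p ^ (\<beta> - (c 1 + c 2)) dvd z"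
          using prime_elem_power_dvd_cancel[OF p prime_elem_not_dvd_power[OF p s]] pD unfolding z by blast
        then obtain y where y: "z = p ^ (\<beta> - (c 1 + c 2)) * y" by (rule dvdE)
        define w where "w = c 1 + 2 * c 2 + (\<beta> - (c 1 + c 2))"
        have fX2: "fdet k (\<lambda>i j. X i (b i) j) = p ^ w * (s ^ (k - (c 1 + c 2) - d0) * y)"
          unfolding fX z y w_def by (simp add: power_add mult_ac)
        show ?thesis
        \<comment> \<open>A row counted by \<open>c 2\<close> contributes one factor
          \<open>p\<close> more than it costs in the rank estimate, and \<open>c 1 > \<beta>\<close>
          exceeds \<beta> outright; either way p^(\<beta>+1) divides the term. Otherwise
          \<open>c 2 = 0\<close> and \<open>c 1\<close> is at most \<open>min d1 \<beta>\<close>,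
          which leaves enough factors \<open>s\<close>.\<close>
        proof (cases "c 2 \<ge> 1 \<or> c 1 > \<beta>")
          case True
          then have "Suc \<beta> \<le> w" unfolding w_def by linarith
          then have "p ^ Suc \<beta> dvd p ^ w" by (rule le_imp_power_dvd)
          then have "p ^ Suc \<beta> dvd fdet k (\<lambda>i j. X i (b i) j)" unfolding fX2 by (rule dvd_mult2)
          then show ?thesis using I1 by (metis dvdE)
        next
          case False
          have "c 1 \<le> card {i. i < k \<and> E i = 1}" unfolding c_def by (rule card_mono) auto
          then have "c 1 \<le> d1" using cardE[of 1] d1 by simp
          then have le: "k - d0 - min d1 \<beta> \<le> k - (c 1 + c 2) - d0" using False by linarith
          have "w = \<beta>" unfolding w_def using False by simp
          moreover have "s ^ (k - (c 1 + c 2) - d0) =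
              s ^ (k - d0 - min d1 \<beta>) * s ^ (k - (c 1 + c 2) - d0 - (k - d0 - min d1 \<beta>))"
            unfolding power_add[symmetric] le_add_diff_inverse[OF le] ..
          ultimately show ?thesis unfolding fX2 using I2 by (simp only: mult.assoc)
        qed
      qed
    qed
    finally show ?thesis .
  qed
  have "fdet n U ^ k * fdet k (\<lambda>i j. P (f i) (g j)) \<in> I"
  proof (rule fdet_rows_in_ideal[OF I _ minors])
    fix i j assume "i < k" "j < k"
    then have "f i < n" using f by (auto simp: k_def)
    then show "fdet n U * P (f i) (g j) = (\<Sum>l<n. A' (f i) l * Z l j)" unfolding Z_def by (rule A'[symmetric])
  qed
  then show ?thesis unfolding I_def k_def by blast
qed

section \<open>Matrix pencils over the integers\<close>

text \<open>Every degree in \<open>t\<close> beyond \<open>k\<close> is paid for by a factor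
  \<open>p\<close>. The terms p^r t^(r+1) of a first integral satisfy this with k = 1, and under
  multiplication the values of \<open>k\<close> add up, so a minor of size \<open>k\<close> has
  level \<open>k\<close>.\<close>

definition coeff_filtered :: "int \<Rightarrow> nat \<Rightarrow> int poly \<Rightarrow> bool" where
  "coeff_filtered p k f \<longleftrightarrow> (\<forall>n. p ^ (n - k) dvd Polynomial.coeff f n)"

lemma coeff_filtered_mult:
  assumes "coeff_filtered p a f" "coeff_filtered p b g"
  shows "coeff_filtered p (a + b) (f * g)"
  unfolding coeff_filtered_def
proof
  fix n
  have "p ^ (n - (a + b)) dvd Polynomial.coeff f i * Polynomial.coeff g (n - i)" if "i \<le> n" for i
  proof -
    have "p ^ (n - (a + b)) dvd p ^ ((i - a) + (n - i - b))" using that by (intro le_imp_power_dvd) linarith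
    also have "\<dots> dvd Polynomial.coeff f i * Polynomial.coeff g (n - i)"
      using assms unfolding power_add coeff_filtered_def by (intro mult_dvd_mono) blast+
    finally show ?thesis .
  qed
  then show "p ^ (n - (a + b)) dvd Polynomial.coeff (f * g) n"
    unfolding coeff_mult by (intro dvd_sum) auto
qed

lemma coeff_filtered_const: "coeff_filtered p 0 [:c:]"
  by (simp add: coeff_filtered_def coeff_pCons split: nat.split)

lemma coeff_filtered_prod:
  assumes "\<And>i. i < k \<Longrightarrow> coeff_filtered p 1 (F i)"
  shows "coeff_filtered p k (\<Prod>i = 0..<k. F i)"
  using assms
proof (induction k)
  case 0
  then show ?case using coeff_filtered_const[of p 1] by (simp add: one_pCons)
next
  case (Suc k)
  then have "coeff_filtered p (k + 1) ((\<Prod>i = 0..<k. F i) * F k)" by (intro coeff_filtered_mult) auto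
  then show ?case by simp
qed

lemma coeff_filtered_fdet:
  assumes "\<And>i j. i < k \<Longrightarrow> j < k \<Longrightarrow> coeff_filtered p 1 (M i j)"
  shows "coeff_filtered p k (fdet k M)"
proof -
  have "coeff_filtered p k (signof \<pi> * (\<Prod>i = 0..<k. M i (\<pi> i)))" if "\<pi> permutes {0..<k}" for \<pi>
  proof -
    have "coeff_filtered p k (\<Prod>i = 0..<k. M i (\<pi> i))"
      using assms permutes_in_image[OF that] by (intro coeff_filtered_prod) auto
    then show ?thesis using coeff_filtered_mult[OF coeff_filtered_const] by (simp add: of_int_poly)
  qed
  then show ?thesis unfolding coeff_filtered_def fdet_leibniz coeff_sum by (auto intro!: dvd_sum)
qed

lemma poly_fdet: "poly (fdet k M) x = fdet k (\<lambda>i j. poly (M i j) x)"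
  for x :: int
  by (simp add: fdet_leibniz poly_sum poly_prod)

lemma fdet_const_poly: "fdet k (\<lambda>i j. [:M i j:]) = [:fdet k M:]"
proof -
  have "(\<Prod>i\<in>A. [:f i:]) = [:\<Prod>i\<in>A. f i:]" for A and f :: "nat \<Rightarrow> 'a"
    by (induction A rule: infinite_finite_induct) auto
  moreover have "(\<Sum>i\<in>A. [:f i:]) = [:\<Sum>i\<in>A. f i:]" for A and f :: "(nat \<Rightarrow> nat) \<Rightarrow> 'a"
    by (induction A rule: infinite_finite_induct) auto
  ultimately show ?thesis by (simp add: fdet_leibniz of_int_poly mult.commute)
qed

section \<open>Roots with multiplicity of integer polynomials modulo p\<close>

lemma poly_split_at: "\<exists>q. F = [:poly F x:] + [:- x, 1:] * q" for x :: "'a :: comm_ring_1"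
proof -
  have "poly (F - [:poly F x:]) x = 0" by simp
  then obtain q where "F - [:poly F x:] = [:- x, 1:] * q" unfolding poly_eq_0_iff_dvd by (rule dvdE)
  then have "F = [:poly F x:] + [:- x, 1:] * q" by (simp add: algebra_simps)
  then show ?thesis by blast
qed

text \<open>Write \<open>F\<close> as F(x) - y with \<open>y\<close> divisible by t - x. Then
  \<open>F\<close> divides F(x)^M - y^M, so modulo (t - x)^M it divides the constant F(x)^M and can
  be cancelled at the price of that constant.\<close>

lemma cancel_coprime_factor:
  fixes p x :: int
  assumes "F * w = [:p:] * u + [:- x, 1:] ^ M * b"
  shows "\<exists>u' b'. [:poly F x ^ M:] * w = [:p:] * u' + [:- x, 1:] ^ M * b'"
proof -
  obtain q where q: "F = [:poly F x:] + [:- x, 1:] * q" using poly_split_at by blast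
  define y where "y = [:- x, 1:] * (- q)"
  define h where "h = (\<Sum>i<M. y ^ (M - Suc i) * [:poly F x:] ^ i)"
  have F: "[:poly F x:] - y = F" using q by (simp add: y_def)
  have "[:poly F x:] ^ M - y ^ M = F * h"
    using power_diff_sumr2[of "[:poly F x:]" M y] unfolding F h_def .
  then have "[:poly F x:] ^ M = F * h + y ^ M" by (simp only: diff_eq_eq)
  then have "[:poly F x:] ^ M * w = h * (F * w) + y ^ M * w" by (simp only: distrib_right distrib_left mult_ac)
  also have "\<dots> = [:p:] * (h * u) + [:- x, 1:] ^ M * (h * b + (- q) ^ M * w)"
    unfolding assms by (simp only: y_def power_mult_distrib algebra_simps)
  finally have "[:poly F x:] ^ M * w = [:p:] * (h * u) + [:- x, 1:] ^ M * (h * b + (- q) ^ M * w)" .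
  moreover have "[:poly F x:] ^ M = [:poly F x ^ M:]" by (simp add: poly_const_pow)
  ultimately show ?thesis by metis
qed

lemma prime_elem_not_dvd_prod:
  assumes p: "prime_elem p" and f: "\<And>i. i \<in> A \<Longrightarrow> \<not> p dvd f i"
  shows "\<not> p dvd prod f A"
  using f
proof (induction A rule: infinite_finite_induct)
  case (insert i A)
  then have "\<not> p dvd f i" "\<not> p dvd prod f A" by blast+
  then have "\<not> p dvd f i * prod f A" using prime_elem_dvd_multD[OF p] by blast
  then show ?case using insert.hyps by simp
next
  case empty
  have "\<not> p dvd 1" using p unfolding prime_elem_def by blast
  then show ?case by simp
next
  case (infinite A)
  have "\<not> p dvd 1" using p unfolding prime_elem_def by blast
  then show ?case using infinite.hyps by simp
qed

text \<open>Coprime factors over the field with \<open>p\<close> elements, handled by explicit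
  equations in \<int>[t] with constants \<open>c\<close> prime to \<open>p\<close> in place of
  units. If \<open>F\<close> collects the factors found so far, F(x_a) is prime to \<open>p\<close>
  by distinctness, so the new power of t - x_a has to divide the cofactor \<open>v\<close>.\<close>

lemma product_divides_mod:
  fixes p :: int and x :: "'i \<Rightarrow> int"
  assumes p: "prime_elem p" and I: "finite I"
    and dist: "\<And>i j. i \<in> I \<Longrightarrow> j \<in> I \<Longrightarrow> i \<noteq> j \<Longrightarrow> \<not> p dvd x i - x j"
    and loc: "\<And>i. i \<in> I \<Longrightarrow> \<exists>c u v. \<not> p dvd c \<and> [:c:] * g = [:p:] * u + [:- x i, 1:] ^ N i * v"
  shows "\<exists>c u v. \<not> p dvd c \<and> [:c:] * g = [:p:] * u + (\<Prod>i\<in>I. [:- x i, 1:] ^ N i) * v"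
  using I dist loc
proof (induction I)
  case empty
  have "\<not> p dvd 1" using p unfolding prime_elem_def by blast
  then have "\<not> p dvd 1 \<and> [:1:] * g = [:p:] * 0 + (\<Prod>i\<in>{}. [:- x i, 1:] ^ N i) * g" by simp
  then show ?case by blast
next
  case (insert a I)
  define F where "F = (\<Prod>i\<in>I. [:- x i, 1:] ^ N i)"
  obtain c u v where c: "\<not> p dvd c" "[:c:] * g = [:p:] * u + F * v"
    using insert.IH insert.prems unfolding F_def by blast
  obtain c' u' v' where c': "\<not> p dvd c'" "[:c':] * g = [:p:] * u' + [:- x a, 1:] ^ N a * v'"
    using insert.prems(2)[of a] by blast
  \<comment> \<open>The two equations for \<open>g\<close> place \<open>F * v\<close>, up to a
    constant, in the ideal generated by \<open>p\<close> and the power of t - x_a; then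
    \<open>F\<close> is cancelled.\<close>
  have "F * ([:c':] * v) = [:c':] * ([:c:] * g - [:p:] * u)" unfolding c(2) add_diff_cancel_left' by (rule mult.left_commute)
  also have "\<dots> = [:c:] * ([:c':] * g) - [:p:] * ([:c':] * u)" by (simp only: right_diff_distrib mult_ac)
  also have "\<dots> = [:p:] * ([:c:] * u' - [:c':] * u) + [:- x a, 1:] ^ N a * ([:c:] * v')"
    unfolding c'(2) by (simp only: right_diff_distrib distrib_left mult_ac diff_add_eq)
  finally obtain u'' b where b: "[:poly F (x a) ^ N a:] * ([:c':] * v) = [:p:] * u'' + [:- x a, 1:] ^ N a * b"
    using cancel_coprime_factor by blast
  have "poly F (x a) = (\<Prod>i\<in>I. (x a - x i) ^ N i)" by (simp add: F_def poly_prod poly_power)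
  moreover have "\<not> p dvd (\<Prod>i\<in>I. (x a - x i) ^ N i)"
  proof (rule prime_elem_not_dvd_prod[OF p], rule prime_elem_not_dvd_power[OF p])
    fix i assume "i \<in> I"
    then show "\<not> p dvd x a - x i" using insert.hyps by (intro insert.prems(1)) auto
  qed
  ultimately have nd: "\<not> p dvd poly F (x a) ^ N a" by (simp only: prime_elem_not_dvd_power[OF p] not_False_eq_True)
  define C where "C = poly F (x a) ^ N a * c' * c"
  have nC: "\<not> p dvd C" unfolding C_def using prime_elem_dvd_multD[OF p] nd c(1) c'(1) by blast
  have eqC: "[:C:] * g = [:p:] * ([:poly F (x a) ^ N a * c':] * u + F * u'') + (F * [:- x a, 1:] ^ N a) * b"
  proof -
    have pc: "[:y * z:] = [:y:] * [:z:]" for y z :: int by simp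
    have "[:C:] * g = [:poly F (x a) ^ N a * c':] * ([:c:] * g)" unfolding C_def pc by (simp only: mult_ac)
    also have "\<dots> = [:p:] * ([:poly F (x a) ^ N a * c':] * u) + F * ([:poly F (x a) ^ N a:] * ([:c':] * v))"
      unfolding c(2) pc by (simp only: distrib_left distrib_right mult_ac)
    also have "\<dots> = [:p:] * ([:poly F (x a) ^ N a * c':] * u + F * u'') + (F * [:- x a, 1:] ^ N a) * b"
      unfolding b by (simp only: distrib_left distrib_right mult_ac add_ac)
    finally show ?thesis .
  qed
  have prodC: "F * [:- x a, 1:] ^ N a = (\<Prod>i\<in>insert a I. [:- x i, 1:] ^ N i)"
    using insert.hyps by (simp add: F_def mult.commute)
  show ?case using nC eqC[unfolded prodC] by blast
qed

text \<open>Otherwise a monic \<open>F\<close> of degree above \<open>B\<close> divides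
  \<open>g\<close> modulo \<open>p\<close>, up to a constant prime to \<open>p\<close>. Comparing
  top coefficients forces the cofactor, and hence \<open>g\<close>, to vanish modulo
  \<open>p\<close>. The degree of \<open>g\<close> is bounded only modulo \<open>p\<close>; its
  higher coefficients may be nonzero.\<close>

lemma root_count_mod:
  fixes p :: int and x :: "'i \<Rightarrow> int"
  assumes p: "prime_elem p" and I: "finite I"
    and dist: "\<And>i j. i \<in> I \<Longrightarrow> j \<in> I \<Longrightarrow> i \<noteq> j \<Longrightarrow> \<not> p dvd x i - x j"
    and loc: "\<And>i. i \<in> I \<Longrightarrow> \<exists>c u v. \<not> p dvd c \<and> [:c:] * g = [:p:] * u + [:- x i, 1:] ^ N i * v"
    and deg: "\<And>n. n > B \<Longrightarrow> p dvd Polynomial.coeff g n" and g: "\<not> [:p:] dvd g"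
  shows "(\<Sum>i\<in>I. N i) \<le> B"
proof (rule ccontr)
  define F where "F = (\<Prod>i\<in>I. [:- x i, 1:] ^ N i)"
  define L where "L = (\<Sum>i\<in>I. N i)"
  assume "\<not> ?thesis"
  then have LB: "L > B" by (simp add: L_def)
  have "\<exists>c u w. \<not> p dvd c \<and> [:c:] * g = [:p:] * u + F * w"
    unfolding F_def by (rule product_divides_mod[OF p I dist loc])
  then obtain c u w where c: "\<not> p dvd c" "[:c:] * g = [:p:] * u + F * w" by blast
  have degF: "Polynomial.degree F = L"
  proof -
    have "[:- x i, 1:] ^ N i \<noteq> 0" for i by (rule power_not_zero) simp
    then have "Polynomial.degree F = (\<Sum>i\<in>I. Polynomial.degree ([:- x i, 1:] ^ N i))"
      unfolding F_def by (intro degree_prod_eq_sum_degree ballI)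
    then show ?thesis unfolding L_def degree_linear_power .
  qed
  have monF: "Polynomial.coeff F L = 1"
  proof -
    have "Polynomial.lead_coeff F = (\<Prod>i\<in>I. Polynomial.lead_coeff ([:- x i, 1:] ^ N i))"
      unfolding F_def by (rule lead_coeff_prod)
    also have "\<dots> = 1"
    proof (rule prod.neutral, rule ballI)
      show "Polynomial.lead_coeff ([:- x i, 1:] ^ N i) = 1" for i
        unfolding lead_coeff_power by (simp only: degree_pCons_eq_if coeff_pCons_Suc) simp
    qed
    finally show ?thesis by (simp add: degF)
  qed
  have "\<forall>e. p dvd Polynomial.coeff w e"
  proof (rule ccontr)
    define E where "E = {e. \<not> p dvd Polynomial.coeff w e}"
    assume "\<not> ?thesis"
    then have "E \<noteq> {}" by (auto simp: E_def)
    have "E \<subseteq> {..Polynomial.degree w}"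
    proof
      fix e assume "e \<in> E"
      then have "Polynomial.coeff w e \<noteq> 0" by (auto simp: E_def)
      then show "e \<in> {..Polynomial.degree w}" using le_degree by blast
    qed
    then have "finite E" using finite_subset by blast
    \<comment> \<open>The degree of \<open>w\<close> modulo \<open>p\<close>. As \<open>F\<close> is
      monic, \<open>F * w\<close> has a coefficient prime to \<open>p\<close> in degree
      \<open>L + e\<close>, which exceeds \<open>B\<close>.\<close>
    define e where "e = Max E"
    have e: "e \<in> E" "\<And>e'. e' \<in> E \<Longrightarrow> e' \<le> e" using \<open>E \<noteq> {}\<close> \<open>finite E\<close> by (auto simp: e_def)
    have "Polynomial.coeff (F * w) (L + e) = (\<Sum>i\<le>L + e. Polynomial.coeff F i * Polynomial.coeff w (L + e - i))"
      by (rule coeff_mult)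
    also have "\<dots> = Polynomial.coeff F L * Polynomial.coeff w e +
        (\<Sum>i\<in>{..L + e} - {L}. Polynomial.coeff F i * Polynomial.coeff w (L + e - i))"
      by (subst sum.remove[of _ L]) auto
    finally have eq: "Polynomial.coeff (F * w) (L + e) = Polynomial.coeff w e +
        (\<Sum>i\<in>{..L + e} - {L}. Polynomial.coeff F i * Polynomial.coeff w (L + e - i))" by (simp add: monF)
    have "p dvd (\<Sum>i\<in>{..L + e} - {L}. Polynomial.coeff F i * Polynomial.coeff w (L + e - i))"
    proof (rule dvd_sum)
      fix i assume i: "i \<in> {..L + e} - {L}"
      show "p dvd Polynomial.coeff F i * Polynomial.coeff w (L + e - i)"
      proof (cases "i < L")
        case True
        then have "\<not> L + e - i \<le> e" by linarith
        then have "L + e - i \<notin> E" using e(2) by blast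
        then show ?thesis by (simp add: E_def)
      next
        case False
        then have "i > Polynomial.degree F" using i degF by auto
        then show ?thesis by (simp add: coeff_eq_0)
      qed
    qed
    moreover have "p dvd Polynomial.coeff (F * w) (L + e)"
    proof -
      have "F * w = [:c:] * g - [:p:] * u" unfolding c(2) by (rule add_diff_cancel_left'[symmetric])
      then have "Polynomial.coeff (F * w) (L + e) = c * Polynomial.coeff g (L + e) - p * Polynomial.coeff u (L + e)"
        by simp
      moreover have "p dvd Polynomial.coeff g (L + e)" using LB by (intro deg) simp
      ultimately show ?thesis by simp
    qed
    ultimately have "p dvd Polynomial.coeff w e" unfolding eq by (simp only: dvd_add_left_iff)
    then show False using e(1) by (simp add: E_def)
  qed
  then have "[:p:] dvd w" by (simp add: const_poly_dvd_iff)
  then have "[:p:] dvd [:c:] * g" unfolding c(2) by (intro dvd_add dvd_triv_left dvd_mult)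
  moreover have "prime_elem [:p:]" unfolding prime_elem_const_poly_iff by (rule p)
  ultimately have "[:p:] dvd [:c:]" using prime_elem_dvd_multD g by blast
  then show False using c(1) by simp
qed

text \<open>These are the quantities that occur in \<open>minors_dvd\<close> and
  \<open>row_reduced_minor\<close> when exponents are cut off at 1 and at 2.\<close>

lemma row_reduced_counts:
  fixes e :: "nat \<Rightarrow> nat"
  assumes "\<And>i. i < n \<Longrightarrow> e i \<le> 2"
    and a: "a = card {i. i < n \<and> e i = 0}" and b: "b = card {i. i < n \<and> e i = 1}"
  shows "card {i. i < n \<and> e i < 1} = a" "card {i. i < n \<and> e i < 2} = a + b"
    "(\<Sum>i<n. 2 - e i) = 2 * a + b" "(\<Sum>i<n. 1 - min (e i) 1) = a"
    "(\<Sum>i | i < n \<and> e i < 2. e i) = b" "(\<Sum>i | i < n \<and> e i < 1. e i) = 0"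
proof -
  let ?A = "{i. i < n \<and> e i = 0}" and ?B = "{i. i < n \<and> e i = 1}"
  have u: "{i. i < n \<and> e i < 2} = ?A \<union> ?B" by auto
  have fin: "finite ?A" "finite ?B" "?A \<inter> ?B = {}" by auto
  show "card {i. i < n \<and> e i < 1} = a" by (simp add: a)
  show "card {i. i < n \<and> e i < 2} = a + b" unfolding u a b using fin by (rule card_Un_disjoint)
  have "(\<Sum>i<n. 2 - e i) = (\<Sum>i\<in>?A \<union> ?B. 2 - e i)"
    using assms(1) by (intro sum.mono_neutral_right) (auto simp: le_Suc_eq numeral_2_eq_2)
  also have "\<dots> = (\<Sum>i\<in>?A. 2 - e i) + (\<Sum>i\<in>?B. 2 - e i)" using fin by (rule sum.union_disjoint)
  finally show "(\<Sum>i<n. 2 - e i) = 2 * a + b" by (simp add: a b)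
  have "(\<Sum>i<n. 1 - min (e i) 1) = (\<Sum>i\<in>?A. 1 - min (e i) 1)"
    by (intro sum.mono_neutral_right) auto
  then show "(\<Sum>i<n. 1 - min (e i) 1) = a" by (simp add: a)
  have "(\<Sum>i\<in>?A \<union> ?B. e i) = (\<Sum>i\<in>?A. e i) + (\<Sum>i\<in>?B. e i)" using fin by (rule sum.union_disjoint)
  then show "(\<Sum>i | i < n \<and> e i < 2. e i) = b" unfolding u by (simp add: b)
qed simp

text \<open>The numbers \<open>d0 i\<close> and \<open>d1 i\<close> come from a reduction of the
  integer matrix P(x_i), the witnesses from one reduction of \<open>P\<close> over \<int>[t]. The
  bounds compare the two through minors: divisibility by powers of \<open>p\<close> passes from
  \<open>P\<close> to P(x_i). The sums arise by counting roots of those minors of \<open>P\<close>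
  that are least divisible by \<open>p\<close>.\<close>

lemma pencil_inequalities:
  fixes p :: int and B0 B1 B2 :: "nat \<Rightarrow> nat \<Rightarrow> int" and x :: "'i \<Rightarrow> int"
  defines "P \<equiv> \<lambda>i j. [:B0 i j, B1 i j, p * B2 i j:]"
  assumes p: "prime_elem p" and I: "finite I"
    and dist: "\<And>i j. i \<in> I \<Longrightarrow> j \<in> I \<Longrightarrow> i \<noteq> j \<Longrightarrow> \<not> p dvd x i - x j"
    and red: "\<And>i. i \<in> I \<Longrightarrow> row_reduced p 2 n n (\<lambda>a b. poly (P a b) (x i)) (U i) (e i) (N i)"
    and d0: "\<And>i. i \<in> I \<Longrightarrow> d0 i = card {a. a < n \<and> e i a = 0}"
    and d1: "\<And>i. i \<in> I \<Longrightarrow> d1 i = card {a. a < n \<and> e i a = 1}"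
  shows "\<exists>\<alpha>0 \<alpha>1. (\<forall>i\<in>I. d0 i \<le> \<alpha>0 \<and> 2 * d0 i + d1 i \<le> 2 * \<alpha>0 + \<alpha>1) \<and>
    (\<Sum>i\<in>I. \<alpha>0 - d0 i) \<le> \<alpha>0 \<and> (\<Sum>i\<in>I. \<alpha>0 + \<alpha>1 - d0 i - min (d1 i) \<alpha>1) \<le> \<alpha>0 + 2 * \<alpha>1"
proof -
  let ?p = "[:p:]"
  have pp: "prime_elem ?p" unfolding prime_elem_const_poly_iff by (rule p)
  obtain T E M where TEM: "row_reduced ?p 2 n n P T E M" using row_reduced_exists[OF pp] by blast
  note T = row_reducedD(1)[OF TEM] and E = row_reducedD(2)[OF TEM] and M = row_reducedD(3)[OF TEM]
  define \<alpha>0 where "\<alpha>0 = card {i. i < n \<and> E i = 0}"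
  define \<alpha>1 where "\<alpha>1 = card {i. i < n \<and> E i = 1}"
  note cE = row_reduced_counts[OF E \<alpha>0_def \<alpha>1_def]
  \<comment> \<open>Cutting the exponents off at 1 moves the surplus factors \<open>p\<close> into
    the rows, so the same \<open>T\<close> also yields divisibility with
    \<open>K = 1\<close>.\<close>
  have M1: "(\<Sum>l<n. T i l * P l j) = ?p ^ min (E i) 1 * (?p ^ (E i - min (E i) 1) * M i j)"
    if "i < n" "j < n" for i j
    using M[OF that] by (simp add: power_add[symmetric] flip: mult.assoc)
  have dvd1: "?p ^ (k - \<alpha>0) dvd fdet k (\<lambda>i j. P (f i) (g j))"
    if "f ` {..<k} \<subseteq> {..<n}" "g ` {..<k} \<subseteq> {..<n}" for k f g
  proof -
    have "?p ^ (k * 1 - (\<Sum>i<n. 1 - min (E i) 1)) dvd fdet k (\<lambda>i j. P (f i) (g j))"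
      by (rule minors_dvd[OF pp T _ M1 that]) simp_all
    then show ?thesis by (simp only: cE(4) mult_1_right)
  qed
  have dvd2: "?p ^ (k * 2 - (2 * \<alpha>0 + \<alpha>1)) dvd fdet k (\<lambda>i j. P (f i) (g j))"
    if "f ` {..<k} \<subseteq> {..<n}" "g ` {..<k} \<subseteq> {..<n}" for k f g
  proof -
    have "?p ^ (k * 2 - (\<Sum>i<n. 2 - E i)) dvd fdet k (\<lambda>i j. P (f i) (g j))"
      by (rule minors_dvd[OF pp T E M that])
    then show ?thesis by (simp only: cE(3))
  qed
  have eval_dvd: "p ^ w dvd fdet k (\<lambda>i j. poly (P (f i) (g j)) y)"
    if w: "?p ^ w dvd fdet k (\<lambda>i j. P (f i) (g j))" for w k f g y
  proof -
    obtain q where "fdet k (\<lambda>i j. P (f i) (g j)) = ?p ^ w * q" using w by (rule dvdE)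
    then have "poly (fdet k (\<lambda>i j. P (f i) (g j))) y = p ^ w * poly q y" by simp
    then show ?thesis by (simp add: poly_fdet)
  qed
  \<comment> \<open>At \<open>x i\<close>, a minor of size \<open>d0 i\<close> prime to
    \<open>p\<close> forces d0 i \<le> \<alpha>0. A minor of size d0 i + d1 i not divisible by p^(d1
    i + 1) forces 2 (d0 i + d1 i) - (2 \<alpha>0 + \<alpha>1) \<le> d1 i.\<close>
  have bounds: "d0 i \<le> \<alpha>0 \<and> 2 * d0 i + d1 i \<le> 2 * \<alpha>0 + \<alpha>1" if i: "i \<in> I" for i
  proof -
    have "\<And>a. a < n \<Longrightarrow> e i a \<le> 2" by (rule row_reducedD(2)[OF red[OF i]])
    note ce = row_reduced_counts[OF this d0[OF i] d1[OF i]]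
    obtain f g where fg: "f ` {..<d0 i} \<subseteq> {..<n}" "g ` {..<d0 i} \<subseteq> {..<n}"
      "\<not> p ^ Suc 0 dvd fdet (d0 i) (\<lambda>a b. poly (P (f a) (g b)) (x i))"
      by (rule row_reduced_minorE[OF p red[OF i] one_le_numeral ce(1) ce(6)])
    have "p ^ (d0 i - \<alpha>0) dvd fdet (d0 i) (\<lambda>a b. poly (P (f a) (g b)) (x i))"
      by (rule eval_dvd[OF dvd1[OF fg(1,2)]])
    then have "\<not> Suc 0 \<le> d0 i - \<alpha>0" using fg(3) dvd_trans[OF le_imp_power_dvd] by blast
    moreover obtain f' g' where fg': "f' ` {..<d0 i + d1 i} \<subseteq> {..<n}" "g' ` {..<d0 i + d1 i} \<subseteq> {..<n}"
      "\<not> p ^ Suc (d1 i) dvd fdet (d0 i + d1 i) (\<lambda>a b. poly (P (f' a) (g' b)) (x i))"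
      by (rule row_reduced_minorE[OF p red[OF i] order_refl ce(2) ce(5)])
    have "p ^ ((d0 i + d1 i) * 2 - (2 * \<alpha>0 + \<alpha>1)) dvd fdet (d0 i + d1 i) (\<lambda>a b. poly (P (f' a) (g' b)) (x i))"
      by (rule eval_dvd[OF dvd2[OF fg'(1,2)]])
    then have "\<not> Suc (d1 i) \<le> (d0 i + d1 i) * 2 - (2 * \<alpha>0 + \<alpha>1)"
      using fg'(3) dvd_trans[OF le_imp_power_dvd] by blast
    ultimately show ?thesis by (intro conjI) arith+
  qed
  \<comment> \<open>Any minor of size \<alpha>0 + \<beta> whose exact order at \<open>p\<close> is
    \<beta> will do; \<open>row_reduced_minorE\<close> supplies one for \<beta> = 0 and one for
    \<beta> = \<alpha>1.\<close>
  have count: "(\<Sum>i\<in>I. \<alpha>0 + \<beta> - d0 i - min (d1 i) \<beta>) \<le> \<alpha>0 + 2 * \<beta>"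
    if fg: "f ` {..<\<alpha>0 + \<beta>} \<subseteq> {..<n}" "g ` {..<\<alpha>0 + \<beta>} \<subseteq> {..<n}"
      and nd: "\<not> ?p ^ Suc \<beta> dvd fdet (\<alpha>0 + \<beta>) (\<lambda>i j. P (f i) (g j))" for f g \<beta>
  proof -
    let ?k = "\<alpha>0 + \<beta>"
    let ?D = "fdet ?k (\<lambda>i j. P (f i) (g j))"
    have "?p ^ \<beta> dvd ?D" using dvd1[OF fg] by simp
    then obtain h where h: "?D = ?p ^ \<beta> * h" by (rule dvdE)
    have "p \<noteq> 0" using p unfolding prime_elem_def by blast
    then have p0: "?p ^ \<beta> \<noteq> 0" "p ^ \<beta> \<noteq> 0" by auto
    have ph: "?p ^ \<beta> * q = Polynomial.smult (p ^ \<beta>) q" for q by (simp add: poly_const_pow)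
    show ?thesis
    proof (rule root_count_mod[OF p I dist])
      show "\<not> [:p:] dvd h"
      proof
        assume "[:p:] dvd h"
        then have "?p ^ \<beta> * ?p dvd ?D" unfolding h by (rule mult_dvd_mono[OF dvd_refl])
        then show False using nd unfolding power_Suc2 by blast
      qed
      fix m assume m: "\<alpha>0 + 2 * \<beta> < m"
      have "coeff_filtered p 1 (P a b)" for a b
        unfolding coeff_filtered_def
      proof
        fix l :: nat
        consider "l = 0" | "l = 1" | "l = 2" | "l \<ge> 3" by linarith
        then show "p ^ (l - 1) dvd Polynomial.coeff (P a b) l"
        proof cases
          case 4
          then show ?thesis by (simp add: P_def coeff_eq_0)
        qed (simp_all add: P_def numeral_2_eq_2)
      qed
      then have "coeff_filtered p ?k ?D" by (intro coeff_filtered_fdet)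
      then have "p ^ (m - ?k) dvd p ^ \<beta> * Polynomial.coeff h m" unfolding coeff_filtered_def h ph by simp
      \<comment> \<open>A degree above \<alpha>0 + 2 \<beta> exceeds \<open>?k\<close> by more than
        \<beta>, so one factor \<open>p\<close> remains in the coefficient after p^\<beta> is
        removed.\<close>
      moreover have "p ^ (\<beta> + 1) dvd p ^ (m - ?k)" using m by (intro le_imp_power_dvd) simp
      ultimately have "p ^ (\<beta> + 1) dvd p ^ \<beta> * Polynomial.coeff h m" by (rule dvd_trans[rotated])
      then have "p ^ \<beta> * p dvd p ^ \<beta> * Polynomial.coeff h m" by (simp only: power_add power_one_right)
      then show "p dvd Polynomial.coeff h m" unfolding dvd_mult_cancel_left using p0(2) by blast
    next
      fix i assume i: "i \<in> I"
      note Ui = row_reducedD(1)[OF red[OF i]] and ei = row_reducedD(2)[OF red[OF i]]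
        and Ni = row_reducedD(3)[OF red[OF i]]
      define s where "s = [:- x i, 1:]"
      have s: "\<not> ?p dvd s"
      proof
        assume "?p dvd s"
        then have "p dvd Polynomial.coeff s 1" unfolding const_poly_dvd_iff by blast
        moreover have "Polynomial.coeff s 1 = 1" by (simp add: s_def)
        ultimately show False using p unfolding prime_elem_def by metis
      qed
      \<comment> \<open>The reduction at \<open>x i\<close>, read with constant polynomials, holds
        over \<int>[t] up to a multiple of t - x_i, by the remainder theorem.\<close>
      have "\<exists>q. (\<Sum>l<n. [:U i a l:] * P l b) = ?p ^ e i a * [:N i a b:] + s * q" if ab: "a < n" "b < n" for a b
      proof -
        have "poly (\<Sum>l<n. [:U i a l:] * P l b) (x i) = p ^ e i a * N i a b"
          using Ni[OF ab] by (simp add: poly_sum)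
        moreover obtain q where q: "(\<Sum>l<n. [:U i a l:] * P l b) = [:poly (\<Sum>l<n. [:U i a l:] * P l b) (x i):] + s * q"
          using poly_split_at unfolding s_def by blast
        moreover have "?p ^ e i a * [:N i a b:] = [:p ^ e i a * N i a b:]" by (simp add: poly_const_pow)
        ultimately have "(\<Sum>l<n. [:U i a l:] * P l b) = ?p ^ e i a * [:N i a b:] + s * q" by simp
        then show ?thesis by blast
      qed
      note ex = this
      define Q where "Q a b = (SOME q. (\<Sum>l<n. [:U i a l:] * P l b) = ?p ^ e i a * [:N i a b:] + s * q)" for a b
      have Q: "(\<Sum>l<n. [:U i a l:] * P l b) = ?p ^ e i a * [:N i a b:] + s * Q a b" if "a < n" "b < n" for a b
        unfolding Q_def by (rule someI_ex) (rule ex[OF that])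
      have "\<exists>u v. fdet n (\<lambda>a b. [:U i a b:]) ^ ?k * ?D =
          ?p ^ Suc \<beta> * u + ?p ^ \<beta> * s ^ (?k - d0 i - min (d1 i) \<beta>) * v"
        by (rule minor_order[where U = "\<lambda>a b. [:U i a b:]" and R = "\<lambda>a b. [:N i a b:]", OF pp s T M \<alpha>0_def ei Q d0[OF i] d1[OF i] fg])
      then obtain u v where uv: "fdet n (\<lambda>a b. [:U i a b:]) ^ ?k * ?D =
          ?p ^ Suc \<beta> * u + ?p ^ \<beta> * s ^ (?k - d0 i - min (d1 i) \<beta>) * v" by blast
      have "?p ^ \<beta> * ([:fdet n (U i) ^ ?k:] * h) = ?p ^ \<beta> * (?p * u + s ^ (?k - d0 i - min (d1 i) \<beta>) * v)"
        using uv unfolding h fdet_const_poly poly_const_pow[of "fdet n (U i)"] power_Suc2 by (simp only: distrib_left mult_ac)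
      then have "[:fdet n (U i) ^ ?k:] * h = ?p * u + s ^ (?k - d0 i - min (d1 i) \<beta>) * v"
        by (simp only: mult_left_cancel[OF p0(1)])
      moreover have "\<not> p dvd fdet n (U i) ^ ?k" by (rule prime_elem_not_dvd_power[OF p Ui])
      ultimately show "\<exists>c u v. \<not> p dvd c \<and> [:c:] * h = ?p * u + [:- x i, 1:] ^ (?k - d0 i - min (d1 i) \<beta>) * v"
        unfolding s_def by blast
    qed
  qed
  obtain f g where "f ` {..<\<alpha>0} \<subseteq> {..<n}" "g ` {..<\<alpha>0} \<subseteq> {..<n}" "\<not> ?p ^ Suc 0 dvd fdet \<alpha>0 (\<lambda>i j. P (f i) (g j))"
    by (rule row_reduced_minorE[OF pp TEM one_le_numeral cE(1) cE(6)])
  then have "(\<Sum>i\<in>I. \<alpha>0 - d0 i) \<le> \<alpha>0" using count[of f 0 g] by simp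
  moreover obtain f g where "f ` {..<\<alpha>0 + \<alpha>1} \<subseteq> {..<n}" "g ` {..<\<alpha>0 + \<alpha>1} \<subseteq> {..<n}"
     "\<not> ?p ^ Suc \<alpha>1 dvd fdet (\<alpha>0 + \<alpha>1) (\<lambda>i j. P (f i) (g j))"
    by (rule row_reduced_minorE[OF pp TEM order_refl cE(2) cE(5)])
  then have "(\<Sum>i\<in>I. \<alpha>0 + \<alpha>1 - d0 i - min (d1 i) \<alpha>1) \<le> \<alpha>0 + 2 * \<alpha>1" by (rule count)
  ultimately show ?thesis using bounds by blast
qed

section \<open>Residues of p-adic integers\<close>

lemma padic_carrier_iff:
  "x \<in> carrier (padic_int p) \<longleftrightarrow> (\<forall>k. 0 \<le> x k \<and> x k < p ^ k \<and> x (Suc k) mod p ^ k = x k)"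
  by (auto simp: padic_int_def)

lemma padic_add: "(x \<oplus>\<^bsub>padic_int p\<^esub> y) k = (x k + y k) mod p ^ k"
  and padic_mult: "(x \<otimes>\<^bsub>padic_int p\<^esub> y) k = (x k * y k) mod p ^ k"
  and padic_zero: "\<zero>\<^bsub>padic_int p\<^esub> k = 0"
  and padic_one: "\<one>\<^bsub>padic_int p\<^esub> k = 1 mod p ^ k"
  by (simp_all add: padic_int_def)

lemma padic_level_range:
  assumes "x \<in> carrier (padic_int p)"
  shows "0 \<le> x k" "x k < p ^ k" "x k mod p ^ k = x k"
  using assms by (auto simp: padic_carrier_iff)

lemma padic_level_mod:
  assumes "x \<in> carrier (padic_int p)" "j \<le> k"
  shows "x k mod p ^ j = x j"
  using assms(2)
proof (induction k rule: dec_induct)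
  case base
  show ?case by (rule padic_level_range(3)[OF assms(1)])
next
  case (step i)
  have "p ^ j dvd p ^ i" using step.hyps by (intro le_imp_power_dvd)
  then have "x (Suc i) mod p ^ j = (x (Suc i) mod p ^ i) mod p ^ j" by (rule mod_mod_cancel[symmetric])
  also have "x (Suc i) mod p ^ i = x i" using assms(1) by (auto simp: padic_carrier_iff)
  finally show ?case using step.IH by simp
qed

lemma padic_of_int_closed:
  assumes "p > 1"
  shows "padic_of_int p a \<in> carrier (padic_int p)"
proof -
  have "p ^ k dvd p ^ Suc k" for k by simp
  then have "a mod p ^ Suc k mod p ^ k = a mod p ^ k" for k by (rule mod_mod_cancel)
  then show ?thesis using assms by (simp add: padic_carrier_iff padic_of_int_def del: power_Suc)
qed

lemma p_power_closed:
  assumes "p > 1"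
  shows "p_power p r \<in> carrier (padic_int p)"
  using assms padic_of_int_closed cring.cring_simprules(2)[OF padic_int_cring[OF assms]]
  by (simp add: p_power_def split: enat.split)

lemma padic_minus:
  assumes p: "p > 1" and "x \<in> carrier (padic_int p)" "y \<in> carrier (padic_int p)"
  shows "(x \<ominus>\<^bsub>padic_int p\<^esub> y) k = (x k - y k) mod p ^ k"
proof -
  interpret cring "padic_int p" by (rule padic_int_cring[OF p])
  let ?z = "x \<ominus>\<^bsub>padic_int p\<^esub> y"
  have z: "?z \<in> carrier (padic_int p)" using assms by simp
  have "?z \<oplus>\<^bsub>padic_int p\<^esub> y = x" using assms by (simp add: minus_eq a_assoc l_neg)
  then have "(?z k + y k) mod p ^ k = x k" using padic_add by metis
  then have "(x k - y k) mod p ^ k = (?z k + y k - y k) mod p ^ k" by (metis mod_diff_left_eq)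
  then show ?thesis using padic_level_range(3)[OF z] by simp
qed

text \<open>Dividing by p^k costs \<open>k\<close> levels of precision, so level \<open>j\<close> of
  the quotient is read off from level \<open>j + k\<close> of \<open>z\<close>.\<close>

lemma padic_divide:
  assumes p: "p > 1" and z: "z \<in> carrier (padic_int p)" "z k = 0"
  shows "\<exists>w\<in>carrier (padic_int p). z = padic_of_int p (p ^ k) \<otimes>\<^bsub>padic_int p\<^esub> w"
proof
  define w where "w j = z (j + k) div p ^ k" for j
  have pk: "p ^ k > 0" for k using p by simp
  have zw: "z (j + k) = p ^ k * w j" for j
    using padic_level_mod[OF z(1), of k "j + k"] z(2) unfolding w_def
    by (metis dvd_mult_div_cancel le_add2 mod_0_imp_dvd)
  show w: "w \<in> carrier (padic_int p)"
    unfolding padic_carrier_iff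
  proof (intro allI conjI)
    fix j
    have "0 \<le> p ^ k * w j" "p ^ k * w j < p ^ k * p ^ j"
      using padic_level_range(1,2)[OF z(1), of "j + k"] by (simp_all only: zw power_add mult.commute)
    then show "0 \<le> w j" "w j < p ^ j" using pk[of k] by (simp_all add: zero_le_mult_iff)
    have "(p ^ k * w (Suc j)) mod (p ^ k * p ^ j) = p ^ k * w j"
      using padic_level_mod[OF z(1), of "j + k" "Suc j + k"] zw[of j] zw[of "Suc j"] by (simp add: power_add mult.commute)
    then show "w (Suc j) mod p ^ j = w j" using p unfolding mult_mod_right[symmetric] by auto
  qed
  show "z = padic_of_int p (p ^ k) \<otimes>\<^bsub>padic_int p\<^esub> w"
  proof
    fix j
    have "(padic_of_int p (p ^ k) \<otimes>\<^bsub>padic_int p\<^esub> w) j = (p ^ k * w j) mod p ^ j"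
      by (simp add: padic_mult padic_of_int_def mod_mult_left_eq)
    also have "\<dots> = z (j + k) mod p ^ j" by (simp only: zw)
    finally show "z j = (padic_of_int p (p ^ k) \<otimes>\<^bsub>padic_int p\<^esub> w) j"
      using padic_level_mod[OF z(1), of j "j + k"] by simp
  qed
qed

text \<open>For finite \<open>r\<close> the level \<open>r\<close> alone decides; asking for all
  levels up to \<open>r\<close> gives one description that also covers r = \<infinity>, where it
  says that \<open>z\<close> is 0.\<close>

lemma p_ideal_iff:
  assumes p: "p > 1"
  shows "z \<in> p_ideal p r \<longleftrightarrow> z \<in> carrier (padic_int p) \<and> (\<forall>k. enat k \<le> r \<longrightarrow> z k = 0)"
proof -
  interpret cring "padic_int p" by (rule padic_int_cring[OF p])
  have I: "p_ideal p r = {w \<otimes>\<^bsub>padic_int p\<^esub> p_power p r | w. w \<in> carrier (padic_int p)}"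
    by (simp add: p_ideal_def cgenideal_def)
  show ?thesis
  proof
    assume "z \<in> p_ideal p r"
    then obtain w where w: "w \<in> carrier (padic_int p)" "z = w \<otimes>\<^bsub>padic_int p\<^esub> p_power p r" unfolding I by blast
    have "z \<in> carrier (padic_int p)" using w p_power_closed[OF p] by simp
    moreover have "z k = 0" if "enat k \<le> r" for k
    proof (cases r)
      case (enat j)
      then have "p ^ k dvd p ^ j" using that by (intro le_imp_power_dvd) simp
      then have "p_power p r k = 0" using enat by (simp add: p_power_def padic_of_int_def)
      then show ?thesis using w(2) by (simp add: padic_mult)
    next
      case infinity
      then show ?thesis using w(2) by (simp add: padic_mult p_power_def padic_zero)
    qed
    ultimately show "z \<in> carrier (padic_int p) \<and> (\<forall>k. enat k \<le> r \<longrightarrow> z k = 0)" by blast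
  next
    assume z: "z \<in> carrier (padic_int p) \<and> (\<forall>k. enat k \<le> r \<longrightarrow> z k = 0)"
    show "z \<in> p_ideal p r"
    proof (cases r)
      case (enat j)
      then obtain w where w: "w \<in> carrier (padic_int p)" "z = padic_of_int p (p ^ j) \<otimes>\<^bsub>padic_int p\<^esub> w"
        using padic_divide[OF p, of z j] z by auto
      then have "z = w \<otimes>\<^bsub>padic_int p\<^esub> p_power p r"
        using m_comm[OF w(1) p_power_closed[OF p, of r]] enat by (simp add: p_power_def)
      then show ?thesis unfolding I using w(1) by blast
    next
      case infinity
      then have "z = \<zero>\<^bsub>padic_int p\<^esub>" using z by (auto simp: padic_zero)
      also have "\<dots> = \<zero>\<^bsub>padic_int p\<^esub> \<otimes>\<^bsub>padic_int p\<^esub> p_power p r" using p_power_closed[OF p, of r] by simp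
      finally show ?thesis unfolding I by blast
    qed
  qed
qed

lemma p_ideal_ideal: "p > 1 \<Longrightarrow> ideal (p_ideal p r) (padic_int p)"
  unfolding p_ideal_def
  using cring.cgenideal_ideal[OF padic_int_cring p_power_closed] by blast

text \<open>Throughout, cosets are described as the fibres of an invariant \<open>\<phi>\<close> of their representatives.\<close>

lemma a_r_coset_fiber:
  assumes "\<And>h. h \<in> N \<Longrightarrow> h \<oplus>\<^bsub>M\<^esub> u \<in> carrier M"
    and "\<And>w. w \<in> carrier M \<Longrightarrow> (\<exists>h\<in>N. w = h \<oplus>\<^bsub>M\<^esub> u) \<longleftrightarrow> \<phi> w = \<phi> u"
  shows "N +>\<^bsub>M\<^esub> u = {w \<in> carrier M. \<phi> w = \<phi> u}"
  using assms unfolding a_r_coset_def' by auto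

lemma p_ideal_coset:
  assumes p: "p > 1" and y: "y \<in> carrier (padic_int p)"
  shows "p_ideal p r +>\<^bsub>padic_int p\<^esub> y = {w \<in> carrier (padic_int p). \<forall>k. enat k \<le> r \<longrightarrow> w k = y k}"
proof -
  interpret cring "padic_int p" by (rule padic_int_cring[OF p])
  \<comment> \<open>The invariant is the sequence of levels up to \<open>r\<close>, padded with 0
    beyond.\<close>
  have "p_ideal p r +>\<^bsub>padic_int p\<^esub> y = {w \<in> carrier (padic_int p).
     (\<lambda>k. if enat k \<le> r then w k else 0) = (\<lambda>k. if enat k \<le> r then y k else 0)}"
  proof (rule a_r_coset_fiber)
    fix h assume "h \<in> p_ideal p r"
    then show "h \<oplus>\<^bsub>padic_int p\<^esub> y \<in> carrier (padic_int p)" using y by (simp add: p_ideal_iff[OF p])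
  next
    fix w assume w: "w \<in> carrier (padic_int p)"
    show "(\<exists>h\<in>p_ideal p r. w = h \<oplus>\<^bsub>padic_int p\<^esub> y) \<longleftrightarrow>
      (\<lambda>k. if enat k \<le> r then w k else 0) = (\<lambda>k. if enat k \<le> r then y k else 0)" (is "?l \<longleftrightarrow> ?r")
    proof
      assume ?l
      then obtain h where "h \<in> p_ideal p r" "w = h \<oplus>\<^bsub>padic_int p\<^esub> y" by blast
      then show ?r using padic_level_range(3)[OF y] by (auto simp: p_ideal_iff[OF p] padic_add)
    next
      assume r: ?r
      have "w k = y k" if "enat k \<le> r" for k using that fun_cong[OF r, of k] by simp
      then have "w \<ominus>\<^bsub>padic_int p\<^esub> y \<in> p_ideal p r"
        using w y by (simp add: p_ideal_iff[OF p] padic_minus[OF p])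
      moreover have "w = (w \<ominus>\<^bsub>padic_int p\<^esub> y) \<oplus>\<^bsub>padic_int p\<^esub> y"
        using w y by (simp add: minus_eq a_assoc l_neg)
      ultimately show ?l by blast
    qed
  qed
  also have "\<dots> = {w \<in> carrier (padic_int p). \<forall>k. enat k \<le> r \<longrightarrow> w k = y k}"
    by (auto simp: fun_eq_iff)
  finally show ?thesis .
qed

text \<open>The level \<open>k\<close> residue of the elements of a coset of \<open>p ^ r\<close>; it is meaningful for \<open>k \<le> r\<close> only.\<close>

definition residue :: "nat \<Rightarrow> padic set \<Rightarrow> int" where
  "residue k X = (SOME x. x \<in> X) k"

lemma residue_coset:
  assumes "p > 1" "y \<in> carrier (padic_int p)" "enat k \<le> r"
  shows "residue k (p_ideal p r +>\<^bsub>padic_int p\<^esub> y) = y k"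
proof -
  have "y \<in> p_ideal p r +>\<^bsub>padic_int p\<^esub> y" using assms by (simp add: p_ideal_coset)
  then have "(SOME x. x \<in> p_ideal p r +>\<^bsub>padic_int p\<^esub> y) \<in> p_ideal p r +>\<^bsub>padic_int p\<^esub> y"
    unfolding some_in_eq by blast
  then show ?thesis using assms by (simp add: residue_def p_ideal_coset)
qed

lemma padic_mod_carrier: "carrier (padic_mod p r) = padic_reduce p r ` carrier (padic_int p)"
  by (auto simp: padic_mod_def FactRing_def A_RCOSETS_def' padic_reduce_def)

lemma padic_mod_cring: "p > 1 \<Longrightarrow> cring (padic_mod p r)"
  unfolding padic_mod_def by (rule ideal.quotient_is_cring[OF p_ideal_ideal padic_int_cring])

lemma padic_reduce_hom: "p > 1 \<Longrightarrow> padic_reduce p r \<in> Ring.ring_hom (padic_int p) (padic_mod p r)"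
  unfolding padic_mod_def padic_reduce_def[abs_def] using ideal.rcos_ring_hom[OF p_ideal_ideal] .

lemma residue_reduce: "p > 1 \<Longrightarrow> y \<in> carrier (padic_int p) \<Longrightarrow> residue k (padic_reduce p (enat k) y) = y k"
  by (simp add: padic_reduce_def residue_coset)

lemma padic_reduce_eq_iff:
  assumes "p > 1" "x \<in> carrier (padic_int p)" "y \<in> carrier (padic_int p)"
  shows "padic_reduce p (enat k) x = padic_reduce p (enat k) y \<longleftrightarrow> x k = y k"
proof
  assume "padic_reduce p (enat k) x = padic_reduce p (enat k) y"
  then show "x k = y k" using residue_reduce assms by metis
next
  assume "x k = y k"
  then have "x j = y j" if "j \<le> k" for j using padic_level_mod assms that by metis
  then show "padic_reduce p (enat k) x = padic_reduce p (enat k) y"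
    using assms by (auto simp: padic_reduce_def p_ideal_coset)
qed

lemma residue_range:
  assumes "p > 1" "X \<in> carrier (padic_mod p (enat k))"
  shows "0 \<le> residue k X" "residue k X < p ^ k"
  using assms padic_level_range by (auto simp: padic_mod_carrier residue_reduce)

lemma residue_mod: "p > 1 \<Longrightarrow> X \<in> carrier (padic_mod p (enat k)) \<Longrightarrow> residue k X mod p ^ k = residue k X"
  using residue_range by simp

lemma residue_eq_iff:
  assumes "p > 1" "X \<in> carrier (padic_mod p (enat k))" "Y \<in> carrier (padic_mod p (enat k))"
  shows "X = Y \<longleftrightarrow> residue k X = residue k Y"
proof -
  obtain x y where "x \<in> carrier (padic_int p)" "y \<in> carrier (padic_int p)"
    "X = padic_reduce p (enat k) x" "Y = padic_reduce p (enat k) y" using assms by (auto simp: padic_mod_carrier)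
  then show ?thesis using assms(1) by (simp only: padic_reduce_eq_iff residue_reduce)
qed

lemma residue_add:
  assumes p: "p > 1" and X: "X \<in> carrier (padic_mod p (enat k))" and Y: "Y \<in> carrier (padic_mod p (enat k))"
  shows "residue k (X \<oplus>\<^bsub>padic_mod p (enat k)\<^esub> Y) = (residue k X + residue k Y) mod p ^ k"
proof -
  interpret cring "padic_int p" by (rule padic_int_cring[OF p])
  obtain x y where xy: "x \<in> carrier (padic_int p)" "y \<in> carrier (padic_int p)"
    "X = padic_reduce p (enat k) x" "Y = padic_reduce p (enat k) y" using X Y by (auto simp: padic_mod_carrier)
  then have "X \<oplus>\<^bsub>padic_mod p (enat k)\<^esub> Y = padic_reduce p (enat k) (x \<oplus>\<^bsub>padic_int p\<^esub> y)"
    using ring_hom_add[OF padic_reduce_hom[OF p]] by metis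
  then show ?thesis using xy by (simp add: residue_reduce[OF p] padic_add)
qed

lemma residue_mult:
  assumes p: "p > 1" and X: "X \<in> carrier (padic_mod p (enat k))" and Y: "Y \<in> carrier (padic_mod p (enat k))"
  shows "residue k (X \<otimes>\<^bsub>padic_mod p (enat k)\<^esub> Y) = (residue k X * residue k Y) mod p ^ k"
proof -
  interpret cring "padic_int p" by (rule padic_int_cring[OF p])
  obtain x y where xy: "x \<in> carrier (padic_int p)" "y \<in> carrier (padic_int p)"
    "X = padic_reduce p (enat k) x" "Y = padic_reduce p (enat k) y" using X Y by (auto simp: padic_mod_carrier)
  then have "X \<otimes>\<^bsub>padic_mod p (enat k)\<^esub> Y = padic_reduce p (enat k) (x \<otimes>\<^bsub>padic_int p\<^esub> y)"
    using ring_hom_mult[OF padic_reduce_hom[OF p]] by metis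
  then show ?thesis using xy by (simp add: residue_reduce[OF p] padic_mult)
qed

lemma residue_finsum:
  assumes p: "p > 1" and f: "\<And>i. i \<in> A \<Longrightarrow> f i \<in> carrier (padic_mod p (enat k))" and A: "finite A"
  shows "residue k (\<Oplus>\<^bsub>padic_mod p (enat k)\<^esub>i\<in>A. f i) = (\<Sum>i\<in>A. residue k (f i)) mod p ^ k"
proof -
  interpret R: cring "padic_mod p (enat k)" by (rule padic_mod_cring[OF p])
  interpret Z: cring "padic_int p" by (rule padic_int_cring[OF p])
  have zero: "residue k \<zero>\<^bsub>padic_mod p (enat k)\<^esub> = 0"
  proof -
    have "padic_reduce p (enat k) \<zero>\<^bsub>padic_int p\<^esub> = \<zero>\<^bsub>padic_mod p (enat k)\<^esub>"
      by (rule ring_hom_zero[OF padic_reduce_hom[OF p] Z.ring_axioms R.ring_axioms])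
    then show ?thesis using residue_reduce[OF p, of "\<zero>\<^bsub>padic_int p\<^esub>" k] by (simp add: padic_zero)
  qed
  show ?thesis using A f
  proof (induction A)
    case empty
    then show ?case by (simp add: zero)
  next
    case (insert a A)
    then have "residue k (\<Oplus>\<^bsub>padic_mod p (enat k)\<^esub>i\<in>insert a A. f i) =
        residue k (f a \<oplus>\<^bsub>padic_mod p (enat k)\<^esub> (\<Oplus>\<^bsub>padic_mod p (enat k)\<^esub>i\<in>A. f i))"
      by (subst R.finsum_insert) auto
    also have "\<dots> = (residue k (f a) + (\<Sum>i\<in>A. residue k (f i)) mod p ^ k) mod p ^ k"
      using insert by (subst residue_add[OF p]) (auto intro!: R.finsum_closed)
    finally show ?case using insert.hyps by (simp add: mod_add_right_eq)
  qed
qed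

definition residue_class :: "int \<Rightarrow> nat \<Rightarrow> int \<Rightarrow> padic set" where
  "residue_class p k a = padic_reduce p (enat k) (padic_of_int p a)"

lemma residue_class:
  assumes "p > 1"
  shows "residue_class p k a \<in> carrier (padic_mod p (enat k))" "residue k (residue_class p k a) = a mod p ^ k"
  using assms padic_of_int_closed[OF assms]
  by (auto simp: residue_class_def padic_mod_carrier residue_reduce) (simp add: padic_of_int_def)

section \<open>Cokernels modulo the square of p\<close>

lemma card_image_eq_fibers:
  assumes "\<And>u v. u \<in> S \<Longrightarrow> v \<in> S \<Longrightarrow> c u = c v \<longleftrightarrow> \<phi> u = \<phi> v"
  shows "card (c ` S) = card (\<phi> ` S)"
proof (rule bij_betw_same_card)
  have *: "\<phi> (inv_into S c (c u)) = \<phi> u" if "u \<in> S" for u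
  proof -
    have "inv_into S c (c u) \<in> S" "c (inv_into S c (c u)) = c u"
      using that by (simp_all only: inv_into_into f_inv_into_f imageI)
    then show ?thesis using assms that by blast
  qed
  show "bij_betw (\<lambda>X. \<phi> (inv_into S c X)) (c ` S) (\<phi> ` S)"
    unfolding bij_betw_def
  proof
    show "inj_on (\<lambda>X. \<phi> (inv_into S c X)) (c ` S)"
    proof (rule inj_onI, elim imageE)
      fix X Y u v assume uv: "u \<in> S" "X = c u" "v \<in> S" "Y = c v"
        and eq: "\<phi> (inv_into S c X) = \<phi> (inv_into S c Y)"
      have "\<phi> u = \<phi> v" using eq unfolding uv *[OF uv(1)] *[OF uv(3)] .
      then show "X = Y" unfolding uv using assms uv by blast
    qed
    show "(\<lambda>X. \<phi> (inv_into S c X)) ` c ` S = \<phi> ` S"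
      unfolding image_image by (rule image_cong[OF refl *])
  qed
qed

lemma image_PiE_coordinatewise:
  "(\<lambda>g. \<lambda>i\<in>I. F i (g i)) ` PiE I S = PiE I (\<lambda>i. F i ` S i)"
proof
  show "(\<lambda>g. \<lambda>i\<in>I. F i (g i)) ` PiE I S \<subseteq> PiE I (\<lambda>i. F i ` S i)"
  proof (rule image_subsetI)
    fix g assume g: "g \<in> PiE I S"
    show "(\<lambda>i\<in>I. F i (g i)) \<in> PiE I (\<lambda>i. F i ` S i)"
      unfolding restrict_PiE_iff using PiE_mem[OF g] by (intro ballI imageI)
  qed
  show "PiE I (\<lambda>i. F i ` S i) \<subseteq> (\<lambda>g. \<lambda>i\<in>I. F i (g i)) ` PiE I S"
  proof
    fix h assume h: "h \<in> PiE I (\<lambda>i. F i ` S i)"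
    define g where "g = (\<lambda>i\<in>I. inv_into (S i) (F i) (h i))"
    have "g \<in> PiE I S"
      unfolding g_def restrict_PiE_iff using PiE_mem[OF h] by (intro ballI inv_into_into)
    moreover have "h = (\<lambda>i\<in>I. F i (g i))"
    proof (rule PiE_ext[OF h])
      show "(\<lambda>i\<in>I. F i (g i)) \<in> PiE I (\<lambda>i. F i ` S i)"
        unfolding restrict_PiE_iff using PiE_mem[OF \<open>g \<in> PiE I S\<close>] by (intro ballI imageI)
      show "h i = (\<lambda>i\<in>I. F i (g i)) i" if "i \<in> I" for i
        unfolding g_def restrict_apply'[OF that] by (rule f_inv_into_f[OF PiE_mem[OF h that], symmetric])
    qed
    ultimately show "h \<in> (\<lambda>g. \<lambda>i\<in>I. F i (g i)) ` PiE I S"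
      using image_eqI[of h "\<lambda>g. \<lambda>i\<in>I. F i (g i)" g] by simp
  qed
qed

text \<open>The box holds the canonical representatives of a product of groups \<int>/p^(\<epsilon>
  i), and the image holds those of the multiples of \<open>p\<close>. In a factor these are trivial
  for \<epsilon> i \<le> 1 and \<open>p\<close> in number for \<epsilon> i = 2.\<close>

lemma card_residue_box:
  fixes p :: int and \<epsilon> :: "'i \<Rightarrow> nat"
  assumes p: "p > 1" and I: "finite I" and \<epsilon>: "\<And>i. i \<in> I \<Longrightarrow> \<epsilon> i \<le> 2"
  shows "card (PiE I (\<lambda>i. {0..<p ^ \<epsilon> i})) = nat p ^ (\<Sum>i\<in>I. \<epsilon> i)"
    and "card ((\<lambda>g. \<lambda>i\<in>I. (p * g i) mod p ^ \<epsilon> i) ` PiE I (\<lambda>i. {0..<p ^ \<epsilon> i})) = nat p ^ card {i \<in> I. \<epsilon> i = 2}"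
proof -
  show "card (PiE I (\<lambda>i. {0..<p ^ \<epsilon> i})) = nat p ^ (\<Sum>i\<in>I. \<epsilon> i)"
    using p I by (simp add: card_PiE nat_power_eq power_sum)
  have c: "card ((\<lambda>y. (p * y) mod p ^ \<epsilon> i) ` {0..<p ^ \<epsilon> i}) = (if \<epsilon> i = 2 then nat p else 1)" if i: "i \<in> I" for i
  proof -
    consider "\<epsilon> i = 0" | "\<epsilon> i = 1" | "\<epsilon> i = 2" using \<epsilon>[OF i] by linarith
    then show ?thesis
    proof cases
      case 1
      have "(\<lambda>y. (p * y) mod p ^ 0) ` {0..<p ^ 0} = {0}" by (auto intro!: image_eqI[of _ _ 0])
      then show ?thesis using 1 by simp
    next
      case 2
      have "(\<lambda>y. (p * y) mod p) ` {0..<p} = {0}" using p by (auto intro!: image_eqI[of _ _ 0])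
      then show ?thesis using 2 by simp
    next
      case 3
      have "(p * y) mod p ^ 2 = p * (y mod p)" for y
        by (simp add: power2_eq_square)
      then have "(\<lambda>y. (p * y) mod p ^ 2) ` {0..<p ^ 2} = (\<lambda>y. p * (y mod p)) ` {0..<p ^ 2}" by simp
      also have "\<dots> = (\<lambda>y. p * y) ` {0..<p}"
      proof
        show "(\<lambda>y. p * (y mod p)) ` {0..<p ^ 2} \<subseteq> (\<lambda>y. p * y) ` {0..<p}" using p by auto
        show "(\<lambda>y. p * y) ` {0..<p} \<subseteq> (\<lambda>y. p * (y mod p)) ` {0..<p ^ 2}"
        proof
          fix z assume "z \<in> (\<lambda>y. p * y) ` {0..<p}"
          then obtain y where y: "z = p * y" "0 \<le> y" "y < p" by auto
          have "p * 1 \<le> p * p" using p by (intro mult_left_mono) auto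
          then have "y < p ^ 2" using y(3) by (simp add: power2_eq_square)
          then show "z \<in> (\<lambda>y. p * (y mod p)) ` {0..<p ^ 2}"
            using y by (intro image_eqI[of _ _ y]) auto
        qed
      qed
      also have "card \<dots> = nat p" using p by (subst card_image) (auto simp: inj_on_def)
      finally show ?thesis using 3 by simp
    qed
  qed
  have "card ((\<lambda>g. \<lambda>i\<in>I. (p * g i) mod p ^ \<epsilon> i) ` PiE I (\<lambda>i. {0..<p ^ \<epsilon> i}))
      = (\<Prod>i\<in>I. card ((\<lambda>y. (p * y) mod p ^ \<epsilon> i) ` {0..<p ^ \<epsilon> i}))"
    unfolding image_PiE_coordinatewise[where F = "\<lambda>i y. (p * y) mod p ^ \<epsilon> i"] by (rule card_PiE[OF I])
  also have "\<dots> = (\<Prod>i\<in>I. if \<epsilon> i = 2 then nat p else 1)" by (rule prod.cong[OF refl c])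
  also have "\<dots> = (\<Prod>i\<in>{i \<in> I. \<epsilon> i = 2}. nat p)"
    by (rule prod.mono_neutral_cong_right) (use I in auto)
  finally show "card ((\<lambda>g. \<lambda>i\<in>I. (p * g i) mod p ^ \<epsilon> i) ` PiE I (\<lambda>i. {0..<p ^ \<epsilon> i})) = nat p ^ card {i \<in> I. \<epsilon> i = 2}"
    by simp
qed

text \<open>Only these two numbers are extracted from an isomorphism, so no uniqueness theorem for
  elementary divisors has to be invoked.\<close>

lemma module_isomorphic_cards:
  assumes "module_isomorphic R M N" and a: "a \<in> carrier R"
    and cl: "\<And>x. x \<in> carrier M \<Longrightarrow> a \<odot>\<^bsub>M\<^esub> x \<in> carrier M"
  shows "card (carrier M) = card (carrier N)"
    and "card ((\<lambda>x. a \<odot>\<^bsub>M\<^esub> x) ` carrier M) = card ((\<lambda>x. a \<odot>\<^bsub>N\<^esub> x) ` carrier N)"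
proof -
  obtain f where f: "f \<in> module_hom R M N" and bij: "bij_betw f (carrier M) (carrier N)"
    using assms(1) by (auto simp: module_isomorphic_def)
  show "card (carrier M) = card (carrier N)" by (rule bij_betw_same_card[OF bij])
  have "(\<lambda>x. a \<odot>\<^bsub>N\<^esub> x) ` carrier N = (\<lambda>x. a \<odot>\<^bsub>N\<^esub> f x) ` carrier M"
    using bij_betw_imp_surj_on[OF bij] by (auto simp flip: image_image)
  also have "\<dots> = f ` (\<lambda>x. a \<odot>\<^bsub>M\<^esub> x) ` carrier M"
    unfolding image_image using f a by (intro image_cong) (auto simp: module_hom_def)
  finally show "card ((\<lambda>x. a \<odot>\<^bsub>M\<^esub> x) ` carrier M) = card ((\<lambda>x. a \<odot>\<^bsub>N\<^esub> x) ` carrier N)"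
    using card_image[of f "(\<lambda>x. a \<odot>\<^bsub>M\<^esub> x) ` carrier M"] cl bij_betw_imp_inj_on[OF bij]
    by (metis image_subsetI inj_on_subset)
qed

text \<open>Shared by the cokernel and by H/p^2 H. The invariant \<phi> labels cosets by elements of
  a product of groups \<int>/p^(\<epsilon> i); \<open>s\<close> multiplies representatives by
  \<open>p\<close>, and \<open>T\<close> is the induced map on cosets.\<close>

lemma coset_cards:
  fixes p :: int
  assumes p: "p > 1" and I: "finite I" and \<epsilon>: "\<And>i. i \<in> I \<Longrightarrow> \<epsilon> i \<le> (2 :: nat)"
    and fib: "\<And>u. u \<in> carrier M \<Longrightarrow> N +>\<^bsub>M\<^esub> u = {w \<in> carrier M. \<phi> w = \<phi> u}"
    and img: "\<phi> ` carrier M = PiE I (\<lambda>i. {0..<p ^ \<epsilon> i})"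
    and s: "\<And>u. u \<in> carrier M \<Longrightarrow> s u \<in> carrier M"
    and \<phi>s: "\<And>u. u \<in> carrier M \<Longrightarrow> \<phi> (s u) = (\<lambda>i\<in>I. (p * \<phi> u i) mod p ^ \<epsilon> i)"
    and T: "\<And>u. u \<in> carrier M \<Longrightarrow> T (N +>\<^bsub>M\<^esub> u) = N +>\<^bsub>M\<^esub> (s u)"
  shows "card (a_rcosets\<^bsub>M\<^esub> N) = nat p ^ (\<Sum>i\<in>I. \<epsilon> i)"
    and "card (T ` (a_rcosets\<^bsub>M\<^esub> N)) = nat p ^ card {i \<in> I. \<epsilon> i = 2}"
    and "\<And>X. X \<in> a_rcosets\<^bsub>M\<^esub> N \<Longrightarrow> T X \<in> a_rcosets\<^bsub>M\<^esub> N"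
proof -
  have rc: "a_rcosets\<^bsub>M\<^esub> N = (\<lambda>u. N +>\<^bsub>M\<^esub> u) ` carrier M" by (auto simp: A_RCOSETS_def')
  have eq: "N +>\<^bsub>M\<^esub> u = N +>\<^bsub>M\<^esub> v \<longleftrightarrow> \<phi> u = \<phi> v" if "u \<in> carrier M" "v \<in> carrier M" for u v
    unfolding fib[OF that(1)] fib[OF that(2)] using that by auto
  show "card (a_rcosets\<^bsub>M\<^esub> N) = nat p ^ (\<Sum>i\<in>I. \<epsilon> i)"
  proof -
    have "card (a_rcosets\<^bsub>M\<^esub> N) = card (\<phi> ` carrier M)"
      unfolding rc by (rule card_image_eq_fibers[OF eq])
    then show ?thesis unfolding img by (simp only: card_residue_box(1)[OF p I \<epsilon>])
  qed
  have "T ` (a_rcosets\<^bsub>M\<^esub> N) = (\<lambda>u. N +>\<^bsub>M\<^esub> u) ` s ` carrier M"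
    unfolding rc image_image by (rule image_cong[OF refl T])
  moreover have "card ((\<lambda>u. N +>\<^bsub>M\<^esub> u) ` s ` carrier M) = card (\<phi> ` s ` carrier M)"
    by (rule card_image_eq_fibers) (use eq s in auto)
  moreover have "\<phi> ` s ` carrier M = (\<lambda>g. \<lambda>i\<in>I. (p * g i) mod p ^ \<epsilon> i) ` \<phi> ` carrier M"
    unfolding image_image by (rule image_cong[OF refl \<phi>s])
  ultimately show "card (T ` (a_rcosets\<^bsub>M\<^esub> N)) = nat p ^ card {i \<in> I. \<epsilon> i = 2}"
    unfolding img using card_residue_box(2)[OF p I \<epsilon>] by simp
  show "T X \<in> a_rcosets\<^bsub>M\<^esub> N" if "X \<in> a_rcosets\<^bsub>M\<^esub> N" for X
    using that unfolding rc using T s by auto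
qed

lemma inverse_mod_prime_power:
  fixes p a :: int
  assumes "prime p" "\<not> p dvd a"
  shows "\<exists>b. p ^ k dvd a * b - 1"
proof -
  have "coprime a (p ^ k)"
    using prime_imp_coprime[OF assms] by (simp add: coprime_commute)
  then obtain b c where "b * a + c * p ^ k = 1" using bezout_int[of a "p ^ k"] by auto
  then have "a * b - 1 = p ^ k * (- c)" by (simp add: algebra_simps)
  then show ?thesis by (metis dvd_triv_left)
qed

text \<open>Describes the column space of \<open>P\<close> modulo p^K by divisibility of the entries
  of U z. Rows with \<open>e i = K\<close> impose nothing on \<open>r\<close>. The other rows of
  \<open>N\<close> have a maximal minor invertible modulo p^K, so Cramer's rule solves for the
  unknowns in its columns, the rest being 0.\<close>

lemma solve_mod_prime_power:
  fixes p :: int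
  assumes p: "prime p" and red: "row_reduced p K n m P U e N"
    and z: "\<And>i. i < n \<Longrightarrow> p ^ e i dvd (\<Sum>l<n. U i l * z l)"
  shows "\<exists>r. \<forall>l<n. p ^ K dvd z l - (\<Sum>j<m. P l j * r j)"
proof -
  have pe: "prime_elem p" using p by (rule prime_imp_prime_elem)
  obtain y where y: "\<And>i. i < n \<Longrightarrow> (\<Sum>l<n. U i l * z l) = p ^ e i * y i"
    using z unfolding dvd_def by metis
  let ?R = "{i. i < n \<and> e i < K}"
  have "\<exists>f g. inj_on f {..<card ?R} \<and> f ` {..<card ?R} \<subseteq> ?R \<and> g ` {..<card ?R} \<subseteq> {..<m} \<and>
    \<not> p dvd fdet (card ?R) (\<lambda>i j. N (f i) (g j))"
  proof (rule independent_rows_minor[OF pe])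
    fix c assume "\<And>j. j < m \<Longrightarrow> p dvd (\<Sum>i\<in>?R. c i * N i j)"
    then show "\<forall>i\<in>?R. p dvd c i" using row_reducedD(4)[OF red] by simp
  qed auto
  then obtain f g where f: "inj_on f {..<card ?R}" "f ` {..<card ?R} \<subseteq> ?R" and g: "g ` {..<card ?R} \<subseteq> {..<m}"
    and nd: "\<not> p dvd fdet (card ?R) (\<lambda>i j. N (f i) (g j))" by blast
  define k where "k = card ?R"
  define \<delta> where "\<delta> = fdet k (\<lambda>i j. N (f i) (g j))"
  have fR: "f ` {..<k} = ?R" unfolding k_def using f by (intro card_subset_eq) (auto simp: card_image)
  obtain B where B: "\<And>a c. a < k \<Longrightarrow> c < k \<Longrightarrow> (\<Sum>b<k. N (f a) (g b) * B b c) = (if a = c then \<delta> else 0)"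
    using fdet_adjugate[of k "\<lambda>i j. N (f i) (g j)"] unfolding \<delta>_def by blast
  obtain \<delta>' where \<delta>': "p ^ K dvd \<delta> * \<delta>' - 1"
    using inverse_mod_prime_power[OF p] nd unfolding \<delta>_def k_def by blast
  \<comment> \<open>Cramer's rule: \<open>B\<close> is the adjugate of the chosen square block and
    \<delta>' an inverse of its determinant modulo p^K.\<close>
  define w where "w b = \<delta>' * (\<Sum>c<k. B b c * y (f c))" for b
  define r where "r j = (\<Sum>b<k. if g b = j then w b else 0)" for j
  have Nr: "(\<Sum>j<m. N i j * r j) = (\<Sum>b<k. N i (g b) * w b)" for i
  proof -
    have "(\<Sum>j<m. N i j * r j) = (\<Sum>j<m. \<Sum>b<k. if j = g b then N i j * w b else 0)"
      unfolding r_def sum_distrib_left by (intro sum.cong) auto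
    also have "\<dots> = (\<Sum>b<k. \<Sum>j<m. if j = g b then N i j * w b else 0)" by (rule sum.swap)
    also have "\<dots> = (\<Sum>b<k. N i (g b) * w b)"
      by (rule sum.cong) (use g in \<open>auto simp: k_def\<close>)
    finally show ?thesis .
  qed
  have sol: "p ^ K dvd y i - (\<Sum>j<m. N i j * r j)" if i: "i < n" "e i < K" for i
  proof -
    obtain a where a: "a < k" "i = f a" using i fR by auto
    have "(\<Sum>b<k. N i (g b) * w b) = (\<Sum>c<k. \<delta>' * ((\<Sum>b<k. N i (g b) * B b c) * y (f c)))"
      unfolding w_def by (simp add: sum_distrib_left sum_distrib_right mult_ac) (rule sum.swap)
    also have "\<dots> = (\<Sum>c<k. if c = a then \<delta>' * \<delta> * y (f a) else 0)"
      unfolding a(2) by (rule sum.cong) (auto simp: B a)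
    also have "\<dots> = \<delta>' * \<delta> * y i" using a by simp
    finally have "y i - (\<Sum>j<m. N i j * r j) = - (\<delta> * \<delta>' - 1) * y i" unfolding Nr by (simp add: algebra_simps)
    then show ?thesis using \<delta>' by (metis dvd_minus_iff dvd_mult2)
  qed
  have "p ^ K dvd z l - (\<Sum>j<m. P l j * r j)" if l: "l < n" for l
  proof -
    \<comment> \<open>The residual vector: p^K divides U q, hence also \<open>q\<close>, because
      \<open>fdet n U\<close> is prime to \<open>p\<close>.\<close>
    define q where "q l = z l - (\<Sum>j<m. P l j * r j)" for l
    have U: "p ^ K dvd (\<Sum>l<n. U i l * q l)" if i: "i < n" for i
    proof -
      have "(\<Sum>l<n. U i l * (\<Sum>j<m. P l j * r j)) = (\<Sum>j<m. (\<Sum>l<n. U i l * P l j) * r j)"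
        by (simp add: sum_distrib_left sum_distrib_right mult.assoc) (rule sum.swap)
      also have "\<dots> = (\<Sum>j<m. p ^ e i * (N i j * r j))"
        by (intro sum.cong) (auto simp: row_reducedD(3)[OF red i])
      finally have eq: "(\<Sum>l<n. U i l * q l) = p ^ e i * (y i - (\<Sum>j<m. N i j * r j))"
        by (simp add: q_def right_diff_distrib sum_subtractf y[OF i] sum_distrib_left)
      show ?thesis
      proof (cases "e i < K")
        case True
        then show ?thesis unfolding eq using sol[OF i] by simp
      next
        case False
        then have "p ^ K dvd p ^ e i" by (intro le_imp_power_dvd) simp
        then show ?thesis unfolding eq by simp
      qed
    qed
    obtain A where A: "\<And>x i. i < n \<Longrightarrow> (\<Sum>l<n. A i l * (\<Sum>a<n. U l a * x a)) = fdet n U * x i"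
      using fdet_invert_rows by blast
    have "p ^ K dvd (\<Sum>a<n. A l a * (\<Sum>b<n. U a b * q b))"
      by (intro dvd_sum dvd_mult U) simp
    then have "p ^ K dvd fdet n U * q l" unfolding A[OF l] .
    then show ?thesis
      using prime_elem_power_dvd_cancel[OF pe row_reducedD(1)[OF red]] unfolding q_def by blast
  qed
  then show ?thesis by blast
qed

text \<open>Sending \<open>v\<close> to the entries of U v modulo p^(e i) is onto the product of the
  groups \<int>/p^(e i), because \<open>fdet n U\<close> is invertible modulo p^2. Its kernel is the
  column space of \<open>M\<close> modulo p^2, by \<open>solve_mod_prime_power\<close>. So the
  cokernel can be counted as that product.\<close>

lemma cokernel_cards:
  fixes p :: int and A :: "padic matrix"
  defines "a \<equiv> residue_class p 2 p"
  assumes p: "prime p" and A: "\<And>i j. i < n \<Longrightarrow> j < n \<Longrightarrow> A (i, j) \<in> carrier (padic_int p)"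
    and M: "\<And>i j. i < n \<Longrightarrow> j < n \<Longrightarrow> A (i, j) 2 = M i j mod p ^ 2"
    and red: "row_reduced p 2 n n M U e N"
  shows "card (carrier (cokernel_mod p 2 n A)) = nat p ^ (\<Sum>i<n. e i)"
    and "card ((\<lambda>x. a \<odot>\<^bsub>cokernel_mod p 2 n A\<^esub> x) ` carrier (cokernel_mod p 2 n A)) = nat p ^ card {i. i < n \<and> e i = 2}"
    and "\<And>X. X \<in> carrier (cokernel_mod p 2 n A) \<Longrightarrow> a \<odot>\<^bsub>cokernel_mod p 2 n A\<^esub> X \<in> carrier (cokernel_mod p 2 n A)"
proof -
  have p1: "p > 1" using p by (rule prime_gt_1_int)
  have pe: "prime_elem p" using p by (rule prime_imp_prime_elem)
  define R where "R = padic_mod p (enat 2)"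
  interpret R: cring R unfolding R_def by (rule padic_mod_cring[OF p1])
  define V where "V = R.func_space {..<n}"
  have Vc: "carrier V = {..<n} \<rightarrow>\<^sub>E carrier R"
    and Va: "\<And>u v. u \<oplus>\<^bsub>V\<^esub> v = (\<lambda>i\<in>{..<n}. u i \<oplus>\<^bsub>R\<^esub> v i)"
    and Vs: "\<And>c u. c \<odot>\<^bsub>V\<^esub> u = (\<lambda>i\<in>{..<n}. c \<otimes>\<^bsub>R\<^esub> u i)"
    by (simp_all add: V_def R.func_space_def)
  define A' where "A' = (\<lambda>(i, j)\<in>{..<n} \<times> {..<n}. padic_reduce p (enat 2) (A (i, j)))"
  define Im where "Im = mat_apply R n A' ` carrier V"
  have a: "a \<in> carrier R" "residue 2 a = p"
    using residue_class[OF p1, of 2 p] p1 unfolding a_def R_def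
    by (auto simp: power2_eq_square mod_pos_pos_trivial)
  have A'c: "A' (i, j) \<in> carrier R" "residue 2 (A' (i, j)) = M i j mod p ^ 2" if "i < n" "j < n" for i j
    using that A M by (auto simp: A'_def R_def padic_mod_carrier residue_reduce[OF p1])
  have cok: "cokernel_mod p 2 n A = quot_module V Im"
    by (simp add: cokernel_mod_def cokernel_def V_def Im_def A'_def R_def)
  define val where "val v l = residue 2 (v l)" for v :: "nat \<Rightarrow> padic set" and l
  define \<phi> where "\<phi> v = (\<lambda>i\<in>{..<n}. (\<Sum>l<n. U i l * val v l) mod p ^ e i)" for v
  have e2: "p ^ e i dvd p ^ 2" if "i < n" for i
    using row_reducedD(2)[OF red that] by (rule le_imp_power_dvd)
  have elem: "v l \<in> carrier R" if "v \<in> carrier V" "l < n" for v l using that by (auto simp: Vc)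
  have apply_closed: "mat_apply R n A' v \<in> carrier V" if "v \<in> carrier V" for v
    unfolding mat_apply_def Vc using elem[OF that] A'c by (auto intro!: R.finsum_closed R.m_closed)
  have val_apply: "val (mat_apply R n A' v) i mod p ^ 2 = (\<Sum>j<n. M i j * val v j) mod p ^ 2"
    if v: "v \<in> carrier V" and i: "i < n" for v i
  proof -
    have "val (mat_apply R n A' v) i = (\<Sum>j<n. residue 2 (A' (i, j) \<otimes>\<^bsub>R\<^esub> v j)) mod p ^ 2"
      using i A'c(1) elem[OF v] unfolding val_def mat_apply_def R_def
      by (simp, intro residue_finsum[OF p1]) (auto simp flip: R_def)
    also have "\<dots> = (\<Sum>j<n. (M i j * val v j) mod p ^ 2) mod p ^ 2"
      using i A'c elem[OF v] unfolding val_def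
      by (intro arg_cong[of _ _ "\<lambda>x. x mod _"] sum.cong refl)
        (simp add: residue_mult[OF p1, of _ 2, folded R_def] mod_mult_left_eq)
    finally show ?thesis by (simp add: mod_sum_eq)
  qed
  have val_add: "val (u \<oplus>\<^bsub>V\<^esub> v) i = (val u i + val v i) mod p ^ 2" if "u \<in> carrier V" "v \<in> carrier V" "i < n" for u v i
    using elem that unfolding val_def Va by (simp add: residue_add[OF p1, of _ 2, folded R_def])
  have add_closed: "u \<oplus>\<^bsub>V\<^esub> v \<in> carrier V" if "u \<in> carrier V" "v \<in> carrier V" for u v
    using elem that unfolding Va Vc by auto
  define vec where "vec z = (\<lambda>l\<in>{..<n}. residue_class p 2 (z l))" for z
  have vec: "vec z \<in> carrier V" "\<And>l. l < n \<Longrightarrow> val (vec z) l = z l mod p ^ 2" for z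
    using residue_class[OF p1, of 2] by (auto simp: vec_def Vc R_def val_def)
  have eqV: "u = v" if "u \<in> carrier V" "v \<in> carrier V" "\<And>l. l < n \<Longrightarrow> val u l = val v l" for u v
  proof (rule PiE_ext)
    show "u \<in> {..<n} \<rightarrow>\<^sub>E carrier R" "v \<in> {..<n} \<rightarrow>\<^sub>E carrier R" using that by (simp_all add: Vc)
    fix l assume "l \<in> {..<n}"
    then show "u l = v l" using that elem residue_eq_iff[OF p1, of _ 2, folded R_def] by (simp add: val_def)
  qed
  have img: "\<phi> ` carrier V = PiE {..<n} (\<lambda>i. {0..<p ^ e i})"
  proof
    show "\<phi> ` carrier V \<subseteq> PiE {..<n} (\<lambda>i. {0..<p ^ e i})" unfolding \<phi>_def
      by (rule image_subsetI) (use p1 in \<open>simp add: restrict_PiE_iff\<close>)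
    show "PiE {..<n} (\<lambda>i. {0..<p ^ e i}) \<subseteq> \<phi> ` carrier V"
    proof
      fix g assume g: "g \<in> PiE {..<n} (\<lambda>i. {0..<p ^ e i})"
      obtain B where B: "\<And>i j. i < n \<Longrightarrow> j < n \<Longrightarrow> (\<Sum>l<n. U i l * B l j) = (if i = j then fdet n U else 0)"
        using fdet_adjugate[of n U] by blast
      obtain \<delta> where \<delta>: "p ^ 2 dvd fdet n U * \<delta> - 1"
        using inverse_mod_prime_power[OF p row_reducedD(1)[OF red]] by blast
      \<comment> \<open>An explicit preimage: the adjugate of \<open>U\<close> applied to
        \<open>g\<close>, divided by the determinant modulo p^2 by means of \<delta>.\<close>
      define z where "z l = \<delta> * (\<Sum>j<n. B l j * g j)" for l
      have Uz: "(\<Sum>l<n. U i l * z l) mod p ^ e i = g i" if i: "i < n" for i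
      proof -
        have "(\<Sum>l<n. U i l * z l) = (\<Sum>j<n. \<delta> * ((\<Sum>l<n. U i l * B l j) * g j))"
          unfolding z_def by (simp add: sum_distrib_left sum_distrib_right mult_ac) (rule sum.swap)
        also have "\<dots> = (\<Sum>j<n. if j = i then \<delta> * fdet n U * g i else 0)"
          by (rule sum.cong) (auto simp: B i)
        finally have "(\<Sum>l<n. U i l * z l) - g i = (fdet n U * \<delta> - 1) * g i" using i by (simp add: algebra_simps)
        moreover have "p ^ e i dvd (fdet n U * \<delta> - 1) * g i" using dvd_trans[OF e2[OF i] \<delta>] by (rule dvd_mult2)
        ultimately have "(\<Sum>l<n. U i l * z l) mod p ^ e i = g i mod p ^ e i" by (simp add: mod_eq_dvd_iff)
        then show ?thesis using g i by (auto simp: PiE_def Pi_def)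
      qed
      have "(\<Sum>l<n. U i l * val (vec z) l) mod p ^ e i = (\<Sum>l<n. U i l * z l) mod p ^ e i" if i: "i < n" for i
        unfolding mod_eq_dvd_iff sum_subtractf[symmetric] right_diff_distrib[symmetric]
      proof (intro dvd_sum dvd_mult dvd_trans[OF e2[OF i]])
        fix l assume "l \<in> {..<n}"
        then have "val (vec z) l = z l mod p ^ 2" by (intro vec) simp
        then show "p ^ 2 dvd val (vec z) l - z l" by (simp flip: mod_eq_dvd_iff)
      qed
      then have "\<phi> (vec z) = g" using Uz g by (auto simp: \<phi>_def fun_eq_iff PiE_def extensional_def)
      then show "g \<in> \<phi> ` carrier V" using vec(1) by blast
    qed
  qed
  have fib: "Im +>\<^bsub>V\<^esub> u = {w \<in> carrier V. \<phi> w = \<phi> u}" if u: "u \<in> carrier V" for u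
  proof (rule a_r_coset_fiber)
    show "h \<oplus>\<^bsub>V\<^esub> u \<in> carrier V" if "h \<in> Im" for h
      using that u apply_closed add_closed by (auto simp: Im_def)
    fix w assume w: "w \<in> carrier V"
    show "(\<exists>h\<in>Im. w = h \<oplus>\<^bsub>V\<^esub> u) \<longleftrightarrow> \<phi> w = \<phi> u"
    proof
      assume "\<exists>h\<in>Im. w = h \<oplus>\<^bsub>V\<^esub> u"
      then obtain v where v: "v \<in> carrier V" "w = mat_apply R n A' v \<oplus>\<^bsub>V\<^esub> u" by (auto simp: Im_def)
      have "(\<Sum>l<n. U i l * val w l) mod p ^ e i = (\<Sum>l<n. U i l * val u l) mod p ^ e i" if i: "i < n" for i
      proof -
        have "p ^ e i dvd (\<Sum>l<n. U i l * (val w l - val u l - (\<Sum>j<n. M l j * val v j)))"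
        proof (intro dvd_sum dvd_mult dvd_trans[OF e2[OF i]])
          fix l assume "l \<in> {..<n}"
          then have l: "l < n" by simp
          have "val w l mod p ^ 2 = (val (mat_apply R n A' v) l + val u l) mod p ^ 2"
            unfolding v(2) using val_add[OF apply_closed[OF v(1)] u l] by simp
          also have "\<dots> = ((\<Sum>j<n. M l j * val v j) + val u l) mod p ^ 2"
            using val_apply[OF v(1) l] by (rule mod_add_cong) simp
          finally show "p ^ 2 dvd val w l - val u l - (\<Sum>j<n. M l j * val v j)"
            by (simp add: mod_eq_dvd_iff algebra_simps)
        qed
        moreover have "(\<Sum>l<n. U i l * (\<Sum>j<n. M l j * val v j)) = (\<Sum>j<n. (\<Sum>l<n. U i l * M l j) * val v j)"
          by (simp add: sum_distrib_left sum_distrib_right mult.assoc) (rule sum.swap)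
        moreover have "\<dots> = (\<Sum>j<n. p ^ e i * (N i j * val v j))"
          by (intro sum.cong) (auto simp: row_reducedD(3)[OF red i])
        ultimately have "p ^ e i dvd (\<Sum>l<n. U i l * val w l) - (\<Sum>l<n. U i l * val u l) - p ^ e i * (\<Sum>j<n. N i j * val v j)"
          by (simp add: right_diff_distrib sum_subtractf sum_distrib_left)
        then have "p ^ e i dvd (\<Sum>l<n. U i l * val w l) - (\<Sum>l<n. U i l * val u l)"
          by (metis dvd_diff_commute dvd_triv_left dvd_diffD1 dvd_diff_right_iff)
        then show ?thesis by (simp only: mod_eq_dvd_iff)
      qed
      then show "\<phi> w = \<phi> u" by (auto simp: \<phi>_def)
    next
      assume \<phi>: "\<phi> w = \<phi> u"
      have "p ^ e i dvd (\<Sum>l<n. U i l * (val w l - val u l))" if "i < n" for i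
        using fun_cong[OF \<phi>, of i] that by (simp add: \<phi>_def mod_eq_dvd_iff right_diff_distrib sum_subtractf)
      from solve_mod_prime_power[OF p red this]
      obtain r where r: "\<And>l. l < n \<Longrightarrow> p ^ 2 dvd val w l - val u l - (\<Sum>j<n. M l j * r j)" by blast
      have "w = mat_apply R n A' (vec r) \<oplus>\<^bsub>V\<^esub> u"
      proof (rule eqV[OF w add_closed[OF apply_closed[OF vec(1)] u]])
        fix l assume l: "l < n"
        have "(\<Sum>j<n. M l j * val (vec r) j) mod p ^ 2 = (\<Sum>j<n. M l j * r j) mod p ^ 2"
          unfolding mod_eq_dvd_iff sum_subtractf[symmetric] right_diff_distrib[symmetric]
          by (intro dvd_sum dvd_mult) (simp add: vec(2) flip: mod_eq_dvd_iff)
        then have "val (mat_apply R n A' (vec r)) l mod p ^ 2 = (\<Sum>j<n. M l j * r j) mod p ^ 2"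
          using val_apply[OF vec(1) l] by simp
        then have "(val (mat_apply R n A' (vec r)) l + val u l) mod p ^ 2 = ((\<Sum>j<n. M l j * r j) + val u l) mod p ^ 2"
          by (rule mod_add_cong) simp
        also have "\<dots> = val w l mod p ^ 2"
          using r[OF l] by (simp add: mod_eq_dvd_iff dvd_diff_commute algebra_simps)
        also have "\<dots> = val w l" unfolding val_def
          using residue_mod[OF p1] elem[OF w l] by (simp add: R_def)
        finally show "val w l = val (mat_apply R n A' (vec r) \<oplus>\<^bsub>V\<^esub> u) l"
          using val_add[OF apply_closed[OF vec(1)] u l] by simp
      qed
      then show "\<exists>h\<in>Im. w = h \<oplus>\<^bsub>V\<^esub> u" using vec(1) by (auto simp: Im_def)
    qed
  qed
  have s: "a \<odot>\<^bsub>V\<^esub> u \<in> carrier V" if "u \<in> carrier V" for u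
    using elem[OF that] a(1) unfolding Vs Vc by auto
  have \<phi>s: "\<phi> (a \<odot>\<^bsub>V\<^esub> u) = (\<lambda>i\<in>{..<n}. (p * \<phi> u i) mod p ^ e i)" if u: "u \<in> carrier V" for u
  proof -
    have "(\<Sum>l<n. U i l * val (a \<odot>\<^bsub>V\<^esub> u) l) mod p ^ e i = (p * (\<Sum>l<n. U i l * val u l)) mod p ^ e i" if i: "i < n" for i
    proof -
      have "p ^ e i dvd (\<Sum>l<n. U i l * (val (a \<odot>\<^bsub>V\<^esub> u) l - p * val u l))"
      proof (intro dvd_sum dvd_mult dvd_trans[OF e2[OF i]])
        fix l assume "l \<in> {..<n}"
        then have "val (a \<odot>\<^bsub>V\<^esub> u) l = (p * val u l) mod p ^ 2"
          using a elem[OF u] by (simp add: val_def Vs residue_mult[OF p1, of _ 2, folded R_def])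
        then show "p ^ 2 dvd val (a \<odot>\<^bsub>V\<^esub> u) l - p * val u l" by (simp flip: mod_eq_dvd_iff)
      qed
      then show ?thesis by (simp add: mod_eq_dvd_iff right_diff_distrib sum_subtractf sum_distrib_left mult_ac)
    qed
    then show ?thesis by (auto simp: \<phi>_def mod_mult_right_eq)
  qed
  have T: "(\<Union>x\<in>Im +>\<^bsub>V\<^esub> u. Im +>\<^bsub>V\<^esub> (a \<odot>\<^bsub>V\<^esub> x)) = Im +>\<^bsub>V\<^esub> (a \<odot>\<^bsub>V\<^esub> u)" if u: "u \<in> carrier V" for u
  proof -
    have "Im +>\<^bsub>V\<^esub> (a \<odot>\<^bsub>V\<^esub> x) = Im +>\<^bsub>V\<^esub> (a \<odot>\<^bsub>V\<^esub> u)" if "x \<in> Im +>\<^bsub>V\<^esub> u" for x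
      using that u by (simp add: fib s \<phi>s)
    moreover have "u \<in> Im +>\<^bsub>V\<^esub> u" using u by (simp add: fib)
    ultimately show ?thesis by blast
  qed
  note cards = coset_cards[where T = "\<lambda>X. \<Union>x\<in>X. Im +>\<^bsub>V\<^esub> (a \<odot>\<^bsub>V\<^esub> x)",
      OF p1 finite_lessThan _ fib img s \<phi>s T]
  have c: "carrier (cokernel_mod p 2 n A) = a_rcosets\<^bsub>V\<^esub> Im"
    and sm: "\<And>X. a \<odot>\<^bsub>cokernel_mod p 2 n A\<^esub> X = (\<Union>x\<in>X. Im +>\<^bsub>V\<^esub> (a \<odot>\<^bsub>V\<^esub> x))"
    by (simp_all add: cok quot_module_def)
  have e: "e i \<le> 2" if "i \<in> {..<n}" for i using row_reducedD(2)[OF red] that by simp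
  show "card (carrier (cokernel_mod p 2 n A)) = nat p ^ (\<Sum>i<n. e i)"
    unfolding c by (rule cards(1)[OF e])
  show "card ((\<lambda>x. a \<odot>\<^bsub>cokernel_mod p 2 n A\<^esub> x) ` carrier (cokernel_mod p 2 n A)) = nat p ^ card {i. i < n \<and> e i = 2}"
    unfolding c sm using cards(2)[OF e] by simp
  show "a \<odot>\<^bsub>cokernel_mod p 2 n A\<^esub> X \<in> carrier (cokernel_mod p 2 n A)" if "X \<in> carrier (cokernel_mod p 2 n A)" for X
    using that unfolding c sm using cards(3)[OF e] by simp
qed

section \<open>Modules of a given type modulo the square of p\<close>

lemma p_ideal_coset_eq_iff:
  assumes "p > 1" "x \<in> carrier (padic_int p)" "y \<in> carrier (padic_int p)"
  shows "p_ideal p r +>\<^bsub>padic_int p\<^esub> x = p_ideal p r +>\<^bsub>padic_int p\<^esub> y \<longleftrightarrow>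
    (\<forall>k. enat k \<le> r \<longrightarrow> x k = y k)"
proof
  assume "p_ideal p r +>\<^bsub>padic_int p\<^esub> x = p_ideal p r +>\<^bsub>padic_int p\<^esub> y"
  moreover have "x \<in> p_ideal p r +>\<^bsub>padic_int p\<^esub> x" using assms by (simp add: p_ideal_coset)
  ultimately show "\<forall>k. enat k \<le> r \<longrightarrow> x k = y k" using assms by (simp add: p_ideal_coset)
next
  assume "\<forall>k. enat k \<le> r \<longrightarrow> x k = y k"
  then show "p_ideal p r +>\<^bsub>padic_int p\<^esub> x = p_ideal p r +>\<^bsub>padic_int p\<^esub> y"
    unfolding p_ideal_coset[OF assms(1,2)] p_ideal_coset[OF assms(1,3)] by auto
qed

definition cyclic_module :: "int \<Rightarrow> enat \<Rightarrow> (padic, padic set) module" where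
  "cyclic_module p r = quot_module (regular_module (padic_int p)) (p_ideal p r)"

lemma cyclic_module_carrier:
  "carrier (cyclic_module p r) = (\<lambda>y. p_ideal p r +>\<^bsub>padic_int p\<^esub> y) ` carrier (padic_int p)"
  by (auto simp: cyclic_module_def quot_module_def regular_module_def A_RCOSETS_def' a_r_coset_def')

lemma cyclic_module_add:
  assumes p: "p > 1" and "x \<in> carrier (padic_int p)" "y \<in> carrier (padic_int p)"
  shows "(p_ideal p r +>\<^bsub>padic_int p\<^esub> x) \<oplus>\<^bsub>cyclic_module p r\<^esub> (p_ideal p r +>\<^bsub>padic_int p\<^esub> y) =
    p_ideal p r +>\<^bsub>padic_int p\<^esub> (x \<oplus>\<^bsub>padic_int p\<^esub> y)"
proof -
  interpret I: ideal "p_ideal p r" "padic_int p" by (rule p_ideal_ideal[OF p])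
  have "X \<oplus>\<^bsub>cyclic_module p r\<^esub> Y = X <+>\<^bsub>padic_int p\<^esub> Y" for X Y
    by (simp add: cyclic_module_def quot_module_def regular_module_def set_add_def set_mult_def)
  then show ?thesis using I.a_rcos_sum assms by simp
qed

lemma cyclic_module_smult:
  assumes p: "p > 1" and a: "a \<in> carrier (padic_int p)" and y: "y \<in> carrier (padic_int p)"
  shows "a \<odot>\<^bsub>cyclic_module p r\<^esub> (p_ideal p r +>\<^bsub>padic_int p\<^esub> y) =
    p_ideal p r +>\<^bsub>padic_int p\<^esub> (a \<otimes>\<^bsub>padic_int p\<^esub> y)"
proof -
  interpret cring "padic_int p" by (rule padic_int_cring[OF p])
  have eq: "p_ideal p r +>\<^bsub>padic_int p\<^esub> (a \<otimes>\<^bsub>padic_int p\<^esub> x) = p_ideal p r +>\<^bsub>padic_int p\<^esub> (a \<otimes>\<^bsub>padic_int p\<^esub> y)"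
    if x: "x \<in> p_ideal p r +>\<^bsub>padic_int p\<^esub> y" for x
  proof -
    have "x \<in> carrier (padic_int p)" "\<forall>k. enat k \<le> r \<longrightarrow> x k = y k" using x y p by (simp_all add: p_ideal_coset)
    then show ?thesis using a y by (subst p_ideal_coset_eq_iff[OF p]) (simp_all add: padic_mult)
  qed
  have y': "y \<in> p_ideal p r +>\<^bsub>padic_int p\<^esub> y" using p y by (simp add: p_ideal_coset)
  have "a \<odot>\<^bsub>cyclic_module p r\<^esub> X = (\<Union>x\<in>X. p_ideal p r +>\<^bsub>padic_int p\<^esub> (a \<otimes>\<^bsub>padic_int p\<^esub> x))" for X
    by (simp add: cyclic_module_def quot_module_def regular_module_def a_r_coset_def')
  then have "a \<odot>\<^bsub>cyclic_module p r\<^esub> (p_ideal p r +>\<^bsub>padic_int p\<^esub> y) =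
      (\<Union>x\<in>p_ideal p r +>\<^bsub>padic_int p\<^esub> y. p_ideal p r +>\<^bsub>padic_int p\<^esub> (a \<otimes>\<^bsub>padic_int p\<^esub> y))"
    using eq by (simp cong: SUP_cong)
  also have "\<dots> = p_ideal p r +>\<^bsub>padic_int p\<^esub> (a \<otimes>\<^bsub>padic_int p\<^esub> y)" using y' by blast
  finally show ?thesis .
qed

text \<open>Here \<epsilon> is the minimum of \<open>r\<close> and 2. Modulo p^2 the summand for p^r
  becomes \<int>/p^\<epsilon>, so all r \<ge> 2, including \<infinity>, look alike, and only
  \<open>d 1\<close> and the number of the other summands stay visible.\<close>

lemma index_card:
  fixes d :: "enat \<Rightarrow> nat"
  assumes fin: "finite {r. 1 \<le> r \<and> d r \<noteq> 0}"
  defines "J \<equiv> {(r, j). 1 \<le> r \<and> j < d r}" and "\<epsilon> \<equiv> \<lambda>i :: enat \<times> nat. if fst i = 1 then 1 else 2 :: nat"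
  shows "finite J" "(\<Sum>r | 1 \<le> r \<and> d r \<noteq> 0. d r) = d 1 + card {i \<in> J. \<epsilon> i = 2}"
    "(\<Sum>i\<in>J. \<epsilon> i) = d 1 + 2 * card {i \<in> J. \<epsilon> i = 2}"
proof -
  have J: "J = Sigma {r. 1 \<le> r \<and> d r \<noteq> 0} (\<lambda>r. {..<d r})" by (auto simp: J_def)
  show finJ: "finite J" unfolding J using fin by auto
  have J1: "{i \<in> J. \<epsilon> i = 1} = {1} \<times> {..<d 1}" by (auto simp: J_def \<epsilon>_def split: if_splits)
  have c1: "card {i \<in> J. \<epsilon> i = 1} = d 1" unfolding J1 by (simp add: card_cartesian_product)
  have split: "J = {i \<in> J. \<epsilon> i = 1} \<union> {i \<in> J. \<epsilon> i = 2}" by (auto simp: \<epsilon>_def)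
  have disj: "finite {i \<in> J. \<epsilon> i = 1}" "finite {i \<in> J. \<epsilon> i = 2}" "{i \<in> J. \<epsilon> i = 1} \<inter> {i \<in> J. \<epsilon> i = 2} = {}"
    using finJ by auto
  have "card J = (\<Sum>r | 1 \<le> r \<and> d r \<noteq> 0. d r)" unfolding J using fin by (simp add: card_SigmaI)
  moreover have "card J = card {i \<in> J. \<epsilon> i = 1} + card {i \<in> J. \<epsilon> i = 2}"
    by (subst split) (rule card_Un_disjoint[OF disj])
  ultimately show "(\<Sum>r | 1 \<le> r \<and> d r \<noteq> 0. d r) = d 1 + card {i \<in> J. \<epsilon> i = 2}" using c1 by simp
  have "(\<Sum>i\<in>J. \<epsilon> i) = (\<Sum>i | i \<in> J \<and> \<epsilon> i = 1. \<epsilon> i) + (\<Sum>i | i \<in> J \<and> \<epsilon> i = 2. \<epsilon> i)"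
    by (subst split) (rule sum.union_disjoint[OF disj])
  then show "(\<Sum>i\<in>J. \<epsilon> i) = d 1 + 2 * card {i \<in> J. \<epsilon> i = 2}" using c1 by simp
qed

text \<open>The counterpart of \<open>cokernel_cards\<close> for H/p^2 H: the invariant reads level
  \<epsilon> i of each cyclic coordinate, and \<open>c\<close> counts the summands with r \<ge> 2,
  including \<infinity>.\<close>

lemma module_mod_cards:
  fixes p :: int and H :: "(padic, 'h) module"
  defines "a \<equiv> residue_class p 2 p"
  assumes p: "p > 1" and H: "module (padic_int p) H" and type: "has_type p H d"
  shows "\<exists>c. (\<Sum>r | 1 \<le> r \<and> d r \<noteq> 0. d r) = d 1 + c \<and>
    card (carrier (module_mod p 2 H)) = nat p ^ (d 1 + 2 * c) \<and>
    card ((\<lambda>x. a \<odot>\<^bsub>module_mod p 2 H\<^esub> x) ` carrier (module_mod p 2 H)) = nat p ^ c"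
proof -
  interpret Z: cring "padic_int p" by (rule padic_int_cring[OF p])
  interpret H: module "padic_int p" H by (rule H)
  define J where "J = {(r, j). 1 \<le> r \<and> j < d r}"
  define \<epsilon> where "\<epsilon> = (\<lambda>i :: enat \<times> nat. if fst i = 1 then 1 else 2 :: nat)"
  have fin: "finite {r. 1 \<le> r \<and> d r \<noteq> 0}" using type by (simp add: has_type_def)
  have idx: "finite J" "(\<Sum>r | 1 \<le> r \<and> d r \<noteq> 0. d r) = d 1 + card {i \<in> J. \<epsilon> i = 2}"
    "(\<Sum>i\<in>J. \<epsilon> i) = d 1 + 2 * card {i \<in> J. \<epsilon> i = 2}"
    unfolding J_def \<epsilon>_def by (rule index_card[OF fin])+
  define W where "W = prod_module J (\<lambda>i. cyclic_module p (fst i))"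
  have "(\<lambda>(r, j). quot_module (regular_module (padic_int p)) (p_ideal p r)) = (\<lambda>i :: enat \<times> nat. cyclic_module p (fst i))"
    by (auto simp: cyclic_module_def)
  then have "module_isomorphic (padic_int p) H W" using type by (simp add: has_type_def W_def J_def)
  then obtain f where f: "f \<in> module_hom (padic_int p) H W" and bij: "bij_betw f (carrier H) (carrier W)"
    by (auto simp: module_isomorphic_def)
  define C where "C i y = p_ideal p (fst i) +>\<^bsub>padic_int p\<^esub> y" for i :: "enat \<times> nat" and y
  have Wc: "carrier W = (\<Pi>\<^sub>E i\<in>J. C i ` carrier (padic_int p))"
    by (simp add: W_def prod_module_def cyclic_module_carrier C_def[abs_def])
  have Wa: "(g \<oplus>\<^bsub>W\<^esub> h) i = g i \<oplus>\<^bsub>cyclic_module p (fst i)\<^esub> h i"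
    and Ws: "(b \<odot>\<^bsub>W\<^esub> g) i = b \<odot>\<^bsub>cyclic_module p (fst i)\<^esub> g i" if "i \<in> J" for g h b i
    using that by (simp_all add: W_def prod_module_def)
  have fW: "f u \<in> carrier W" if "u \<in> carrier H" for u using f that by (auto simp: module_hom_def)
  have f_add: "f (u \<oplus>\<^bsub>H\<^esub> v) = f u \<oplus>\<^bsub>W\<^esub> f v" if "u \<in> carrier H" "v \<in> carrier H" for u v
    using f that by (auto simp: module_hom_def)
  have f_smult: "f (b \<odot>\<^bsub>H\<^esub> u) = b \<odot>\<^bsub>W\<^esub> f u" if "b \<in> carrier (padic_int p)" "u \<in> carrier H" for b u
    using f that by (auto simp: module_hom_def)
  have rep: "\<exists>y\<in>carrier (padic_int p). f u i = C i y" if "u \<in> carrier H" "i \<in> J" for u i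
    using PiE_mem[OF fW[OF that(1), unfolded Wc] that(2)] by blast
  have \<epsilon>_le: "enat (\<epsilon> i) \<le> fst i" if "i \<in> J" for i
  proof -
    have "1 \<le> fst i" using that by (auto simp: J_def)
    then show ?thesis
      by (cases "fst i") (auto simp: \<epsilon>_def one_enat_def)
  qed
  have \<epsilon>2: "\<epsilon> i \<le> 2" for i by (simp add: \<epsilon>_def)
  define \<phi> where "\<phi> u = (\<lambda>i\<in>J. residue (\<epsilon> i) (f u i))" for u
  have \<phi>_rep: "\<phi> u i = y (\<epsilon> i)" if "i \<in> J" "y \<in> carrier (padic_int p)" "f u i = C i y" for u i y
    using that residue_coset[OF p _ \<epsilon>_le] by (simp add: \<phi>_def C_def)
  define q where "q = p_power p (enat 2)"
  have q: "q \<in> carrier (padic_int p)" unfolding q_def by (rule p_power_closed[OF p])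
  have q0: "q k = 0" if "k \<le> 2" for k
  proof -
    have "p ^ k dvd p ^ 2" using that by (rule le_imp_power_dvd)
    moreover have "q k = p ^ 2 mod p ^ k" by (simp add: q_def p_power_def padic_of_int_def)
    ultimately show ?thesis by (simp only: mod_eq_0_iff_dvd)
  qed
  define N where "N = (\<lambda>x. q \<odot>\<^bsub>H\<^esub> x) ` carrier H"
  have img: "\<phi> ` carrier H = PiE J (\<lambda>i. {0..<p ^ \<epsilon> i})"
  proof
    show "\<phi> ` carrier H \<subseteq> PiE J (\<lambda>i. {0..<p ^ \<epsilon> i})"
    proof (rule image_subsetI, rule PiE_I)
      fix u i assume u: "u \<in> carrier H" and i: "i \<in> J"
      obtain y where y: "y \<in> carrier (padic_int p)" "f u i = C i y" using rep[OF u i] by blast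
      show "\<phi> u i \<in> {0..<p ^ \<epsilon> i}"
        unfolding \<phi>_rep[OF i y] using padic_level_range(1,2)[OF y(1), of "\<epsilon> i"] by simp
    qed (simp add: \<phi>_def)
    show "PiE J (\<lambda>i. {0..<p ^ \<epsilon> i}) \<subseteq> \<phi> ` carrier H"
    proof
      fix g assume g: "g \<in> PiE J (\<lambda>i. {0..<p ^ \<epsilon> i})"
      define G where "G = (\<lambda>i\<in>J. C i (padic_of_int p (g i)))"
      have "G \<in> carrier W" unfolding Wc G_def restrict_PiE_iff by (intro ballI imageI padic_of_int_closed[OF p])
      then have "G \<in> f ` carrier H" by (simp only: bij_betw_imp_surj_on[OF bij])
      then obtain u where u: "u \<in> carrier H" "f u = G" by blast
      have "\<phi> u = g"
      proof (rule PiE_ext)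
        show "\<phi> u \<in> PiE J (\<lambda>_. UNIV)" by (simp add: \<phi>_def)
        show "g \<in> PiE J (\<lambda>_. UNIV)" using g by (simp add: PiE_def)
        fix i assume i: "i \<in> J"
        then have "\<phi> u i = padic_of_int p (g i) (\<epsilon> i)"
          using padic_of_int_closed[OF p] u(2) by (intro \<phi>_rep) (simp_all add: G_def)
        then show "\<phi> u i = g i" using PiE_mem[OF g i] by (simp add: padic_of_int_def)
      qed
      then show "g \<in> \<phi> ` carrier H" using u(1) by blast
    qed
  qed
  have \<phi>_smult: "\<phi> (b \<odot>\<^bsub>H\<^esub> u) = (\<lambda>i\<in>J. (b (\<epsilon> i) * \<phi> u i) mod p ^ \<epsilon> i)"
    if b: "b \<in> carrier (padic_int p)" and u: "u \<in> carrier H" for b u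
  proof (rule PiE_ext)
    show "\<phi> (b \<odot>\<^bsub>H\<^esub> u) \<in> PiE J (\<lambda>_. UNIV)" by (simp add: \<phi>_def)
    show "(\<lambda>i\<in>J. (b (\<epsilon> i) * \<phi> u i) mod p ^ \<epsilon> i) \<in> PiE J (\<lambda>_. UNIV)" by simp
    fix i assume i: "i \<in> J"
    obtain y where y: "y \<in> carrier (padic_int p)" "f u i = C i y" using rep[OF u i] by blast
    have "f (b \<odot>\<^bsub>H\<^esub> u) i = C i (b \<otimes>\<^bsub>padic_int p\<^esub> y)"
      using y b by (simp add: f_smult[OF b u] Ws[OF i] C_def cyclic_module_smult[OF p])
    then have "\<phi> (b \<odot>\<^bsub>H\<^esub> u) i = (b \<otimes>\<^bsub>padic_int p\<^esub> y) (\<epsilon> i)" using i b y by (intro \<phi>_rep) simp_all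
    then show "\<phi> (b \<odot>\<^bsub>H\<^esub> u) i = (\<lambda>i\<in>J. (b (\<epsilon> i) * \<phi> u i) mod p ^ \<epsilon> i) i"
      using i \<phi>_rep[OF i y] by (simp add: padic_mult)
  qed
  have fib: "N +>\<^bsub>H\<^esub> u = {w \<in> carrier H. \<phi> w = \<phi> u}" if u: "u \<in> carrier H" for u
  proof (rule a_r_coset_fiber)
    show "h \<oplus>\<^bsub>H\<^esub> u \<in> carrier H" if "h \<in> N" for h using that u q by (auto simp: N_def)
    fix w assume w: "w \<in> carrier H"
    show "(\<exists>h\<in>N. w = h \<oplus>\<^bsub>H\<^esub> u) \<longleftrightarrow> \<phi> w = \<phi> u"
    proof
      assume "\<exists>h\<in>N. w = h \<oplus>\<^bsub>H\<^esub> u"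
      then obtain v where v: "v \<in> carrier H" "w = (q \<odot>\<^bsub>H\<^esub> v) \<oplus>\<^bsub>H\<^esub> u" by (auto simp: N_def)
      show "\<phi> w = \<phi> u"
      proof (rule PiE_ext)
        show "\<phi> w \<in> PiE J (\<lambda>_. UNIV)" "\<phi> u \<in> PiE J (\<lambda>_. UNIV)" by (simp_all add: \<phi>_def)
        fix i assume i: "i \<in> J"
        obtain y where y: "y \<in> carrier (padic_int p)" "f u i = C i y" using rep[OF u i] by blast
        obtain t where t: "t \<in> carrier (padic_int p)" "f v i = C i t" using rep[OF v(1) i] by blast
        have "f w i = C i ((q \<otimes>\<^bsub>padic_int p\<^esub> t) \<oplus>\<^bsub>padic_int p\<^esub> y)"
          using y t q v(1) u unfolding v(2)
          by (simp add: f_add f_smult Wa[OF i] Ws[OF i] C_def cyclic_module_smult[OF p] cyclic_module_add[OF p])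
        then have "\<phi> w i = ((q \<otimes>\<^bsub>padic_int p\<^esub> t) \<oplus>\<^bsub>padic_int p\<^esub> y) (\<epsilon> i)" using i t y q by (intro \<phi>_rep) simp_all
        also have "\<dots> = y (\<epsilon> i)" using q0[OF \<epsilon>2] padic_level_range(3)[OF y(1)] by (simp add: padic_add padic_mult)
        finally show "\<phi> w i = \<phi> u i" using \<phi>_rep[OF i y] by simp
      qed
    next
      assume \<phi>: "\<phi> w = \<phi> u"
      have "\<exists>t\<in>carrier (padic_int p). f w i = (q \<odot>\<^bsub>cyclic_module p (fst i)\<^esub> C i t) \<oplus>\<^bsub>cyclic_module p (fst i)\<^esub> f u i"
        if i: "i \<in> J" for i
      proof -
        obtain y where y: "y \<in> carrier (padic_int p)" "f u i = C i y" using rep[OF u i] by blast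
        obtain z where z: "z \<in> carrier (padic_int p)" "f w i = C i z" using rep[OF w i] by blast
        have zy: "z (\<epsilon> i) = y (\<epsilon> i)" using \<phi> \<phi>_rep[OF i y] \<phi>_rep[OF i z] by simp
        have "\<exists>t\<in>carrier (padic_int p). C i z = C i ((q \<otimes>\<^bsub>padic_int p\<^esub> t) \<oplus>\<^bsub>padic_int p\<^esub> y)"
        \<comment> \<open>In a summand with exponent 1, equal residues already give equal cosets, so
          t = 0 works. In the others, agreement at level 2 makes the difference divisible by
          \<open>q\<close>, that is, by p^2.\<close>
        proof (cases "fst i = 1")
          case True
          have "C i z = C i ((q \<otimes>\<^bsub>padic_int p\<^esub> \<zero>\<^bsub>padic_int p\<^esub>) \<oplus>\<^bsub>padic_int p\<^esub> y)"
            unfolding C_def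
          proof (subst p_ideal_coset_eq_iff[OF p])
            show "\<forall>k. enat k \<le> fst i \<longrightarrow> z k = ((q \<otimes>\<^bsub>padic_int p\<^esub> \<zero>\<^bsub>padic_int p\<^esub>) \<oplus>\<^bsub>padic_int p\<^esub> y) k"
            proof (intro allI impI)
              fix k assume "enat k \<le> fst i"
              then have "k \<le> 1" using True by (simp add: one_enat_def)
              have "z 1 = y 1" using zy True by (simp add: \<epsilon>_def)
              then have "z k = y k" using \<open>k \<le> 1\<close> padic_level_mod z(1) y(1) by metis
              then show "z k = ((q \<otimes>\<^bsub>padic_int p\<^esub> \<zero>\<^bsub>padic_int p\<^esub>) \<oplus>\<^bsub>padic_int p\<^esub> y) k" using q y by simp
            qed
          qed (use q y z in simp_all)
          then show ?thesis by blast
        next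
          case False
          have "(z \<ominus>\<^bsub>padic_int p\<^esub> y) 2 = 0" using zy False z y by (simp add: padic_minus[OF p] \<epsilon>_def)
          then obtain t where t: "t \<in> carrier (padic_int p)" "z \<ominus>\<^bsub>padic_int p\<^esub> y = q \<otimes>\<^bsub>padic_int p\<^esub> t"
            using padic_divide[OF p Z.minus_closed[OF z(1) y(1)], of 2] by (auto simp: q_def p_power_def)
          have "z = (q \<otimes>\<^bsub>padic_int p\<^esub> t) \<oplus>\<^bsub>padic_int p\<^esub> y"
            unfolding t(2)[symmetric] using z y by (simp add: Z.minus_eq Z.a_assoc Z.l_neg)
          then show ?thesis using t(1) by blast
        qed
        then obtain t where t: "t \<in> carrier (padic_int p)" "C i z = C i ((q \<otimes>\<^bsub>padic_int p\<^esub> t) \<oplus>\<^bsub>padic_int p\<^esub> y)" by blast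
        have "f w i = (q \<odot>\<^bsub>cyclic_module p (fst i)\<^esub> C i t) \<oplus>\<^bsub>cyclic_module p (fst i)\<^esub> f u i"
          using t y q unfolding z(2) y(2) by (simp add: C_def cyclic_module_smult[OF p] cyclic_module_add[OF p])
        then show ?thesis using t(1) by blast
      qed
      then obtain t where t: "\<And>i. i \<in> J \<Longrightarrow> t i \<in> carrier (padic_int p)"
        "\<And>i. i \<in> J \<Longrightarrow> f w i = (q \<odot>\<^bsub>cyclic_module p (fst i)\<^esub> C i (t i)) \<oplus>\<^bsub>cyclic_module p (fst i)\<^esub> f u i"
        by metis
      define G where "G = (\<lambda>i\<in>J. C i (t i))"
      have "G \<in> carrier W" unfolding Wc G_def restrict_PiE_iff by (intro ballI imageI t(1))
      then have "G \<in> f ` carrier H" by (simp only: bij_betw_imp_surj_on[OF bij])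
      then obtain v where v: "v \<in> carrier H" "f v = G" by blast
      have qv: "(q \<odot>\<^bsub>H\<^esub> v) \<oplus>\<^bsub>H\<^esub> u \<in> carrier H" using q v u by simp
      have "f w = f ((q \<odot>\<^bsub>H\<^esub> v) \<oplus>\<^bsub>H\<^esub> u)"
      proof (rule PiE_ext)
        show "f w \<in> (\<Pi>\<^sub>E i\<in>J. C i ` carrier (padic_int p))" using fW[OF w] by (simp add: Wc)
        show "f ((q \<odot>\<^bsub>H\<^esub> v) \<oplus>\<^bsub>H\<^esub> u) \<in> (\<Pi>\<^sub>E i\<in>J. C i ` carrier (padic_int p))" using fW[OF qv] by (simp add: Wc)
        fix i assume i: "i \<in> J"
        then show "f w i = f ((q \<odot>\<^bsub>H\<^esub> v) \<oplus>\<^bsub>H\<^esub> u) i"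
          using t(2)[OF i] q v u by (simp add: f_add f_smult Wa Ws G_def)
      qed
      then have "w = (q \<odot>\<^bsub>H\<^esub> v) \<oplus>\<^bsub>H\<^esub> u"
        by (rule inj_onD[OF bij_betw_imp_inj_on[OF bij] _ w qv])
      then show "\<exists>h\<in>N. w = h \<oplus>\<^bsub>H\<^esub> u" using v(1) by (auto simp: N_def)
    qed
  qed
  define P where "P = padic_of_int p p"
  have P: "P \<in> carrier (padic_int p)" unfolding P_def by (rule padic_of_int_closed[OF p])
  \<comment> \<open>Every representative \<open>b\<close> of the class of \<open>p\<close> acts like
    \<open>p\<close> at the levels \<epsilon> i \<le> 2, so the action on cosets does not depend on
    the choice of \<open>b\<close>.\<close>
  have a: "b \<in> carrier (padic_int p)" "b (\<epsilon> i) = p mod p ^ \<epsilon> i" if "b \<in> a" for b i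
    using that P \<epsilon>2[of i] unfolding a_def residue_class_def padic_reduce_def P_def
    by (auto simp: p_ideal_coset[OF p] padic_of_int_def)
  have Pa: "P \<in> a" using P unfolding a_def residue_class_def padic_reduce_def by (simp add: p_ideal_coset[OF p] P_def)
  have \<phi>a: "\<phi> (b \<odot>\<^bsub>H\<^esub> u) = (\<lambda>i\<in>J. (p * \<phi> u i) mod p ^ \<epsilon> i)" if "b \<in> a" "u \<in> carrier H" for b u
    using \<phi>_smult[OF a(1)[OF that(1)] that(2)] a(2)[OF that(1)] by (simp add: mod_mult_left_eq)
  have T: "(\<Union>b\<in>a. \<Union>x\<in>N +>\<^bsub>H\<^esub> u. N +>\<^bsub>H\<^esub> (b \<odot>\<^bsub>H\<^esub> x)) = N +>\<^bsub>H\<^esub> (P \<odot>\<^bsub>H\<^esub> u)" if u: "u \<in> carrier H" for u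
  proof -
    have "N +>\<^bsub>H\<^esub> (b \<odot>\<^bsub>H\<^esub> x) = N +>\<^bsub>H\<^esub> (P \<odot>\<^bsub>H\<^esub> u)" if b: "b \<in> a" and x: "x \<in> N +>\<^bsub>H\<^esub> u" for b x
    proof -
      have x': "x \<in> carrier H" "\<phi> x = \<phi> u" using x unfolding fib[OF u] by auto
      then have "\<phi> (b \<odot>\<^bsub>H\<^esub> x) = \<phi> (P \<odot>\<^bsub>H\<^esub> u)" using \<phi>a b Pa u by simp
      then show ?thesis using fib a(1)[OF b] P x' u by simp
    qed
    moreover have "u \<in> N +>\<^bsub>H\<^esub> u" using u by (simp add: fib)
    ultimately show ?thesis using Pa by blast
  qed
  note cards = coset_cards[where T = "\<lambda>X. \<Union>b\<in>a. \<Union>x\<in>X. N +>\<^bsub>H\<^esub> (b \<odot>\<^bsub>H\<^esub> x)" and s = "\<lambda>u. P \<odot>\<^bsub>H\<^esub> u",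
      OF p idx(1) \<epsilon>2 fib img H.smult_closed[OF P] \<phi>a[OF Pa] T]
  have c: "carrier (module_mod p 2 H) = a_rcosets\<^bsub>H\<^esub> N"
    and sm: "\<And>X. a \<odot>\<^bsub>module_mod p 2 H\<^esub> X = (\<Union>b\<in>a. \<Union>x\<in>X. N +>\<^bsub>H\<^esub> (b \<odot>\<^bsub>H\<^esub> x))"
    by (simp_all add: module_mod_def Let_def N_def q_def)
  show ?thesis unfolding c sm using cards(1,2) unfolding idx(3) using idx(2) by blast
qed

section \<open>Evaluation of a first integral\<close>

lemma padic_finsum:
  assumes p: "p > 1" and A: "finite A" and f: "\<And>i. i \<in> A \<Longrightarrow> f i \<in> carrier (padic_int p)"
  shows "(\<Oplus>\<^bsub>padic_int p\<^esub>i\<in>A. f i) k = (\<Sum>i\<in>A. f i k) mod p ^ k"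
proof -
  interpret Z: cring "padic_int p" by (rule padic_int_cring[OF p])
  show ?thesis using A f
  proof (induction A)
    case empty
    then show ?case by (simp add: padic_zero)
  next
    case (insert a A)
    then have "(\<Oplus>\<^bsub>padic_int p\<^esub>i\<in>insert a A. f i) k = (f a k + (\<Sum>i\<in>A. f i k) mod p ^ k) mod p ^ k"
      by (subst Z.finsum_insert) (auto simp: padic_add)
    then show ?case using insert.hyps by (simp add: mod_add_right_eq)
  qed
qed

lemma mat_ring_carrierD:
  "A \<in> carrier (mat_ring R n) \<Longrightarrow> i < n \<Longrightarrow> j < n \<Longrightarrow> A (i, j) \<in> carrier R"
  by (auto simp: mat_ring_def)

lemma mat_ring_zero_entry: "i < n \<Longrightarrow> j < n \<Longrightarrow> \<zero>\<^bsub>mat_ring R n\<^esub> (i, j) = \<zero>\<^bsub>R\<^esub>"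
  and mat_ring_add_entry: "i < n \<Longrightarrow> j < n \<Longrightarrow> (A \<oplus>\<^bsub>mat_ring R n\<^esub> B) (i, j) = A (i, j) \<oplus>\<^bsub>R\<^esub> B (i, j)"
  by (simp_all add: mat_ring_def)

text \<open>Finite sums of matrices need only the additive structure; products are computed entry by
  entry in \<open>mat_ring_mult\<close>.\<close>

lemma mat_ring_abelian_monoid:
  assumes "cring R"
  shows "abelian_monoid (mat_ring R n)"
proof -
  interpret cring R by fact
  show ?thesis
    by (rule abelian_monoidI)
      (auto simp: mat_ring_def fun_eq_iff PiE_def Pi_def extensional_def a_ac)
qed

lemma mat_ring_finsum:
  assumes p: "p > 1" and K: "finite K" and F: "\<And>k. k \<in> K \<Longrightarrow> F k \<in> carrier (mat_ring (padic_int p) n)"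
    and ij: "i < n" "j < n"
  shows "(\<Oplus>\<^bsub>mat_ring (padic_int p) n\<^esub>k\<in>K. F k) (i, j) l = (\<Sum>k\<in>K. F k (i, j) l) mod p ^ l"
proof -
  interpret S: abelian_monoid "mat_ring (padic_int p) n"
    by (rule mat_ring_abelian_monoid[OF padic_int_cring[OF p]])
  show ?thesis using K F
  proof (induction K)
    case empty
    then show ?case using ij by (simp add: mat_ring_zero_entry padic_zero)
  next
    case (insert a K)
    then have "(\<Oplus>\<^bsub>mat_ring (padic_int p) n\<^esub>k\<in>insert a K. F k) =
        F a \<oplus>\<^bsub>mat_ring (padic_int p) n\<^esub> (\<Oplus>\<^bsub>mat_ring (padic_int p) n\<^esub>k\<in>K. F k)"
      by (intro S.finsum_insert) auto
    then have "(\<Oplus>\<^bsub>mat_ring (padic_int p) n\<^esub>k\<in>insert a K. F k) (i, j) l =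
        (F a (i, j) l + (\<Oplus>\<^bsub>mat_ring (padic_int p) n\<^esub>k\<in>K. F k) (i, j) l) mod p ^ l"
      using ij by (simp add: mat_ring_add_entry padic_add)
    also have "\<dots> = (F a (i, j) l + (\<Sum>k\<in>K. F k (i, j) l) mod p ^ l) mod p ^ l"
      using insert by simp
    finally show ?case using insert.hyps by (simp add: mod_add_right_eq)
  qed
qed

lemma mat_ring_mult:
  assumes p: "p > 1" and A: "A \<in> carrier (mat_ring (padic_int p) n)" and B: "B \<in> carrier (mat_ring (padic_int p) n)"
  shows "A \<otimes>\<^bsub>mat_ring (padic_int p) n\<^esub> B \<in> carrier (mat_ring (padic_int p) n)"
    and "i < n \<Longrightarrow> j < n \<Longrightarrow> (A \<otimes>\<^bsub>mat_ring (padic_int p) n\<^esub> B) (i, j) k = (\<Sum>l<n. A (i, l) k * B (l, j) k) mod p ^ k"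
proof -
  interpret Z: cring "padic_int p" by (rule padic_int_cring[OF p])
  have e: "(A \<otimes>\<^bsub>mat_ring (padic_int p) n\<^esub> B) =
      (\<lambda>(i, j)\<in>{..<n} \<times> {..<n}. \<Oplus>\<^bsub>padic_int p\<^esub>l\<in>{..<n}. A (i, l) \<otimes>\<^bsub>padic_int p\<^esub> B (l, j))"
    by (simp add: mat_ring_def)
  have c: "A (i, l) \<otimes>\<^bsub>padic_int p\<^esub> B (l, j) \<in> carrier (padic_int p)" if "i < n" "l < n" "j < n" for i l j
    using mat_ring_carrierD[OF A] mat_ring_carrierD[OF B] that by simp
  show "A \<otimes>\<^bsub>mat_ring (padic_int p) n\<^esub> B \<in> carrier (mat_ring (padic_int p) n)"
  proof -
    have "(\<Oplus>\<^bsub>padic_int p\<^esub>l\<in>{..<n}. A (i, l) \<otimes>\<^bsub>padic_int p\<^esub> B (l, j)) \<in> carrier (padic_int p)" if "i < n" "j < n" for i j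
      using c that by (intro Z.finsum_closed) auto
    then show ?thesis unfolding e by (auto simp: mat_ring_def)
  qed
  assume ij: "i < n" "j < n"
  have "(A \<otimes>\<^bsub>mat_ring (padic_int p) n\<^esub> B) (i, j) k = (\<Sum>l<n. (A (i, l) k * B (l, j) k) mod p ^ k) mod p ^ k"
  proof -
    have "(A \<otimes>\<^bsub>mat_ring (padic_int p) n\<^esub> B) (i, j) k = (\<Oplus>\<^bsub>padic_int p\<^esub>l\<in>{..<n}. A (i, l) \<otimes>\<^bsub>padic_int p\<^esub> B (l, j)) k"
      unfolding e using ij by simp
    also have "\<dots> = (\<Sum>l<n. (A (i, l) \<otimes>\<^bsub>padic_int p\<^esub> B (l, j)) k) mod p ^ k"
      by (rule padic_finsum[OF p]) (use ij c in auto)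
    finally show ?thesis by (simp only: padic_mult)
  qed
  then show "(A \<otimes>\<^bsub>mat_ring (padic_int p) n\<^esub> B) (i, j) k = (\<Sum>l<n. A (i, l) k * B (l, j) k) mod p ^ k"
    by (simp add: mod_sum_eq)
qed

lemma mat_ring_scalar_power:
  fixes p :: int and x :: padic and n :: nat
  defines "S \<equiv> mat_ring (padic_int p) n"
  defines "s \<equiv> mat_smult (padic_int p) n x \<one>\<^bsub>S\<^esub>"
  assumes p: "p > 1" and x: "x \<in> carrier (padic_int p)"
  shows "s [^]\<^bsub>S\<^esub> (k :: nat) \<in> carrier S \<and>
    (\<forall>i<n. \<forall>j<n. (s [^]\<^bsub>S\<^esub> k) (i, j) l = (if i = j then x l ^ k mod p ^ l else 0))"
proof -
  interpret Z: cring "padic_int p" by (rule padic_int_cring[OF p])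
  have one: "\<one>\<^bsub>S\<^esub> = (\<lambda>(i, j)\<in>{..<n} \<times> {..<n}. if i = j then \<one>\<^bsub>padic_int p\<^esub> else \<zero>\<^bsub>padic_int p\<^esub>)"
    by (simp add: S_def mat_ring_def)
  have oneS: "\<one>\<^bsub>S\<^esub> \<in> carrier S" unfolding one by (auto simp: S_def mat_ring_def)
  have s: "s \<in> carrier S" unfolding s_def mat_smult_def one using x by (auto simp: S_def mat_ring_def)
  have s_entry: "s (i, j) l = (if i = j then x l else 0)" if "i < n" "j < n" for i j
    using that x padic_level_range(3)[OF x] by (simp add: s_def mat_smult_def one padic_zero)
  show ?thesis
  proof (induction k)
    case 0
    have "s [^]\<^bsub>S\<^esub> (0 :: nat) = \<one>\<^bsub>S\<^esub>" by (simp add: nat_pow_def)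
    moreover have "\<one>\<^bsub>S\<^esub> (i, j) l = (if i = j then x l ^ 0 mod p ^ l else 0)" if "i < n" "j < n" for i j
      using that by (simp add: one padic_one padic_zero)
    ultimately show ?case using oneS by (simp only:) blast
  next
    case (Suc k)
    have pow: "s [^]\<^bsub>S\<^esub> (Suc k) = s [^]\<^bsub>S\<^esub> k \<otimes>\<^bsub>S\<^esub> s" by (simp add: nat_pow_def)
    have "(s [^]\<^bsub>S\<^esub> Suc k) (i, j) l = (if i = j then x l ^ Suc k mod p ^ l else 0)" if ij: "i < n" "j < n" for i j
    proof -
      have "(s [^]\<^bsub>S\<^esub> Suc k) (i, j) l = (\<Sum>a<n. (s [^]\<^bsub>S\<^esub> k) (i, a) l * s (a, j) l) mod p ^ l"
        unfolding pow unfolding S_def by (rule mat_ring_mult(2)[OF p _ _ ij]) (use Suc.IH s in \<open>simp_all add: S_def\<close>)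
      also have "(\<Sum>a<n. (s [^]\<^bsub>S\<^esub> k) (i, a) l * s (a, j) l) =
          (\<Sum>a<n. if a = j then (if i = j then (x l ^ k mod p ^ l) * x l else 0) else 0)"
        by (rule sum.cong) (use Suc.IH s_entry ij in auto)
      also have "\<dots> mod p ^ l = (if i = j then x l ^ Suc k mod p ^ l else 0)"
        using ij by (simp add: mod_mult_right_eq mult.commute)
      finally show ?thesis .
    qed
    moreover have "s [^]\<^bsub>S\<^esub> Suc k \<in> carrier S"
      unfolding pow using mat_ring_mult(1)[OF p] Suc.IH s by (simp add: S_def)
    ultimately show ?case by blast
  qed
qed

text \<open>At level 2 the factors p^(k-1) kill all coefficients with k \<ge> 3 and make the
  coefficient of degree 2 a multiple of \<open>p\<close>. The integer matrices are read off from the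
  coefficients of \<open>P\<close>, hence are the same for all \<open>x\<close>.\<close>

lemma first_integral_eval:
  fixes p :: int
  assumes p: "p > 1" and P: "first_integral p n P"
  shows "\<exists>B0 B1 B2. \<forall>x\<in>carrier (padic_int p).
    mat_poly_eval (padic_int p) n P x \<in> carrier (mat_ring (padic_int p) n) \<and>
    (\<forall>i<n. \<forall>j<n. mat_poly_eval (padic_int p) n P x (i, j) 2 =
      poly [:B0 i j, B1 i j, p * B2 i j:] (x 2) mod p ^ 2)"
proof -
  define S where "S = mat_ring (padic_int p) n"
  interpret Z: cring "padic_int p" by (rule padic_int_cring[OF p])
  interpret S: abelian_monoid S unfolding S_def by (rule mat_ring_abelian_monoid[OF Z.is_cring])
  have PS: "P \<in> carrier (UP S)" using P by (simp add: first_integral_def S_def)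
  then have up: "P \<in> up S" by (simp add: UP_def)
  have Pc: "P k \<in> carrier S" for k using up by (auto simp: up_def)
  have co: "UnivPoly.coeff (UP S) P k = P k" for k using up by (simp add: UP_def)
  obtain b where "bound \<zero>\<^bsub>S\<^esub> b (UnivPoly.coeff (UP S) P)" using up by (auto simp: up_def co[abs_def])
  then have "bound \<zero>\<^bsub>S\<^esub> (deg S P) (UnivPoly.coeff (UP S) P)" unfolding deg_def by (rule LeastI)
  then have above: "P k = \<zero>\<^bsub>S\<^esub>" if "k > deg S P" for k
    using that unfolding co[abs_def] bound_def by blast
  have zero: "\<zero>\<^bsub>S\<^esub> (i, j) = \<zero>\<^bsub>padic_int p\<^esub>" if "i < n" "j < n" for i j using that by (simp add: S_def mat_ring_def)
  have "\<exists>r A. (\<forall>k. A k \<in> carrier S) \<and> P = (\<lambda>k. if k = 0 then A 0 else if k \<le> r + 1 then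
      mat_smult (padic_int p) n (p_power p (enat (k - 1))) (A k) else \<zero>\<^bsub>S\<^esub>)"
    using P unfolding first_integral_def S_def by (rule conjunct2)
  then obtain r A where
    PA: "P = (\<lambda>k. if k = 0 then A 0 else if k \<le> r + 1 then
      mat_smult (padic_int p) n (p_power p (enat (k - 1))) (A k) else \<zero>\<^bsub>S\<^esub>)"
    by (elim exE conjE)
  have entry: "P k (i, j) 2 = (if k \<le> r + 1 then (p ^ (k - 1) * A k (i, j) 2) mod p ^ 2 else 0)"
    if "k > 0" "i < n" "j < n" for k i j
    using that zero[OF that(2,3)] unfolding PA
    by (simp add: mat_smult_def padic_mult padic_zero p_power_def padic_of_int_def mod_mult_left_eq)
  have P3: "P k (i, j) 2 = 0" if "k \<ge> 3" "i < n" "j < n" for k i j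
  proof -
    have "p ^ 2 dvd p ^ (k - 1)" using that by (intro le_imp_power_dvd) simp
    then have "(p ^ (k - 1) * A k (i, j) 2) mod p ^ 2 = 0" by simp
    then show ?thesis using entry[of k i j] that by simp
  qed
  have P2: "p dvd P 2 (i, j) 2" if "i < n" "j < n" for i j
    using entry[of 2 i j] that by (simp add: power2_eq_square dvd_mod)
  have main: "mat_poly_eval (padic_int p) n P x \<in> carrier S \<and>
    (\<forall>i<n. \<forall>j<n. mat_poly_eval (padic_int p) n P x (i, j) 2 =
      poly [:P 0 (i, j) 2, P 1 (i, j) 2, p * (P 2 (i, j) 2 div p):] (x 2) mod p ^ 2)"
    if x: "x \<in> carrier (padic_int p)" for x
  proof -
    define s where "s = mat_smult (padic_int p) n x \<one>\<^bsub>S\<^esub>"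
    have s: "s [^]\<^bsub>S\<^esub> k \<in> carrier S"
      "\<And>i j. i < n \<Longrightarrow> j < n \<Longrightarrow> (s [^]\<^bsub>S\<^esub> k) (i, j) 2 = (if i = j then x 2 ^ k mod p ^ 2 else 0)" for k :: nat
      using mat_ring_scalar_power[OF p x, of n k 2] unfolding s_def S_def by blast+
    have ev: "mat_poly_eval (padic_int p) n P x = (\<Oplus>\<^bsub>S\<^esub>k\<in>{..deg S P}. P k \<otimes>\<^bsub>S\<^esub> s [^]\<^bsub>S\<^esub> k)"
      using PS by (simp add: mat_poly_eval_def UnivPoly.eval_def co flip: S_def s_def)
    have c: "P k \<otimes>\<^bsub>S\<^esub> s [^]\<^bsub>S\<^esub> k \<in> carrier S" for k
      using mat_ring_mult(1)[OF p] Pc s(1) by (simp add: S_def)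
    have summand: "(P k \<otimes>\<^bsub>S\<^esub> s [^]\<^bsub>S\<^esub> k) (i, j) 2 = (P k (i, j) 2 * x 2 ^ k) mod p ^ 2" if ij: "i < n" "j < n" for i j k
    proof -
      have "(P k \<otimes>\<^bsub>S\<^esub> s [^]\<^bsub>S\<^esub> k) (i, j) 2 = (\<Sum>l<n. P k (i, l) 2 * (s [^]\<^bsub>S\<^esub> k) (l, j) 2) mod p ^ 2"
        unfolding S_def by (rule mat_ring_mult(2)[OF p _ _ ij]) (use Pc s(1) in \<open>simp_all add: S_def\<close>)
      also have "(\<Sum>l<n. P k (i, l) 2 * (s [^]\<^bsub>S\<^esub> k) (l, j) 2) = (\<Sum>l<n. if l = j then P k (i, j) 2 * (x 2 ^ k mod p ^ 2) else 0)"
        by (rule sum.cong) (use ij s(2) in auto)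
      finally show ?thesis using ij by (simp add: mod_mult_right_eq)
    qed
    have "mat_poly_eval (padic_int p) n P x (i, j) 2 =
        poly [:P 0 (i, j) 2, P 1 (i, j) 2, p * (P 2 (i, j) 2 div p):] (x 2) mod p ^ 2" if ij: "i < n" "j < n" for i j
    proof -
      let ?g = "\<lambda>k. P k (i, j) 2 * x 2 ^ k"
      have "mat_poly_eval (padic_int p) n P x (i, j) 2 = (\<Sum>k\<le>deg S P. ?g k mod p ^ 2) mod p ^ 2"
        unfolding ev summand[OF ij, symmetric] unfolding S_def
        by (rule mat_ring_finsum[OF p _ _ ij]) (use c in \<open>simp_all add: S_def\<close>)
      also have "\<dots> = (\<Sum>k\<le>deg S P. ?g k) mod p ^ 2" by (rule mod_sum_eq)
      \<comment> \<open>Extending the range by 2 ensures that it contains the degrees 0, 1 and 2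
        even if \<open>P\<close> has smaller degree; the added terms are 0.\<close>
      also have "(\<Sum>k\<le>deg S P. ?g k) = (\<Sum>k\<le>deg S P + 2. ?g k)"
        by (rule sum.mono_neutral_left) (use above zero[OF ij] in \<open>auto simp: padic_zero\<close>)
      also have "\<dots> = (\<Sum>k<3. ?g k)"
        by (rule sum.mono_neutral_right) (use P3[OF _ ij] in auto)
      also have "\<dots> = poly [:P 0 (i, j) 2, P 1 (i, j) 2, p * (P 2 (i, j) 2 div p):] (x 2)"
        using P2[OF ij] by (simp add: eval_nat_numeral algebra_simps)
      finally show ?thesis .
    qed
    moreover have "mat_poly_eval (padic_int p) n P x \<in> carrier S" unfolding ev using c by (intro S.finsum_closed) auto
    ultimately show ?thesis by (intro conjI allI impI)
  qed
  show ?thesis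
    by (rule exI[of _ "\<lambda>i j. P 0 (i, j) 2"], rule exI[of _ "\<lambda>i j. P 1 (i, j) 2"],
        rule exI[of _ "\<lambda>i j. P 2 (i, j) 2 div p"], rule ballI, rule main[unfolded S_def])
qed

section \<open>Comparison of types\<close>

text \<open>A cokernel and a module \<open>H\<close> that agree modulo \<open>p\<^sup>2\<close> have the same number of elements and of
  multiples of \<open>p\<close>; these two numbers determine \<open>d\<^sub>0\<close> and \<open>d\<^sub>1\<close>.\<close>

lemma row_reduced_type:
  fixes p :: int and A :: "padic matrix" and H :: "(padic, 'h) module"
  assumes p: "prime p" and A: "A \<in> carrier (mat_ring (padic_int p) n)"
    and M: "\<And>i j. i < n \<Longrightarrow> j < n \<Longrightarrow> A (i, j) 2 = M i j mod p ^ 2"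
    and red: "row_reduced p 2 n n M U e N"
    and H: "module (padic_int p) H" "has_type p H d"
    and iso: "module_isomorphic (padic_mod p 2) (cokernel_mod p 2 n A) (module_mod p 2 H)"
  shows "int (card {i. i < n \<and> e i = 0}) = type_defect n d" "card {i. i < n \<and> e i = 1} = d 1"
proof -
  have p1: "p > 1" using p by (rule prime_gt_1_int)
  define a where "a = residue_class p 2 p"
  have a: "a \<in> carrier (padic_mod p 2)"
    using residue_class(1)[OF p1, of 2 p] by (simp add: a_def numeral_eq_enat)
  let ?C = "cokernel_mod p 2 n A"
  have A': "A (i, j) \<in> carrier (padic_int p)" if "i < n" "j < n" for i j
    using A that by (rule mat_ring_carrierD)
  have cok: "card (carrier ?C) = nat p ^ (\<Sum>i<n. e i)"
    "card ((\<lambda>x. a \<odot>\<^bsub>?C\<^esub> x) ` carrier ?C) = nat p ^ card {i. i < n \<and> e i = 2}"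
    "\<And>X. X \<in> carrier ?C \<Longrightarrow> a \<odot>\<^bsub>?C\<^esub> X \<in> carrier ?C"
    unfolding a_def
    by (rule cokernel_cards(1)[OF p A' M red] cokernel_cards(2)[OF p A' M red] cokernel_cards(3)[OF p A' M red]; assumption)+
  note cards = module_isomorphic_cards[OF iso a cok(3)]
  obtain c where c: "(\<Sum>r | 1 \<le> r \<and> d r \<noteq> 0. d r) = d 1 + c"
    "card (carrier (module_mod p 2 H)) = nat p ^ (d 1 + 2 * c)"
    "card ((\<lambda>x. a \<odot>\<^bsub>module_mod p 2 H\<^esub> x) ` carrier (module_mod p 2 H)) = nat p ^ c"
    using module_mod_cards[OF p1 H] unfolding a_def by blast
  have np: "1 < nat p" using p1 by simp
  have "nat p ^ (\<Sum>i<n. e i) = nat p ^ (d 1 + 2 * c)"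
    using cards(1) unfolding cok(1) c(2) .
  then have sum: "(\<Sum>i<n. e i) = d 1 + 2 * c" by (simp only: power_inject_exp[OF np])
  have "nat p ^ card {i. i < n \<and> e i = 2} = nat p ^ c"
    using cards(2) unfolding cok(2) c(3) .
  then have two: "card {i. i < n \<and> e i = 2} = c" by (simp only: power_inject_exp[OF np])
  let ?E = "\<lambda>k. {i. i < n \<and> e i = k}"
  have e2: "e i \<le> 2" if "i < n" for i by (rule row_reducedD(2)[OF red that])
  have "{..<n} = ?E 0 \<union> ?E 1 \<union> ?E 2"
    using e2 by (fastforce simp: le_Suc_eq numeral_2_eq_2)
  moreover have "card (?E 0 \<union> ?E 1 \<union> ?E 2) = card (?E 0) + card (?E 1) + card (?E 2)"
    by (subst card_Un_disjoint, auto)+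
  ultimately have n: "n = card (?E 0) + card (?E 1) + c" using two by (metis card_lessThan)
  \<comment> \<open>The number of exponents 2 is already known to be \<open>c\<close>; the size
    \<open>n\<close> and the sum of the exponents are two linear equations that fix the numbers of
    exponents 1 and 0.\<close>
  have "(\<Sum>i<n. 2 - e i) = 2 * card (?E 0) + card (?E 1)"
    by (rule row_reduced_counts(3)[OF e2 refl refl])
  moreover have "(\<Sum>i<n. 2 - e i) + (\<Sum>i<n. e i) = 2 * n"
  proof -
    have "(\<Sum>i<n. 2 - e i) + (\<Sum>i<n. e i) = (\<Sum>i<n. 2)"
      unfolding sum.distrib[symmetric] by (rule sum.cong) (use e2 in auto)
    then show ?thesis by simp
  qed
  ultimately show one: "card (?E 1) = d 1" using sum n by linarith
  show "int (card (?E 0)) = type_defect n d" unfolding type_defect_def c(1) using n one by simp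
qed

theorem theorem3p7:
  fixes p :: int
    and m n :: nat
    and x :: "nat \<Rightarrow> padic"
    and H :: "nat \<Rightarrow> (padic, 'h) module"
    and d :: "enat \<Rightarrow> nat \<Rightarrow> nat"
    and d\<^sub>0 :: "nat \<Rightarrow> int"
  assumes "prime p"
    and "\<forall>i\<in>{1..m}. x i \<in> carrier (padic_int p)"
    and "inj_on (\<lambda>i. padic_reduce p 1 (x i)) {1..m}"
    and "\<forall>i\<in>{1..m}. has_type p (H i) (\<lambda>r. d r i)"
    and "\<forall>i\<in>{1..m}. d\<^sub>0 i = type_defect n (\<lambda>r. d r i)"
    and "(n, H) \<in> C_set p m x"
  shows "\<exists>\<alpha>0 \<alpha>1 :: nat.
    int \<alpha>0 \<ge> (MAX i\<in>{1..m}. d\<^sub>0 i) \<and>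
    2 * int \<alpha>0 + int \<alpha>1 \<ge> (MAX i\<in>{1..m}. 2 * d\<^sub>0 i + int (d 1 i)) \<and>
    (\<Sum>i = 1..m. d\<^sub>0 i) - (int m - 1) * int \<alpha>0 \<ge> 0 \<and>
    ((\<Sum>i = 1..m. d\<^sub>0 i) - (int m - 1) * int \<alpha>0) +
      ((\<Sum>i = 1..m. min (int (d 1 i)) (int \<alpha>1)) - (int m - 2) * int \<alpha>1) \<ge> 0"
proof (cases "m = 0")
  case True
  \<comment> \<open>The maxima over the empty set are unspecified integers, but no upper bound on the \<open>\<alpha>\<close> remains.\<close>
  define \<alpha>0 where "\<alpha>0 = nat (MAX i\<in>{1..m}. d\<^sub>0 i)"
  define \<alpha>1 where "\<alpha>1 = nat (MAX i\<in>{1..m}. 2 * d\<^sub>0 i + int (d 1 i))"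
  have "int \<alpha>0 \<ge> (MAX i\<in>{1..m}. d\<^sub>0 i)" unfolding \<alpha>0_def by simp
  moreover have "2 * int \<alpha>0 + int \<alpha>1 \<ge> (MAX i\<in>{1..m}. 2 * d\<^sub>0 i + int (d 1 i))" unfolding \<alpha>1_def by simp
  ultimately show ?thesis using True by (intro exI[of _ \<alpha>0] exI[of _ \<alpha>1]) simp
next
  case False
  let ?I = "{1..m}"
  have I: "finite ?I" "?I \<noteq> {}" using False by auto
  have p1: "p > 1" using assms(1) by (rule prime_gt_1_int)
  have pe: "prime_elem p" using assms(1) by (rule prime_imp_prime_elem)
  have xi: "x i \<in> carrier (padic_int p)" if "i \<in> ?I" for i using assms(2) that by blast
  have Hi: "module (padic_int p) (H i)" if "i \<in> ?I" for i
    using assms(6) that by (auto simp: C_set_def B_set_def fg_module_def)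
  obtain P where P: "first_integral p n P"
    and iso: "\<And>i. i \<in> ?I \<Longrightarrow> module_isomorphic (padic_mod p 2)
        (cokernel_mod p 2 n (mat_poly_eval (padic_int p) n P (x i))) (module_mod p 2 (H i))"
    using assms(6) by (auto simp: C_set_def)
  obtain B0 B1 B2 where B: "\<And>y. y \<in> carrier (padic_int p) \<Longrightarrow>
      mat_poly_eval (padic_int p) n P y \<in> carrier (mat_ring (padic_int p) n) \<and>
      (\<forall>i<n. \<forall>j<n. mat_poly_eval (padic_int p) n P y (i, j) 2 =
        poly [:B0 i j, B1 i j, p * B2 i j:] (y 2) mod p ^ 2)"
    using first_integral_eval[OF p1 P] by blast
  define Q where "Q a b = [:B0 a b, B1 a b, p * B2 a b:]" for a b
  \<comment> \<open>Each p-adic point enters only through its residue \<open>x i 2\<close> modulo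
    p^2, so the reduction takes place over the integers.\<close>
  have "\<exists>T. row_reduced p 2 n n (\<lambda>a b. poly (Q a b) (x i 2)) (fst T) (fst (snd T)) (snd (snd T))" for i
    using row_reduced_exists[OF pe] by (metis fst_conv snd_conv)
  then obtain T where T: "\<And>i. row_reduced p 2 n n (\<lambda>a b. poly (Q a b) (x i 2)) (fst (T i)) (fst (snd (T i))) (snd (snd (T i)))"
    by metis
  define e where "e i = fst (snd (T i))" for i
  define e0 where "e0 i = card {a. a < n \<and> e i a = 0}" for i
  define e1 where "e1 i = card {a. a < n \<and> e i a = 1}" for i
  have e: "d\<^sub>0 i = int (e0 i)" "d 1 i = e1 i" if i: "i \<in> ?I" for i
  proof -
    note ty = row_reduced_type[OF assms(1) _ _ T[of i] Hi[OF i] bspec[OF assms(4) i] iso[OF i]]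
    have A: "mat_poly_eval (padic_int p) n P (x i) \<in> carrier (mat_ring (padic_int p) n)"
      "\<And>a b. a < n \<Longrightarrow> b < n \<Longrightarrow> mat_poly_eval (padic_int p) n P (x i) (a, b) 2 = poly (Q a b) (x i 2) mod p ^ 2"
      using B[OF xi[OF i]] unfolding Q_def by blast+
    show "d\<^sub>0 i = int (e0 i)" using ty(1)[OF A] bspec[OF assms(5) i] unfolding e0_def e_def by simp
    show "d 1 i = e1 i" using ty(2)[OF A] unfolding e1_def e_def by simp
  qed
  have dist: "\<not> p dvd x i 2 - x j 2" if "i \<in> ?I" "j \<in> ?I" "i \<noteq> j" for i j
  proof
    assume "p dvd x i 2 - x j 2"
    then have "x i 2 mod p ^ 1 = x j 2 mod p ^ 1" by (simp add: mod_eq_dvd_iff)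
    then have "x i 1 = x j 1" using padic_level_mod[OF xi[OF that(1)], of 1 2] padic_level_mod[OF xi[OF that(2)], of 1 2] by simp
    then have "padic_reduce p 1 (x i) = padic_reduce p 1 (x j)"
      using padic_reduce_eq_iff[OF p1 xi[OF that(1)] xi[OF that(2)], of 1] by (simp add: one_enat_def)
    then show False using inj_onD[OF assms(3)] that by blast
  qed
  have "\<exists>\<alpha>0 \<alpha>1. (\<forall>i\<in>?I. e0 i \<le> \<alpha>0 \<and> 2 * e0 i + e1 i \<le> 2 * \<alpha>0 + \<alpha>1) \<and>
    (\<Sum>i\<in>?I. \<alpha>0 - e0 i) \<le> \<alpha>0 \<and> (\<Sum>i\<in>?I. \<alpha>0 + \<alpha>1 - e0 i - min (e1 i) \<alpha>1) \<le> \<alpha>0 + 2 * \<alpha>1"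
    by (rule pencil_inequalities[where x = "\<lambda>i. x i 2", OF pe I(1) dist T[unfolded Q_def, folded e_def] e0_def e1_def])
  then obtain \<alpha>0 \<alpha>1 where \<alpha>: "\<And>i. i \<in> ?I \<Longrightarrow> e0 i \<le> \<alpha>0" "\<And>i. i \<in> ?I \<Longrightarrow> 2 * e0 i + e1 i \<le> 2 * \<alpha>0 + \<alpha>1"
    and s0: "(\<Sum>i\<in>?I. \<alpha>0 - e0 i) \<le> \<alpha>0"
    and s1: "(\<Sum>i\<in>?I. \<alpha>0 + \<alpha>1 - e0 i - min (e1 i) \<alpha>1) \<le> \<alpha>0 + 2 * \<alpha>1" by blast
  have b0: "(MAX i\<in>?I. d\<^sub>0 i) \<le> int \<alpha>0"
    using I \<alpha>(1) e by (subst Max_le_iff) auto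
  have b1: "(MAX i\<in>?I. 2 * d\<^sub>0 i + int (d 1 i)) \<le> 2 * int \<alpha>0 + int \<alpha>1"
  proof (subst Max_le_iff)
    have "2 * d\<^sub>0 i + int (d 1 i) \<le> 2 * int \<alpha>0 + int \<alpha>1" if "i \<in> ?I" for i
      using \<alpha>(2)[OF that] e[OF that] by linarith
    then show "\<forall>a\<in>(\<lambda>i. 2 * d\<^sub>0 i + int (d 1 i)) ` ?I. a \<le> 2 * int \<alpha>0 + int \<alpha>1" by blast
  qed (use I in auto)
  \<comment> \<open>The passage to integers is exact, here and in \<open>c1\<close>: none of the
    differences is truncated, because \<open>e0 i \<le> \<alpha>0\<close> and
    \<open>min (e1 i) \<alpha>1 \<le> \<alpha>1\<close>.\<close>
  have c0: "int (\<Sum>i\<in>?I. \<alpha>0 - e0 i) = (\<Sum>i\<in>?I. int \<alpha>0 - d\<^sub>0 i)"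
    unfolding of_nat_sum by (rule sum.cong) (use \<alpha>(1) e in auto)
  have b2: "int m * int \<alpha>0 - (\<Sum>i\<in>?I. d\<^sub>0 i) \<le> int \<alpha>0"
    using of_nat_mono[OF s0, where 'a = int] unfolding c0 by (simp add: sum_subtractf)
  have c1: "int (\<Sum>i\<in>?I. \<alpha>0 + \<alpha>1 - e0 i - min (e1 i) \<alpha>1) =
      (\<Sum>i\<in>?I. int \<alpha>0 + int \<alpha>1 - d\<^sub>0 i - min (int (d 1 i)) (int \<alpha>1))"
    unfolding of_nat_sum
  proof (rule sum.cong[OF refl])
    fix i assume i: "i \<in> ?I"
    show "int (\<alpha>0 + \<alpha>1 - e0 i - min (e1 i) \<alpha>1) = int \<alpha>0 + int \<alpha>1 - d\<^sub>0 i - min (int (d 1 i)) (int \<alpha>1)"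
      using \<alpha>(1)[OF i] e[OF i] by (auto simp: min_def)
  qed
  have b3: "int m * (int \<alpha>0 + int \<alpha>1) - (\<Sum>i\<in>?I. d\<^sub>0 i) - (\<Sum>i\<in>?I. min (int (d 1 i)) (int \<alpha>1)) \<le> int \<alpha>0 + 2 * int \<alpha>1"
    using of_nat_mono[OF s1, where 'a = int] unfolding c1 by (simp add: sum_subtractf)
  show ?thesis
  proof (rule exI[of _ \<alpha>0], rule exI[of _ \<alpha>1], intro conjI)
    show "0 \<le> (\<Sum>i = 1..m. d\<^sub>0 i) - (int m - 1) * int \<alpha>0"
      using b2 by (simp only: left_diff_distrib mult_1_left)
    show "0 \<le> (\<Sum>i = 1..m. d\<^sub>0 i) - (int m - 1) * int \<alpha>0 +
        ((\<Sum>i = 1..m. min (int (d 1 i)) (int \<alpha>1)) - (int m - 2) * int \<alpha>1)"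
      using b3 by (simp only: left_diff_distrib distrib_left mult_1_left)
  qed (rule b0 b1)+
qed

end
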